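(* Let $R$ be a countable unital commutative ring which is an integral domain; in case the characteristic of $R$ is positive, assume that the field of fractions of $R$ is not an algebraic extension of its prime field. For $n \geq 3$, let $G = \mathrm{GL}_n(R)$ or $G = \mathrm{SL}_n(R)$. Then there exists an infinite dimensional irreducible unitary representation of $G$ which is traceable.
   Context: $G$ is considered as a discrete group. Unitary representations of $G$ are homomorphisms $\pi: G \to U(\mathcal H)$ into the unitary group of a complex separable Hilbert space $\mathcal H$. The maximal $C^*$-algebra $C^*(G)$ is the completion of the group algebra $\mathbf C[G]$ for the norm $f \mapsto \sup_\pi \|\pi(f)\|$, the supremum being over all unitary representations $\pi$ of $G$ on separable Hilbert spaces; every unitary representation $\pi$ of $G$ extends uniquely to a $*$-representation $\pi : C^*(G) \to \mathcal B(\mathcal H)$. An irreducible unitary representation $(\pi, \mathcal H)$ of $G$ is traceable if $\pi(C^*(G))$ (equivalently, the $C^*$-subalgebra of $\mathcal B(\mathcal H)$ generated by $\pi(G)$) contains the algebra of compact operators on $\mathcal H$. *)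

theory Defs
  imports
    "HOL-Analysis.Abstract_Metric_Spaces"
    "HOL-Algebra.Algebraic_Closure_Type"
    "HOL-Computational_Algebra.Fraction_Field"
    "Jordan_Normal_Form.Determinant"
begin

section \<open>Rings and linear groups\<close>

definition prime_field :: "'k::field set" where
  "prime_field = \<Inter>{K. subfield K ring_of_type_algebra}"

definition algebraic_over_prime_field :: "'k::field itself \<Rightarrow> bool" where
  "algebraic_over_prime_field _ \<longleftrightarrow>
     (\<forall>x::'k. (ring.algebraic ring_of_type_algebra over prime_field) x)"

definition GL :: "nat \<Rightarrow> 'a::comm_ring_1 mat monoid" where
  "GL n = units_of (ring_mat TYPE('a) n ())"

definition SL :: "nat \<Rightarrow> 'a::comm_ring_1 mat monoid" where
  "SL n = (GL n)\<lparr>carrier := {A \<in> carrier_mat n n. det A = 1}\<rparr>"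


section \<open>Complex Hilbert spaces\<close>

text \<open>
  Hilbert spaces are structures with an explicit carrier, so that one can quantify over
  them existentially. Every separable Hilbert space has at most the cardinality of the
  continuum, hence is isomorphic to one whose carrier is a subset of
  \<^typ>\<open>nat \<Rightarrow> complex\<close>. As for any \<^typ>\<open>('a, 'b) module\<close>, the record fields
  for multiplication and its unit are present but carry no meaning.
\<close>

record 'v hilbert = "(complex, 'v) module" +
  hinner :: "'v \<Rightarrow> 'v \<Rightarrow> complex"

definition hnorm :: "'v hilbert \<Rightarrow> 'v \<Rightarrow> real" where
  "hnorm H x = sqrt (Re (hinner H x x))"

text \<open>\<^locale>\<open>Metric_space\<close> constrains the distance also outside the
  carrier, whence the case distinction.\<close>

definition hdist :: "'v hilbert \<Rightarrow> 'v \<Rightarrow> 'v \<Rightarrow> real" where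
  "hdist H x y =
     (if x \<in> carrier H \<and> y \<in> carrier H then hnorm H (x \<ominus>\<^bsub>H\<^esub> y) else 0)"

abbreviation htopology :: "'v hilbert \<Rightarrow> 'v topology" where
  "htopology H \<equiv> Metric_space.mtopology (carrier H) (hdist H)"

locale hilbert_space = module "ring_of_type_algebra :: complex ring" H
  for H :: "'v hilbert" (structure) +
  assumes inner_add_left:
      "\<lbrakk>x \<in> carrier H; y \<in> carrier H; z \<in> carrier H\<rbrakk> \<Longrightarrow>
        hinner H (x \<oplus> y) z = hinner H x z + hinner H y z"
    and inner_smult_left:
      "\<lbrakk>x \<in> carrier H; y \<in> carrier H\<rbrakk> \<Longrightarrow> hinner H (c \<odot> x) y = c * hinner H x y"
    and inner_commute:
      "\<lbrakk>x \<in> carrier H; y \<in> carrier H\<rbrakk> \<Longrightarrow> hinner H y x = cnj (hinner H x y)"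
    and inner_nonneg: "x \<in> carrier H \<Longrightarrow> 0 \<le> Re (hinner H x x)"
    and inner_definite: "\<lbrakk>x \<in> carrier H; hinner H x x = 0\<rbrakk> \<Longrightarrow> x = \<zero>"
    and complete: "Metric_space.mcomplete (carrier H) (hdist H)"

context hilbert_space begin

lemma complex_ring_simps [simp]:
  "carrier (ring_of_type_algebra::complex ring) = UNIV"
  "\<one>\<^bsub>ring_of_type_algebra::complex ring\<^esub> = 1" "\<zero>\<^bsub>ring_of_type_algebra::complex ring\<^esub> = 0"
  "x \<oplus>\<^bsub>ring_of_type_algebra::complex ring\<^esub> y = x + y"
  "x \<otimes>\<^bsub>ring_of_type_algebra::complex ring\<^esub> y = x * y"
  by (auto simp: ring_of_type_algebra_def)

lemma smult_closed_complex [simp]: "x \<in> carrier H \<Longrightarrow> c \<odot> x \<in> carrier H"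
  using smult_closed[of c x] by simp

lemma uminus_eq_smult:
  assumes "x \<in> carrier H"
  shows "\<ominus> x = (-1) \<odot> x"
proof -
  have "(1 + (-1)) \<odot> x = 1 \<odot> x \<oplus> (-1) \<odot> x" using assms smult_l_distr[of 1 "-1" x] by simp
  moreover have "1 \<odot> x = x" using smult_one[of x] assms by simp
  moreover have "0 \<odot> x = \<zero>" using smult_l_null[of x] assms by simp
  ultimately show ?thesis using assms
    by (metis M.add.inv_unique' add.right_inverse minus_equality smult_closed_complex M.a_comm)
qed

lemma inner_add_right:
  "\<lbrakk>x \<in> carrier H; y \<in> carrier H; z \<in> carrier H\<rbrakk> \<Longrightarrow>
    hinner H z (x \<oplus> y) = hinner H z x + hinner H z y"
  by (metis inner_add_left inner_commute complex_cnj_add M.add.m_closed)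

lemma inner_smult_right:
  "\<lbrakk>x \<in> carrier H; y \<in> carrier H\<rbrakk> \<Longrightarrow>
    hinner H x (c \<odot> y) = cnj c * hinner H x y"
  by (metis inner_smult_left inner_commute complex_cnj_mult smult_closed_complex)

lemma Im_inner_self: "x \<in> carrier H \<Longrightarrow> Im (hinner H x x) = 0"
  using inner_commute[of x x] by (simp add: complex_eq_iff)

lemma hnorm_triangle:
  assumes "x \<in> carrier H" "y \<in> carrier H"
  shows "hnorm H (x \<oplus> y) \<le> hnorm H x + hnorm H y"
proof -
  define a where "a = Re (hinner H x x)" define b where "b = Re (hinner H y y)"
  define c where "c = Re (hinner H x y)"
  have cc: "Re (hinner H y x) = c" using inner_commute[of x y] assms by (simp add: c_def)
  have q: "0 \<le> a + 2*t*c + t^2*b" for t :: real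
  proof -
    have "0 \<le> Re (hinner H (x \<oplus> complex_of_real t \<odot> y) (x \<oplus> complex_of_real t \<odot> y))"
      using assms by (intro inner_nonneg) simp
    also have "\<dots> = a + 2*t*c + t^2*b"
      using assms cc by (simp add: inner_add_left inner_add_right inner_smult_right inner_smult_left
          a_def b_def c_def algebra_simps power2_eq_square)
    finally show ?thesis .
  qed
  have a0: "0 \<le> a" and b0: "0 \<le> b" using assms inner_nonneg by (auto simp: a_def b_def)
  have "c^2 \<le> a*b"
  proof (cases "b = 0")
    case True
    have "c = 0"
    proof (rule ccontr)
      assume "c \<noteq> 0"
      with q[of "-(a+1)/(2*c)"] True show False by simp
    qed
    then show ?thesis using True by simp
  next
    case False
    with q[of "-c/b"] b0 show ?thesis by (simp add: field_simps power2_eq_square split: if_splits)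
  qed
  then have "c \<le> sqrt a * sqrt b" by (metis real_le_rsqrt real_sqrt_mult)
  then have "a + 2*c + b \<le> (sqrt a + sqrt b)^2" using a0 b0 by (simp add: power2_sum)
  moreover have "Re (hinner H (x \<oplus> y) (x \<oplus> y)) = a + 2*c + b"
    using assms cc by (simp add: inner_add_left inner_add_right a_def b_def c_def)
  ultimately show ?thesis unfolding hnorm_def using a0 b0 by (simp add: real_le_lsqrt a_def b_def)
qed

lemma hnorm_uminus: "x \<in> carrier H \<Longrightarrow> hnorm H (\<ominus> x) = hnorm H x"
  by (simp add: uminus_eq_smult hnorm_def inner_smult_left inner_smult_right)

lemma Metric_space_hdist: "Metric_space (carrier H) (hdist H)"
proof
  fix x y z
  show "0 \<le> hdist H x y" by (auto simp: hdist_def hnorm_def inner_nonneg)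
  have "x \<in> carrier H \<Longrightarrow> y \<in> carrier H \<Longrightarrow> y \<ominus> x = \<ominus> (x \<ominus> y)"
    by (simp add: a_minus_def M.minus_add M.a_comm)
  then show "hdist H x y = hdist H y x" by (auto simp: hdist_def hnorm_uminus)
  { assume "x \<in> carrier H" "y \<in> carrier H"
    then have "hnorm H (x \<ominus> y) = 0 \<longleftrightarrow> x \<ominus> y = \<zero>"
      using inner_definite[of "x \<ominus> y"] Im_inner_self[of "x \<ominus> y"]
        inner_smult_left[of \<zero> \<zero> 0] smult_l_null[of \<zero>]
      by (auto simp: hnorm_def complex_eq_iff)
    then show "(hdist H x y = 0) = (x = y)" using \<open>x \<in> _\<close> \<open>y \<in> _\<close>
      by (auto simp: hdist_def M.r_neg a_minus_def)
        (metis M.minus_equality M.minus_minus M.a_inv_closed M.a_comm) }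
  assume *: "x \<in> carrier H" "y \<in> carrier H" "z \<in> carrier H"
  have "x \<ominus> z = (x \<ominus> y) \<oplus> (y \<ominus> z)" using *
    by (simp add: a_minus_def M.a_assoc M.r_neg1)
  with hnorm_triangle[of "x \<ominus> y" "y \<ominus> z"] *
  show "hdist H x z \<le> hdist H x y + hdist H y z" by (simp add: hdist_def)
qed

end

definition subspace_of :: "'v set \<Rightarrow> 'v hilbert \<Rightarrow> bool" where
  "subspace_of W H \<longleftrightarrow> submodule W (ring_of_type_algebra :: complex ring) H"

definition infinite_dimensional :: "'v hilbert \<Rightarrow> bool" where
  "infinite_dimensional H \<longleftrightarrow>
     \<not> (\<exists>S. finite S \<and> S \<subseteq> carrier H \<and> (\<forall>W. subspace_of W H \<and> S \<subseteq> W \<longrightarrow> W = carrier H))"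


section \<open>Operators\<close>

text \<open>Operators are functions that are \<^const>\<open>undefined\<close> outside the carrier, so that
  equality of operators is equality of functions.\<close>

definition bounded_operators :: "'v hilbert \<Rightarrow> ('v \<Rightarrow> 'v) set" where
  "bounded_operators H = {T \<in> carrier H \<rightarrow>\<^sub>E carrier H.
     (\<forall>x\<in>carrier H. \<forall>y\<in>carrier H. T (x \<oplus>\<^bsub>H\<^esub> y) = T x \<oplus>\<^bsub>H\<^esub> T y) \<and>
     (\<forall>c. \<forall>x\<in>carrier H. T (c \<odot>\<^bsub>H\<^esub> x) = c \<odot>\<^bsub>H\<^esub> T x) \<and>
     (\<exists>K. \<forall>x\<in>carrier H. hnorm H (T x) \<le> K * hnorm H x)}"

definition compact_operators :: "'v hilbert \<Rightarrow> ('v \<Rightarrow> 'v) set" where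
  "compact_operators H = {T \<in> bounded_operators H.
     compactin (htopology H)
       (htopology H closure_of (T ` {x \<in> carrier H. hnorm H x \<le> 1}))}"

definition is_adjoint :: "'v hilbert \<Rightarrow> ('v \<Rightarrow> 'v) \<Rightarrow> ('v \<Rightarrow> 'v) \<Rightarrow> bool" where
  "is_adjoint H T S \<longleftrightarrow>
     (\<forall>x\<in>carrier H. \<forall>y\<in>carrier H. hinner H (T x) y = hinner H x (S y))"

text \<open>In the last clause, the displayed inequality says that the operator norm of
  \<open>T - S\<close> is at most \<open>\<epsilon>\<close>.\<close>

definition cstar_subalgebra :: "'v hilbert \<Rightarrow> ('v \<Rightarrow> 'v) set \<Rightarrow> bool" where
  "cstar_subalgebra H A \<longleftrightarrow>
     A \<subseteq> bounded_operators H \<and>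
     (\<lambda>x\<in>carrier H. \<zero>\<^bsub>H\<^esub>) \<in> A \<and>
     (\<forall>S\<in>A. \<forall>T\<in>A. (\<lambda>x\<in>carrier H. S x \<oplus>\<^bsub>H\<^esub> T x) \<in> A) \<and>
     (\<forall>c. \<forall>T\<in>A. (\<lambda>x\<in>carrier H. c \<odot>\<^bsub>H\<^esub> T x) \<in> A) \<and>
     (\<forall>S\<in>A. \<forall>T\<in>A. compose (carrier H) S T \<in> A) \<and>
     (\<forall>T\<in>A. \<forall>S\<in>bounded_operators H. is_adjoint H T S \<longrightarrow> S \<in> A) \<and>
     (\<forall>T\<in>bounded_operators H.
        (\<forall>\<epsilon>>0. \<exists>S\<in>A. \<forall>x\<in>carrier H. hdist H (T x) (S x) \<le> \<epsilon> * hnorm H x) \<longrightarrow> T \<in> A)"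

definition cstar_generated :: "'v hilbert \<Rightarrow> ('v \<Rightarrow> 'v) set \<Rightarrow> ('v \<Rightarrow> 'v) set" where
  "cstar_generated H S = \<Inter>{A. cstar_subalgebra H A \<and> S \<subseteq> A}"


section \<open>Unitary representations\<close>

definition unitary_group :: "'v hilbert \<Rightarrow> ('v \<Rightarrow> 'v) monoid" where
  "unitary_group H =
    \<lparr>carrier = {T \<in> bounded_operators H. T ` carrier H = carrier H \<and>
       (\<forall>x\<in>carrier H. \<forall>y\<in>carrier H. hinner H (T x) (T y) = hinner H x y)},
     monoid.mult = compose (carrier H),
     one = (\<lambda>x\<in>carrier H. x)\<rparr>"

definition unitary_rep :: "'g monoid \<Rightarrow> 'v hilbert \<Rightarrow> ('g \<Rightarrow> 'v \<Rightarrow> 'v) \<Rightarrow> bool" where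
  "unitary_rep G H \<pi> \<longleftrightarrow>
     hilbert_space H \<and> separable_space (htopology H) \<and> \<pi> \<in> hom G (unitary_group H)"

definition irreducible_rep :: "'g monoid \<Rightarrow> 'v hilbert \<Rightarrow> ('g \<Rightarrow> 'v \<Rightarrow> 'v) \<Rightarrow> bool" where
  "irreducible_rep G H \<pi> \<longleftrightarrow>
     carrier H \<noteq> {\<zero>\<^bsub>H\<^esub>} \<and>
     (\<forall>W. subspace_of W H \<and> closedin (htopology H) W \<and>
          (\<forall>g\<in>carrier G. \<pi> g ` W \<subseteq> W) \<longrightarrow> W = {\<zero>\<^bsub>H\<^esub>} \<or> W = carrier H)"

text \<open>The image of the maximal C*-algebra of a discrete group \<open>G\<close> under a unitary
  representation \<open>\<pi>\<close> is the C*-algebra of operators generated by \<open>\<pi>(G)\<close>.\<close>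

definition traceable :: "'g monoid \<Rightarrow> 'v hilbert \<Rightarrow> ('g \<Rightarrow> 'v \<Rightarrow> 'v) \<Rightarrow> bool" where
  "traceable G H \<pi> \<longleftrightarrow> compact_operators H \<subseteq> cstar_generated H (\<pi> ` carrier G)"

end

theory Submission
  imports Defs "HOL-Analysis.Infinite_Sum" "HOL-Analysis.Function_Topology" "HOL-Analysis.L2_Norm"
begin

text \<open>
  Let \<open>X\<close> be the \<open>G\<close>-orbit of the line through the first basis vector, and let \<open>G\<close> act on
  the square-summable functions on \<open>X\<close> by permuting \<open>X\<close>. This representation is irreducible and
  traceable as soon as the C*-algebra generated by the image of \<open>G\<close> contains the rank one
  projection onto the point mass at the base point: \<open>G\<close> is transitive on \<open>X\<close>, so translates of
  this projection are all the matrix units, whose span is dense in the compact operators, and a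
  closed invariant subspace other than \<open>0\<close> contains one point mass, hence all of them.

  To obtain the projection it suffices to find finitely many elements \<open>s\<close> of \<open>G\<close> that fix the base
  point and satisfy a spectral gap inequality \<open>\<parallel>f\<parallel> \<le> c * (\<Sum>s. \<parallel>s f - f\<parallel>)\<close> for all
  \<open>f\<close> vanishing at the base point. The average of the operators \<open>(1 + s) / 2\<close> then fixes the point
  mass at the base point and is a strict contraction on the functions vanishing there, so that its
  powers converge in norm to the projection (\<open>walk_power_limit\<close>).

  The gap comes from a paradoxical decomposition, and this is where \<open>n \<ge> 3\<close> enters. A line
  other than the base point has a nonzero coordinate \<open>v\<^sub>i\<close> with \<open>i \<ge> 1\<close> (indices start from \<open>0\<close>),
  and there is a second such index \<open>j\<close>. Elementary matrices in these two coordinates fix the base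
  point. The lines with \<open>(v\<^sub>i, v\<^sub>j) \<noteq> 0\<close> are covered by the two halves ``\<open>v\<^sub>i\<close> is not larger than
  \<open>v\<^sub>j\<close>'' and ``\<open>v\<^sub>j\<close> is not larger than \<open>v\<^sub>i\<close>'', and each half has three pairwise disjoint translates
  under row operations \<open>v\<^sub>i := v\<^sub>i + s\<^sub>k * v\<^sub>j\<close>. An almost invariant unit vector would give each half
  a mass of not much more than one third, which is too little (\<open>gap_from_paradox\<close>).

  What remains is to compare sizes of elements of \<open>R\<close> (\<open>size_relation_exists\<close>). In characteristic
  \<open>0\<close>, the additive group of \<open>R\<close> is torsion free and carries a total order; the translations are by
  \<open>0\<close>, \<open>3\<close> and \<open>6\<close>. In positive characteristic, the hypothesis on \<open>R\<close> yields an element \<open>t\<close> whose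
  powers are distinct, and the fraction field has a valuation ring that does not contain \<open>t\<close>; the
  translations are by \<open>0\<close>, \<open>t\<close> and \<open>t\<^sup>2\<close>. The first of these relations is not compatible with
  multiplication by units and hence makes sense for vectors, but not for lines. The units form a
  commutative group, however, so there is an invariant mean on them
  (\<open>invariant_mean_exists\<close>), and averaging over the multiples of a vector turns the two halves into
  functions on lines with values in \<open>[0, 1]\<close>. Such functions serve as well as sets.
\<close>

section \<open>Square-summable functions\<close>

definition l2 :: "('i \<Rightarrow> complex) set" where
  "l2 = {f. (\<lambda>i. (cmod (f i))\<^sup>2) summable_on UNIV}"

definition l2_norm :: "('i \<Rightarrow> complex) \<Rightarrow> real" where
  "l2_norm f = sqrt (\<Sum>\<^sub>\<infinity>i. (cmod (f i))\<^sup>2)"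

lemma l2_norm_power2: "(l2_norm f)\<^sup>2 = (\<Sum>\<^sub>\<infinity>i. (cmod (f i))\<^sup>2)"
  by (simp add: l2_norm_def infsum_nonneg)

lemma l2_norm_nonneg [simp]: "0 \<le> l2_norm f"
  by (simp add: l2_norm_def infsum_nonneg)

text \<open>
  Bounds are derived from finite partial sums, because the inequalities of Minkowski and
  Cauchy-Schwarz are then those for \<^const>\<open>L2_set\<close>.
\<close>
lemma l2_boundedI:
  assumes "\<And>F. finite F \<Longrightarrow> L2_set (\<lambda>i. cmod (f i)) F \<le> B"
  shows "f \<in> l2" and "l2_norm f \<le> B"
proof -
  have B: "0 \<le> B" using assms[of "{}"] by simp
  have *: "(\<Sum>i\<in>F. (cmod (f i))\<^sup>2) \<le> B\<^sup>2" if "finite F" for F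
    using assms[OF that] B by (simp add: L2_set_def real_sqrt_le_iff sqrt_le_D)
  show 1: "f \<in> l2"
    unfolding l2_def mem_Collect_eq
    by (rule nonneg_bdd_above_summable_on) (auto intro!: bdd_aboveI[of _ "B\<^sup>2"] *)
  show "l2_norm f \<le> B"
    unfolding l2_norm_def using 1 B
    by (intro real_le_lsqrt infsum_le_finite_sums) (auto simp: l2_def intro: *)
qed

lemma L2_set_le_l2_norm:
  assumes "f \<in> l2" "finite F"
  shows "L2_set (\<lambda>i. cmod (f i)) F \<le> l2_norm f"
  unfolding L2_set_def l2_norm_def
  using assms by (intro real_sqrt_le_mono finite_sum_le_infsum) (auto simp: l2_def)

lemma cmod_le_l2_norm: "f \<in> l2 \<Longrightarrow> cmod (f i) \<le> l2_norm f"
  using L2_set_le_l2_norm[of f "{i}"] by simp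

lemma l2_norm_eq_0: "f \<in> l2 \<Longrightarrow> l2_norm f = 0 \<Longrightarrow> f = (\<lambda>i. 0)"
  using cmod_le_l2_norm by (metis norm_le_zero_iff)

lemma l2_zero [simp]: "(\<lambda>i. 0) \<in> l2" and l2_norm_zero [simp]: "l2_norm (\<lambda>i. 0) = 0"
  by (auto simp: l2_def l2_norm_def)

lemma l2_add:
  assumes "f \<in> l2" "g \<in> l2"
  shows "(\<lambda>i. f i + g i) \<in> l2" and "l2_norm (\<lambda>i. f i + g i) \<le> l2_norm f + l2_norm g"
proof -
  have "L2_set (\<lambda>i. cmod (f i + g i)) F \<le> l2_norm f + l2_norm g" if "finite F" for F
  proof -
    have "L2_set (\<lambda>i. cmod (f i + g i)) F \<le> L2_set (\<lambda>i. cmod (f i) + cmod (g i)) F"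
      by (intro L2_set_mono) (auto simp: norm_triangle_ineq)
    also have "\<dots> \<le> L2_set (\<lambda>i. cmod (f i)) F + L2_set (\<lambda>i. cmod (g i)) F"
      by (rule L2_set_triangle_ineq)
    finally show ?thesis using L2_set_le_l2_norm[OF assms(1) that] L2_set_le_l2_norm[OF assms(2) that]
      by linarith
  qed
  from l2_boundedI[OF this]
  show "(\<lambda>i. f i + g i) \<in> l2" and "l2_norm (\<lambda>i. f i + g i) \<le> l2_norm f + l2_norm g" by auto
qed

lemma l2_smult:
  assumes "f \<in> l2"
  shows "(\<lambda>i. c * f i) \<in> l2" and "l2_norm (\<lambda>i. c * f i) = cmod c * l2_norm f"
proof -
  show "(\<lambda>i. c * f i) \<in> l2"
    using assms by (auto simp: l2_def norm_mult power_mult_distrib intro: summable_on_cmult_right)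
  show "l2_norm (\<lambda>i. c * f i) = cmod c * l2_norm f"
    by (simp add: l2_norm_def norm_mult power_mult_distrib infsum_cmult_right' real_sqrt_mult)
qed

lemma l2_diff:
  assumes "f \<in> l2" "g \<in> l2"
  shows "(\<lambda>i. f i - g i) \<in> l2" and "l2_norm (\<lambda>i. f i - g i) \<le> l2_norm f + l2_norm g"
  using l2_add[OF assms(1) l2_smult(1)[OF assms(2), of "-1"]] l2_smult(2)[OF assms(2), of "-1"] by auto

lemma l2_norm_minus_commute: "l2_norm (\<lambda>i. f i - g i) = l2_norm (\<lambda>i. g i - f i)"
  by (simp add: l2_norm_def norm_minus_commute)

lemma l2_norm_triangle_sub:
  assumes "f \<in> l2" "g \<in> l2" "h \<in> l2"
  shows "l2_norm (\<lambda>i. f i - h i) \<le> l2_norm (\<lambda>i. f i - g i) + l2_norm (\<lambda>i. g i - h i)"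
  using l2_add(2)[OF l2_diff(1)[OF assms(1,2)] l2_diff(1)[OF assms(2,3)]] by simp

lemma l2_sum:
  assumes "finite I" "\<And>k. k \<in> I \<Longrightarrow> f k \<in> l2"
  shows "(\<lambda>i. \<Sum>k\<in>I. f k i) \<in> l2" and "l2_norm (\<lambda>i. \<Sum>k\<in>I. f k i) \<le> (\<Sum>k\<in>I. l2_norm (f k))"
proof -
  have "(\<lambda>i. \<Sum>k\<in>I. f k i) \<in> l2 \<and> l2_norm (\<lambda>i. \<Sum>k\<in>I. f k i) \<le> (\<Sum>k\<in>I. l2_norm (f k))"
    using assms
  proof (induction I rule: finite_induct)
    case (insert k I)
    then have "(\<lambda>i. \<Sum>k\<in>I. f k i) \<in> l2" "f k \<in> l2" "l2_norm (\<lambda>i. \<Sum>k\<in>I. f k i) \<le> (\<Sum>k\<in>I. l2_norm (f k))"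
      by auto
    with l2_add[OF this(2,1)] insert.hyps show ?case by simp
  qed simp
  then show "(\<lambda>i. \<Sum>k\<in>I. f k i) \<in> l2" "l2_norm (\<lambda>i. \<Sum>k\<in>I. f k i) \<le> (\<Sum>k\<in>I. l2_norm (f k))" by auto
qed

lemma l2_mono:
  assumes "g \<in> l2" "\<And>i. cmod (f i) \<le> cmod (g i)"
  shows "f \<in> l2" and "l2_norm f \<le> l2_norm g"
proof -
  have "L2_set (\<lambda>i. cmod (f i)) F \<le> l2_norm g" if "finite F" for F
    using L2_set_mono[of F "\<lambda>i. cmod (f i)" "\<lambda>i. cmod (g i)"] L2_set_le_l2_norm[OF assms(1) that] assms(2)
    by force
  from l2_boundedI[OF this] show "f \<in> l2" and "l2_norm f \<le> l2_norm g" by auto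
qed

lemma l2_product_abs_summable:
  assumes "f \<in> l2" "g \<in> l2"
  shows "(\<lambda>i. cmod (f i) * cmod (g i)) summable_on UNIV"
    and "(\<Sum>\<^sub>\<infinity>i. cmod (f i) * cmod (g i)) \<le> l2_norm f * l2_norm g"
proof -
  have *: "(\<Sum>i\<in>F. cmod (f i) * cmod (g i)) \<le> l2_norm f * l2_norm g" if "finite F" for F
  proof -
    have "(\<Sum>i\<in>F. cmod (f i) * cmod (g i)) \<le> L2_set (\<lambda>i. cmod (f i)) F * L2_set (\<lambda>i. cmod (g i)) F"
      using L2_set_mult_ineq[of "\<lambda>i. cmod (f i)" "\<lambda>i. cmod (g i)" F] by simp
    also have "\<dots> \<le> l2_norm f * l2_norm g"
      using assms that by (intro mult_mono L2_set_le_l2_norm) auto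
    finally show ?thesis .
  qed
  show s: "(\<lambda>i. cmod (f i) * cmod (g i)) summable_on UNIV"
    by (rule nonneg_bdd_above_summable_on) (auto intro!: bdd_aboveI[of _ "l2_norm f * l2_norm g"] *)
  show "(\<Sum>\<^sub>\<infinity>i. cmod (f i) * cmod (g i)) \<le> l2_norm f * l2_norm g"
    using s * by (intro infsum_le_finite_sums) auto
qed

lemma l2_inner_summable:
  assumes "f \<in> l2" "g \<in> l2"
  shows "(\<lambda>i. f i * cnj (g i)) summable_on UNIV"
proof -
  have "(\<lambda>i. norm (f i * cnj (g i))) summable_on UNIV"
    using l2_product_abs_summable(1)[OF assms] by (simp add: norm_mult)
  then show ?thesis by (rule abs_summable_summable)
qed

lemma l2_finite_support:
  assumes "finite F" "\<And>i. i \<notin> F \<Longrightarrow> f i = 0"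
  shows "f \<in> l2" and "(l2_norm f)\<^sup>2 = (\<Sum>i\<in>F. (cmod (f i))\<^sup>2)"
proof -
  have "((\<lambda>i. (cmod (f i))\<^sup>2) has_sum (\<Sum>i\<in>F. (cmod (f i))\<^sup>2)) UNIV"
    using assms by (intro has_sum_finite_neutralI) auto
  then show "f \<in> l2" "(l2_norm f)\<^sup>2 = (\<Sum>i\<in>F. (cmod (f i))\<^sup>2)"
    by (auto simp: l2_def l2_norm_power2 infsumI has_sum_imp_summable)
qed

definition l2_unit :: "'i \<Rightarrow> 'i \<Rightarrow> complex" where
  "l2_unit x = (\<lambda>i. of_bool (i = x))"

lemma l2_unit [simp]: "l2_unit x \<in> l2" and l2_norm_unit [simp]: "l2_norm (l2_unit x) = 1"
proof -
  show "l2_unit x \<in> l2" by (rule l2_finite_support[of "{x}"]) (auto simp: l2_unit_def)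
  have "(l2_norm (l2_unit x))\<^sup>2 = 1"
    by (subst l2_finite_support[of "{x}"]) (auto simp: l2_unit_def)
  then show "l2_norm (l2_unit x) = 1" using l2_norm_nonneg[of "l2_unit x"] by (simp add: power2_eq_1_iff)
qed

definition l2_cut :: "'i set \<Rightarrow> ('i \<Rightarrow> complex) \<Rightarrow> 'i \<Rightarrow> complex" where
  "l2_cut F f = (\<lambda>i. if i \<in> F then f i else 0)"

lemma l2_cut: "f \<in> l2 \<Longrightarrow> l2_cut F f \<in> l2" "f \<in> l2 \<Longrightarrow> l2_norm (l2_cut F f) \<le> l2_norm f"
  by (rule l2_mono(1)[where g = f], auto simp: l2_cut_def) (rule l2_mono(2)[where g = f], auto simp: l2_cut_def)

lemma l2_cut_sum: "finite F \<Longrightarrow> l2_cut F f = (\<lambda>i. \<Sum>x\<in>F. f x * l2_unit x i)"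
  by (simp add: l2_cut_def l2_unit_def fun_eq_iff of_bool_def sum.If_cases if_distrib[of "(*) _"] cong: if_cong)

lemma l2_tail_small:
  assumes "f \<in> l2" "0 < e"
  obtains F where "finite F" "l2_norm (\<lambda>i. f i - l2_cut F f i) < e"
proof -
  define s where "s = (\<Sum>\<^sub>\<infinity>i. (cmod (f i))\<^sup>2)"
  have sm: "(\<lambda>i. (cmod (f i))\<^sup>2) summable_on UNIV" using assms by (simp add: l2_def)
  then obtain F where F: "finite F" "dist (\<Sum>i\<in>F. (cmod (f i))\<^sup>2) s \<le> e\<^sup>2 / 2"
    using infsum_finite_approximation[OF sm, of "e\<^sup>2 / 2"] assms(2) by (auto simp: s_def)
  have pos: "0 < e\<^sup>2" using assms(2) by simp
  have "(cmod (f i - l2_cut F f i))\<^sup>2 = (if i \<in> F then 0 else (cmod (f i))\<^sup>2)" for i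
    by (simp add: l2_cut_def)
  then have "(l2_norm (\<lambda>i. f i - l2_cut F f i))\<^sup>2 = (\<Sum>\<^sub>\<infinity>i. if i \<in> F then 0 else (cmod (f i))\<^sup>2)"
    by (simp add: l2_norm_power2)
  also have "\<dots> = (\<Sum>\<^sub>\<infinity>i\<in>-F. (cmod (f i))\<^sup>2)"
    by (intro infsum_cong_neutral) auto
  also have "\<dots> = s - (\<Sum>i\<in>F. (cmod (f i))\<^sup>2)"
    using infsum_Diff[OF sm, of F] F(1) by (simp add: s_def Compl_eq_Diff_UNIV)
  also have "\<dots> < e\<^sup>2" using F(2) pos unfolding dist_real_def abs_le_iff by linarith
  finally show ?thesis using that F(1) assms(2) by (simp add: power2_less_imp_less)
qed

lemma l2_tail_antimono:
  assumes "f \<in> l2" "F \<subseteq> F'"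
  shows "l2_norm (\<lambda>i. f i - l2_cut F' f i) \<le> l2_norm (\<lambda>i. f i - l2_cut F f i)"
  by (rule l2_mono(2)[OF l2_diff(1)[OF assms(1) l2_cut(1)[OF assms(1)]]])
    (use assms(2) in \<open>auto simp: l2_cut_def\<close>)

text \<open>
  The limit is taken coordinatewise. The Cauchy estimate passes to the limit in each finite partial
  sum, and thereby to the norm.
\<close>
lemma l2_complete:
  assumes f: "\<And>k::nat. f k \<in> l2"
    and cauchy: "\<And>e. 0 < e \<Longrightarrow> \<exists>N. \<forall>k\<ge>N. \<forall>l\<ge>N. l2_norm (\<lambda>i. f k i - f l i) < e"
  obtains g where "g \<in> l2" "(\<lambda>k. l2_norm (\<lambda>i. f k i - g i)) \<longlonglongrightarrow> 0"
proof -
  have "Cauchy (\<lambda>k. f k i)" for i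
  proof (rule metric_CauchyI)
    fix e :: real assume "0 < e"
    then obtain N where N: "\<forall>k\<ge>N. \<forall>l\<ge>N. l2_norm (\<lambda>i. f k i - f l i) < e" using cauchy by blast
    have "dist (f k i) (f l i) < e" if "k \<ge> N" "l \<ge> N" for k l
    proof -
      have "dist (f k i) (f l i) \<le> l2_norm (\<lambda>i. f k i - f l i)"
        unfolding dist_norm by (rule cmod_le_l2_norm[OF l2_diff(1)[OF f f]])
      also have "\<dots> < e" using N that by auto
      finally show ?thesis .
    qed
    then show "\<exists>N. \<forall>k\<ge>N. \<forall>l\<ge>N. dist (f k i) (f l i) < e" by blast
  qed
  then have lim: "(\<lambda>k. f k i) \<longlonglongrightarrow> lim (\<lambda>k. f k i)" for i
    by (simp add: Cauchy_convergent_iff convergent_LIMSEQ_iff)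
  define g where "g = (\<lambda>i. lim (\<lambda>k. f k i))"
  have g: "(\<lambda>k. f k i) \<longlonglongrightarrow> g i" for i using lim by (simp add: g_def)
  have close: "(\<lambda>i. f k i - g i) \<in> l2 \<and> l2_norm (\<lambda>i. f k i - g i) \<le> e"
    if N: "\<forall>k\<ge>N. \<forall>l\<ge>N. l2_norm (\<lambda>i. f k i - f l i) < e" and "k \<ge> N" for N k e
  proof -
    have "L2_set (\<lambda>i. cmod (f k i - g i)) F \<le> e" if "finite F" for F
    proof (rule LIMSEQ_le_const2)
      show "(\<lambda>l. L2_set (\<lambda>i. cmod (f k i - f l i)) F) \<longlonglongrightarrow> L2_set (\<lambda>i. cmod (f k i - g i)) F"
        unfolding L2_set_def by (intro tendsto_intros g)
      have "L2_set (\<lambda>i. cmod (f k i - f l i)) F \<le> e" if "l \<ge> N" for l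
      proof -
        have "L2_set (\<lambda>i. cmod (f k i - f l i)) F \<le> l2_norm (\<lambda>i. f k i - f l i)"
          by (rule L2_set_le_l2_norm[OF l2_diff(1)[OF f f] \<open>finite F\<close>])
        also have "\<dots> \<le> e" using N \<open>k \<ge> N\<close> that by (simp add: less_imp_le)
        finally show ?thesis .
      qed
      then show "\<exists>N. \<forall>l\<ge>N. L2_set (\<lambda>i. cmod (f k i - f l i)) F \<le> e" by blast
    qed
    from l2_boundedI[OF this] show ?thesis by auto
  qed
  obtain N where "\<forall>k\<ge>N. \<forall>l\<ge>N. l2_norm (\<lambda>i. f k i - f l i) < 1" using cauchy[of 1] by auto
  from close[OF this order.refl] have "(\<lambda>i. f N i - g i) \<in> l2" by auto
  from l2_diff(1)[OF f this, of N] have "g \<in> l2" by simp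
  moreover have "(\<lambda>k. l2_norm (\<lambda>i. f k i - g i)) \<longlonglongrightarrow> 0"
  proof (rule LIMSEQ_I)
    fix r :: real assume "0 < r"
    then obtain N where N: "\<forall>k\<ge>N. \<forall>l\<ge>N. l2_norm (\<lambda>i. f k i - f l i) < r/2" using cauchy[of "r/2"] by auto
    have "norm (l2_norm (\<lambda>i. f k i - g i) - 0) < r" if "k \<ge> N" for k
      using close[OF N that] \<open>0 < r\<close> by auto
    then show "\<exists>N. \<forall>k\<ge>N. norm (l2_norm (\<lambda>i. f k i - g i) - 0) < r" by blast
  qed
  ultimately show ?thesis by (rule that)
qed

lemma l2_permute:
  assumes "bij p"
  shows "f \<in> l2 \<Longrightarrow> (\<lambda>i. f (p i)) \<in> l2" and "l2_norm (\<lambda>i. f (p i)) = l2_norm f"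
  using summable_on_reindex_bij_betw[OF assms, of "\<lambda>i. (cmod (f i))\<^sup>2"]
    infsum_reindex_bij_betw[OF assms, of "\<lambda>i. (cmod (f i))\<^sup>2"]
  by (auto simp: l2_def l2_norm_def)

section \<open>The Hilbert space of square-summable functions\<close>

definition ell2 :: "('i \<Rightarrow> complex) hilbert" where
  "ell2 = \<lparr>carrier = l2, monoid.mult = (\<lambda>f g. undefined), one = undefined,
     zero = (\<lambda>i. 0), add = (\<lambda>f g i. f i + g i),
     module.smult = (\<lambda>c f i. c * f i), hinner = (\<lambda>f g. \<Sum>\<^sub>\<infinity>i. f i * cnj (g i))\<rparr>"

lemma ell2_simps [simp]:
  "carrier ell2 = l2" "\<zero>\<^bsub>ell2\<^esub> = (\<lambda>i. 0)" "f \<oplus>\<^bsub>ell2\<^esub> g = (\<lambda>i. f i + g i)"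
  "c \<odot>\<^bsub>ell2\<^esub> f = (\<lambda>i. c * f i)" "hinner ell2 f g = (\<Sum>\<^sub>\<infinity>i. f i * cnj (g i))"
  by (simp_all add: ell2_def)

lemma complex_ring_of_type_algebra_simps:
  "carrier (ring_of_type_algebra::complex ring) = UNIV"
  "\<one>\<^bsub>ring_of_type_algebra::complex ring\<^esub> = 1" "\<zero>\<^bsub>ring_of_type_algebra::complex ring\<^esub> = 0"
  "x \<oplus>\<^bsub>ring_of_type_algebra::complex ring\<^esub> y = x + y"
  "x \<otimes>\<^bsub>ring_of_type_algebra::complex ring\<^esub> y = x * y"
  by (auto simp: ring_of_type_algebra_def)

lemma abelian_group_ell2: "abelian_group ell2"
proof (rule abelian_groupI)
  fix f :: "'i \<Rightarrow> complex" assume "f \<in> carrier ell2"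
  then show "\<exists>g\<in>carrier ell2. g \<oplus>\<^bsub>ell2\<^esub> f = \<zero>\<^bsub>ell2\<^esub>"
    using l2_smult(1)[of f "-1"] by (intro bexI[of _ "\<lambda>i. - f i"]) auto
qed (auto simp: l2_add fun_eq_iff)

lemma module_ell2: "module (ring_of_type_algebra :: complex ring) ell2"
proof (rule moduleI)
  show "cring (ring_of_type_algebra :: complex ring)" by (rule cring_from_type_algebra)
qed (auto simp: complex_ring_of_type_algebra_simps abelian_group_ell2 l2_smult algebra_simps)

lemma ell2_uminus:
  assumes "f \<in> l2"
  shows "\<ominus>\<^bsub>ell2\<^esub> f = (\<lambda>i. - f i)"
proof -
  interpret abelian_group "ell2 :: ('a \<Rightarrow> complex) hilbert" by (rule abelian_group_ell2)
  have "(\<lambda>i. - f i) \<in> l2" using l2_smult(1)[OF assms, of "-1"] by simp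
  then show ?thesis using assms by (intro minus_equality) auto
qed

lemma ell2_minus: "g \<in> l2 \<Longrightarrow> f \<ominus>\<^bsub>ell2\<^esub> g = (\<lambda>i. f i - g i)"
  by (simp add: a_minus_def ell2_uminus)

lemma subspace_of_ell2_iff:
  "subspace_of W ell2 \<longleftrightarrow> W \<subseteq> l2 \<and> (\<lambda>i. 0) \<in> W \<and>
     (\<forall>f\<in>W. \<forall>g\<in>W. (\<lambda>i. f i + g i) \<in> W) \<and> (\<forall>c. \<forall>f\<in>W. (\<lambda>i. c * f i) \<in> W)"
proof -
  interpret module "ring_of_type_algebra :: complex ring" "ell2 :: ('a \<Rightarrow> complex) hilbert"
    by (rule module_ell2)
  show ?thesis
  proof
    assume "subspace_of W ell2"
    then have sub: "submodule W (ring_of_type_algebra :: complex ring) ell2" by (simp add: subspace_of_def)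
    have c: "(\<lambda>i. c * f i) \<in> W" if "f \<in> W" for c f
      using submoduleE(4)[OF sub _ that, of c] by (simp add: complex_ring_of_type_algebra_simps)
    obtain f where "f \<in> W" using submoduleE(2)[OF sub] by blast
    from c[OF this, of 0] have "(\<lambda>i. 0) \<in> W" by simp
    then show "W \<subseteq> l2 \<and> (\<lambda>i. 0) \<in> W \<and>
        (\<forall>f\<in>W. \<forall>g\<in>W. (\<lambda>i. f i + g i) \<in> W) \<and> (\<forall>c. \<forall>f\<in>W. (\<lambda>i. c * f i) \<in> W)"
      using submoduleE(1)[OF sub] submoduleE(5)[OF sub] c by auto
  next
    assume W: "W \<subseteq> l2 \<and> (\<lambda>i. 0) \<in> W \<and>
        (\<forall>f\<in>W. \<forall>g\<in>W. (\<lambda>i. f i + g i) \<in> W) \<and> (\<forall>c. \<forall>f\<in>W. (\<lambda>i. c * f i) \<in> W)"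
    then have "(\<lambda>i. (-1) * f i) \<in> W" if "f \<in> W" for f using that by blast
    then have "(\<lambda>i. - f i) \<in> W" if "f \<in> W" for f using that by simp
    then show "subspace_of W ell2"
      unfolding subspace_of_def using W by (intro submoduleI) (auto simp: ell2_uminus subset_iff)
  qed
qed

lemma subspace_of_ell2D:
  assumes "subspace_of W ell2"
  shows "f \<in> W \<Longrightarrow> f \<in> l2" and "(\<lambda>i. 0) \<in> W"
    and "f \<in> W \<Longrightarrow> g \<in> W \<Longrightarrow> (\<lambda>i. f i + g i) \<in> W"
    and "f \<in> W \<Longrightarrow> (\<lambda>i. c * f i) \<in> W"
  using assms by (simp_all add: subspace_of_ell2_iff subset_iff)

lemma subspace_of_ell2_sum:
  assumes "subspace_of W ell2" "finite F" "\<And>k. k \<in> F \<Longrightarrow> f k \<in> W"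
  shows "(\<lambda>i. \<Sum>k\<in>F. f k i) \<in> W"
  using assms(2,3)
proof (induction F rule: finite_induct)
  case empty
  show ?case using subspace_of_ell2D(2)[OF assms(1)] by simp
next
  case (insert k F)
  have "(\<lambda>i. f k i + (\<Sum>k\<in>F. f k i)) \<in> W"
    by (rule subspace_of_ell2D(3)[OF assms(1) insert.prems insert.IH]) (use insert.prems in auto)
  then show ?case using insert.hyps by simp
qed

lemma hnorm_ell2:
  assumes "f \<in> l2"
  shows "hnorm ell2 f = l2_norm f"
proof -
  have "((\<lambda>i. of_real ((cmod (f i))\<^sup>2) :: complex) has_sum of_real (\<Sum>\<^sub>\<infinity>i. (cmod (f i))\<^sup>2)) UNIV"
    using assms by (simp only: has_sum_of_real_iff l2_def mem_Collect_eq has_sum_infsum)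
  then have "(\<Sum>\<^sub>\<infinity>i. f i * cnj (f i)) = of_real (\<Sum>\<^sub>\<infinity>i. (cmod (f i))\<^sup>2)"
    by (simp only: complex_norm_square infsumI)
  then show ?thesis by (simp add: hnorm_def l2_norm_def)
qed

lemma hdist_ell2: "f \<in> l2 \<Longrightarrow> g \<in> l2 \<Longrightarrow> hdist ell2 f g = l2_norm (\<lambda>i. f i - g i)"
  by (simp add: hdist_def ell2_minus hnorm_ell2 l2_diff(1))

lemma Metric_space_ell2: "Metric_space l2 (hdist ell2)"
proof
  fix f g h :: "'a \<Rightarrow> complex"
  show "0 \<le> hdist ell2 f g" by (auto simp: hdist_def hnorm_ell2 ell2_minus l2_diff(1))
  show "hdist ell2 f g = hdist ell2 g f"
    by (auto simp: hdist_def hnorm_ell2 ell2_minus l2_diff(1) intro: l2_norm_minus_commute)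
  show "(hdist ell2 f g = 0) = (f = g)" if "f \<in> l2" "g \<in> l2"
  proof
    assume "hdist ell2 f g = 0"
    then have "(\<lambda>i. f i - g i) = (\<lambda>i. 0)"
      using that by (intro l2_norm_eq_0 l2_diff(1)) (auto simp: hdist_ell2)
    then show "f = g" by (auto simp: fun_eq_iff)
  qed (use that in \<open>auto simp: hdist_ell2\<close>)
  show "hdist ell2 f h \<le> hdist ell2 f g + hdist ell2 g h" if "f \<in> l2" "g \<in> l2" "h \<in> l2"
    using l2_norm_triangle_sub[OF that] that by (simp add: hdist_ell2)
qed

lemma limitin_ell2:
  assumes "\<And>k::nat. f k \<in> l2"
  shows "limitin (htopology ell2) f g sequentially \<longleftrightarrow>
    g \<in> l2 \<and> (\<lambda>k. l2_norm (\<lambda>i. f k i - g i)) \<longlonglongrightarrow> 0"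
  using assms by (auto simp: Metric_space.limitin_metric_dist_null[OF Metric_space_ell2] hdist_ell2)

lemma mcomplete_ell2: "Metric_space.mcomplete l2 (hdist ell2)"
  unfolding Metric_space.mcomplete_def[OF Metric_space_ell2]
proof (intro allI impI)
  fix f :: "nat \<Rightarrow> 'a \<Rightarrow> complex" assume "Metric_space.MCauchy l2 (hdist ell2) f"
  then have f: "\<And>k. f k \<in> l2"
    and c: "\<And>e. 0 < e \<Longrightarrow> \<exists>N. \<forall>k l. N \<le> k \<longrightarrow> N \<le> l \<longrightarrow> hdist ell2 (f k) (f l) < e"
    unfolding Metric_space.MCauchy_def[OF Metric_space_ell2] by auto
  have "\<exists>N. \<forall>k\<ge>N. \<forall>l\<ge>N. l2_norm (\<lambda>i. f k i - f l i) < e" if "0 < e" for e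
    using c[OF that] f by (auto simp: hdist_ell2)
  from l2_complete[OF f this] obtain g where "g \<in> l2" "(\<lambda>k. l2_norm (\<lambda>i. f k i - g i)) \<longlonglongrightarrow> 0"
    by blast
  then show "\<exists>g. limitin (Metric_space.mtopology l2 (hdist ell2)) f g sequentially"
    using limitin_ell2[OF f] by auto
qed

lemma hilbert_space_ell2: "hilbert_space ell2"
proof (intro hilbert_space.intro hilbert_space_axioms.intro)
  show "module (ring_of_type_algebra :: complex ring) ell2" by (rule module_ell2)
  show "Metric_space.mcomplete (carrier ell2) (hdist ell2)" using mcomplete_ell2 by simp
  fix f g h :: "'a \<Rightarrow> complex"
  assume f: "f \<in> carrier ell2"
  show "0 \<le> Re (hinner ell2 f f)"
    using l2_norm_nonneg[of f] hnorm_ell2[of f] f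
    by (metis ell2_simps(1) hnorm_def real_sqrt_ge_0_iff)
  show "f = \<zero>\<^bsub>ell2\<^esub>" if "hinner ell2 f f = 0"
    using l2_norm_eq_0[of f] f that by (simp add: hnorm_ell2[symmetric] hnorm_def)
  assume g: "g \<in> carrier ell2"
  show "hinner ell2 (c \<odot>\<^bsub>ell2\<^esub> f) g = c * hinner ell2 f g" for c
    by (simp add: mult.assoc infsum_cmult_right')
  show "hinner ell2 g f = cnj (hinner ell2 f g)"
    by (simp add: infsum_cnj[symmetric] mult.commute)
  assume h: "h \<in> carrier ell2"
  show "hinner ell2 (f \<oplus>\<^bsub>ell2\<^esub> g) h = hinner ell2 f h + hinner ell2 g h"
    using f g h by (simp add: distrib_right infsum_add l2_inner_summable)
qed

text \<open>
  The countable dense set consists of the finitely supported functions whose values have rational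
  real and imaginary parts, encoded by lists of a point and two coordinates.
\<close>
lemma separable_ell2:
  assumes "countable (UNIV :: 'i set)"
  shows "separable_space (htopology (ell2 :: ('i \<Rightarrow> complex) hilbert))"
proof -
  have "countable (lists ((UNIV :: 'i set) \<times> (UNIV :: (rat \<times> rat) set)))"
    by (intro countable_lists countable_SIGMA assms) simp
  then have countable_lists: "countable (UNIV :: ('i \<times> rat \<times> rat) list set)" by simp
  define q :: "('i \<times> rat \<times> rat) list \<Rightarrow> 'i \<Rightarrow> complex" where
    "q = (\<lambda>l i. \<Sum>(j, a, b)\<leftarrow>l. Complex (of_rat a) (of_rat b) * l2_unit j i)"
  have q: "q l \<in> l2" for l
  proof (induction l)
    case Nil then show ?case by (simp add: q_def)
  next
    case (Cons x l)
    then show ?case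
      using l2_add(1)[OF l2_smult(1)[OF l2_unit] Cons] by (simp add: q_def case_prod_beta)
  qed
  have approx: "\<exists>l. l2_norm (\<lambda>i. l2_cut F f i - q l i) < e" if "finite F" "0 < e"
    for F :: "'i set" and f and e :: real
    using that
  proof (induction F arbitrary: e rule: finite_induct)
    case empty
    then show ?case by (intro exI[of _ "[]"]) (simp add: l2_cut_def q_def)
  next
    case (insert x F)
    obtain l where l: "l2_norm (\<lambda>i. l2_cut F f i - q l i) < e/2" using insert.IH[of "e/2"] insert.prems by auto
    have e4: "0 < e/4" using insert.prems by simp
    obtain a where "Re (f x) - e/4 < of_rat a" "of_rat a < Re (f x) + e/4"
      using of_rat_dense[of "Re (f x) - e/4" "Re (f x) + e/4"] e4 by auto
    then have a: "\<bar>Re (f x) - of_rat a\<bar> < e/4" unfolding abs_less_iff by linarith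
    obtain b where "Im (f x) - e/4 < of_rat b" "of_rat b < Im (f x) + e/4"
      using of_rat_dense[of "Im (f x) - e/4" "Im (f x) + e/4"] e4 by auto
    then have b: "\<bar>Im (f x) - of_rat b\<bar> < e/4" unfolding abs_less_iff by linarith
    define z where "z = f x - Complex (of_rat a) (of_rat b)"
    have "cmod z \<le> \<bar>Re z\<bar> + \<bar>Im z\<bar>" by (rule cmod_le)
    also have "\<dots> < e/2" using a b by (simp add: z_def)
    finally have z: "cmod z < e/2" .
    have "(\<lambda>i. l2_cut (insert x F) f i - q ((x,a,b)#l) i) = (\<lambda>i. z * l2_unit x i + (l2_cut F f i - q l i))"
      using insert.hyps by (auto simp: fun_eq_iff z_def q_def l2_cut_def l2_unit_def)
    moreover have "l2_cut F f \<in> l2" by (rule l2_finite_support(1)[OF \<open>finite F\<close>]) (simp add: l2_cut_def)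
    ultimately have "l2_norm (\<lambda>i. l2_cut (insert x F) f i - q ((x,a,b)#l) i)
        \<le> cmod z + l2_norm (\<lambda>i. l2_cut F f i - q l i)"
      using l2_add(2)[OF l2_smult(1)[OF l2_unit, of z x] l2_diff(1)[OF _ q, of "l2_cut F f" l]]
      by (simp add: l2_smult(2))
    then show ?case using l z by (intro exI[of _ "(x,a,b)#l"]) linarith
  qed
  have "htopology ell2 closure_of (range q) = l2"
    unfolding Metric_space.metric_closure_of[OF Metric_space_ell2, simplified] ell2_simps(1)
  proof (intro equalityI subsetI CollectI conjI allI impI)
    fix f :: "'i \<Rightarrow> complex" and r :: real assume f: "f \<in> l2" and "r > 0"
    obtain F where F: "finite F" "l2_norm (\<lambda>i. f i - l2_cut F f i) < r/2"
      using l2_tail_small[OF f, of "r/2"] \<open>r > 0\<close> by auto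
    obtain l where "l2_norm (\<lambda>i. l2_cut F f i - q l i) < r/2" using approx[OF F(1), of "r/2" f] \<open>r > 0\<close> by auto
    then have "hdist ell2 f (q l) < r"
      using l2_norm_triangle_sub[OF f l2_cut(1)[OF f, of F] q, of l] F(2) f q by (simp add: hdist_ell2)
    then show "\<exists>y\<in>range q. y \<in> Metric_space.mball l2 (hdist ell2) f r"
      using f q by (auto simp: Metric_space.in_mball[OF Metric_space_ell2])
  qed auto
  then show ?thesis
    unfolding separable_space_def
    using q countable_image[OF countable_lists, of q] by (intro exI[of _ "range q"]) (auto simp: Metric_space.topspace_mtopology[OF Metric_space_ell2])
qed

text \<open>
  Finitely many vectors are annihilated by some nonzero functional of finite support, whose kernel is
  then a proper subspace. In the induction, the support is kept disjoint from a given finite set, so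
  that two functionals with disjoint supports are available for each new vector; a suitable
  combination of them annihilates the new vector, too, and is nonzero.
\<close>
lemma infinite_dimensional_ell2:
  assumes "infinite (UNIV :: 'i set)"
  shows "infinite_dimensional (ell2 :: ('i \<Rightarrow> complex) hilbert)"
  unfolding infinite_dimensional_def
proof (intro notI, elim exE conjE)
  fix S :: "('i \<Rightarrow> complex) set"
  assume S: "finite S" and sub: "S \<subseteq> carrier ell2" and whole: "\<forall>W. subspace_of W ell2 \<and> S \<subseteq> W \<longrightarrow> W = carrier ell2"
  have "\<exists>D a. finite D \<and> D \<inter> B = {} \<and> (\<exists>d\<in>D. a d \<noteq> 0) \<and> (\<forall>s\<in>S. (\<Sum>d\<in>D. a d * s d) = 0)"
    if "finite B" for B :: "'i set"
    using S that
  proof (induction S arbitrary: B rule: finite_induct)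
    case empty
    obtain d where "d \<notin> B" using ex_new_if_finite[OF assms empty] by blast
    then show ?case by (intro exI[of _ "{d}"] exI[of _ "\<lambda>_. 1"]) auto
  next
    case (insert s S)
    obtain D a where a: "finite D" "D \<inter> B = {}" "\<exists>d\<in>D. a d \<noteq> 0" "\<forall>s\<in>S. (\<Sum>d\<in>D. a d * s d) = (0::complex)"
      using insert.IH[OF insert.prems] by blast
    obtain D' a' where a': "finite D'" "D' \<inter> (B \<union> D) = {}" "\<exists>d\<in>D'. a' d \<noteq> 0"
        "\<forall>s\<in>S. (\<Sum>d\<in>D'. a' d * s d) = (0::complex)"
      using insert.IH[of "B \<union> D"] insert.prems a(1) by auto
    define u where "u = (\<Sum>d\<in>D. a d * s d)"
    define u' where "u' = (\<Sum>d\<in>D'. a' d * s d)"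
    show ?case
    proof (cases "u = 0")
      case True
      then show ?thesis using a by (intro exI[of _ D] exI[of _ a]) (auto simp: u_def)
    next
      case False
      define b where "b = (\<lambda>d. if d \<in> D then u' * a d else - u * a' d)"
      have disj: "D \<inter> D' = {}" using a'(2) by auto
      have sum_b: "(\<Sum>d\<in>D \<union> D'. b d * t d) = u' * (\<Sum>d\<in>D. a d * t d) - u * (\<Sum>d\<in>D'. a' d * t d)" for t
      proof -
        have "(\<Sum>d\<in>D'. b d * t d) = (\<Sum>d\<in>D'. - (u * (a' d * t d)))"
          using disj by (intro sum.cong) (auto simp: b_def)
        moreover have "(\<Sum>d\<in>D. b d * t d) = (\<Sum>d\<in>D. u' * (a d * t d))"
          by (intro sum.cong) (auto simp: b_def)
        ultimately show ?thesis
          using a(1) a'(1) disj by (simp add: sum.union_disjoint sum_distrib_left sum_negf)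
      qed
      obtain d where d: "d \<in> D'" "a' d \<noteq> 0" using a'(3) by blast
      then have "b d \<noteq> 0" using False disj by (auto simp: b_def)
      then show ?thesis using a a' sum_b d(1)
        by (intro exI[of _ "D \<union> D'"] exI[of _ b]) (auto simp: u_def u'_def)
    qed
  qed
  from this[of "{}"] obtain D a where D: "finite D" "\<exists>d\<in>D. a d \<noteq> (0::complex)" "\<forall>s\<in>S. (\<Sum>d\<in>D. a d * s d) = 0"
    by auto
  define W where "W = {f \<in> l2. (\<Sum>d\<in>D. a d * f d) = 0}"
  have "subspace_of W ell2"
    unfolding subspace_of_ell2_iff
  proof (intro conjI ballI allI)
    fix f g and c :: complex assume f: "f \<in> W"
    have "(\<Sum>d\<in>D. a d * (c * f d)) = c * (\<Sum>d\<in>D. a d * f d)"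
      by (simp add: sum_distrib_left mult_ac)
    then show "(\<lambda>i. c * f i) \<in> W" using f l2_smult by (auto simp: W_def)
    assume "g \<in> W"
    then show "(\<lambda>i. f i + g i) \<in> W" using f l2_add by (auto simp: W_def distrib_left sum.distrib)
  qed (auto simp: W_def)
  moreover have "S \<subseteq> W" using D(3) sub by (auto simp: W_def)
  ultimately have "W = l2" using whole by simp
  obtain d where d: "d \<in> D" "a d \<noteq> 0" using D(2) by blast
  have "l2_unit d \<in> W" using \<open>W = l2\<close> by simp
  then show False using d D(1) by (simp add: W_def l2_unit_def of_bool_def if_distrib sum.If_cases cong: if_cong)
qed

section \<open>Operators on square-summable functions\<close>

lemma l2_parallelogram:
  assumes "f \<in> l2" "g \<in> l2"
  shows "(l2_norm (\<lambda>i. f i + g i))\<^sup>2 + (l2_norm (\<lambda>i. f i - g i))\<^sup>2 = 2 * (l2_norm f)\<^sup>2 + 2 * (l2_norm g)\<^sup>2"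
proof -
  have s: "(\<lambda>i. (cmod (f i))\<^sup>2) summable_on UNIV" "(\<lambda>i. (cmod (g i))\<^sup>2) summable_on UNIV"
    "(\<lambda>i. (cmod (f i + g i))\<^sup>2) summable_on UNIV" "(\<lambda>i. (cmod (f i - g i))\<^sup>2) summable_on UNIV"
    using assms l2_add(1)[OF assms] l2_diff(1)[OF assms] by (auto simp: l2_def)
  have "(l2_norm (\<lambda>i. f i + g i))\<^sup>2 + (l2_norm (\<lambda>i. f i - g i))\<^sup>2
      = (\<Sum>\<^sub>\<infinity>i. (cmod (f i + g i))\<^sup>2 + (cmod (f i - g i))\<^sup>2)"
    unfolding l2_norm_power2 by (rule infsum_add[symmetric, OF s(3,4)])
  also have "\<dots> = (\<Sum>\<^sub>\<infinity>i. 2 * (cmod (f i))\<^sup>2 + 2 * (cmod (g i))\<^sup>2)"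
    by (intro infsum_cong) (simp only: cmod_power2, simp add: power2_eq_square algebra_simps)
  also have "\<dots> = (\<Sum>\<^sub>\<infinity>i. 2 * (cmod (f i))\<^sup>2) + (\<Sum>\<^sub>\<infinity>i. 2 * (cmod (g i))\<^sup>2)"
    by (intro infsum_add summable_on_cmult_right s)
  finally show ?thesis by (simp add: infsum_cmult_right' l2_norm_power2)
qed

text \<open>
  The parallelogram law gives \<open>sqrt (N\<^sup>2 - d\<^sup>2 / 4)\<close> for the norm of the midpoint, where \<open>N\<close> is the
  common norm and \<open>d\<close> the distance. The upper bound stated here is easier to add up.
\<close>
lemma l2_midpoint_norm:
  assumes "f \<in> l2" "g \<in> l2" "l2_norm g = l2_norm f" "0 < l2_norm f"
  shows "l2_norm (\<lambda>i. (f i + g i) / 2) \<le> l2_norm f - (l2_norm (\<lambda>i. g i - f i))\<^sup>2 / (8 * l2_norm f)"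
proof -
  define N d p where "N = l2_norm f" and "d = l2_norm (\<lambda>i. g i - f i)" and "p = l2_norm (\<lambda>i. f i + g i)"
  have N: "0 < N" using assms by (simp add: N_def)
  have mid: "l2_norm (\<lambda>i. (f i + g i) / 2) = p / 2"
    using l2_smult(2)[OF l2_add(1)[OF assms(1,2)], of "1/2"] by (simp add: p_def)
  have "p\<^sup>2 + d\<^sup>2 = 2 * N\<^sup>2 + 2 * N\<^sup>2"
    unfolding N_def d_def p_def l2_norm_minus_commute[of g f] l2_parallelogram[OF assms(1,2)] assms(3) ..
  then have p: "p\<^sup>2 = 4 * N\<^sup>2 - d\<^sup>2" by simp
  have "d \<le> 2 * N"
    using l2_diff(2)[OF assms(2,1)] assms(3) by (simp add: N_def d_def)
  then have "d\<^sup>2 \<le> (2*N)\<^sup>2" by (intro power_mono) (auto simp: d_def)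
  also have "(2*N)\<^sup>2 \<le> N * (8*N)" using N by (simp add: power2_eq_square)
  finally have le: "d\<^sup>2 / (8 * N) \<le> N" using N by (simp add: pos_divide_le_eq)
  have "(N - d\<^sup>2 / (8 * N))\<^sup>2 = N\<^sup>2 - d\<^sup>2 / 4 + (d\<^sup>2 / (8 * N))\<^sup>2"
    using N by (simp add: power2_diff)
  then have "(p / 2)\<^sup>2 \<le> (N - d\<^sup>2 / (8 * N))\<^sup>2" using p by (simp add: power_divide)
  then have "p / 2 \<le> N - d\<^sup>2 / (8 * N)" by (rule power2_le_imp_le) (use le in auto)
  then show ?thesis unfolding mid N_def d_def .
qed

text \<open>
  The coefficients of a bounded functional are square-summable: test the functional on their complex
  conjugates, cut off to a finite set. The tail of the coefficients therefore controls the error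
  uniformly on the unit ball.
\<close>
lemma l2_functional_approx:
  assumes add: "\<And>f g. f \<in> l2 \<Longrightarrow> g \<in> l2 \<Longrightarrow> \<phi> (\<lambda>i. f i + g i) = \<phi> f + \<phi> g"
    and scale: "\<And>c f. f \<in> l2 \<Longrightarrow> \<phi> (\<lambda>i. c * f i) = c * (\<phi> f :: complex)"
    and bounded: "\<And>f. f \<in> l2 \<Longrightarrow> cmod (\<phi> f) \<le> B * l2_norm f"
    and e: "0 < e"
  obtains F where "finite F" "\<And>f. f \<in> l2 \<Longrightarrow> cmod (\<phi> f - (\<Sum>y\<in>F. f y * \<phi> (l2_unit y))) \<le> e * l2_norm f"
proof -
  define a where "a = (\<lambda>y. \<phi> (l2_unit y))"
  have fin: "\<phi> (\<lambda>i. \<Sum>y\<in>F. f y * l2_unit y i) = (\<Sum>y\<in>F. f y * a y)" if "finite F" for F f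
    using that
  proof (induction F rule: finite_induct)
    case empty
    show ?case using scale[OF l2_zero, of 0] by simp
  next
    case (insert x F)
    have "(\<lambda>i. \<Sum>y\<in>F. f y * l2_unit y i) \<in> l2"
      using insert.hyps by (intro l2_sum(1) l2_smult(1)) auto
    then show ?case
      using insert add[OF l2_smult(1)[OF l2_unit]] scale[OF l2_unit] by (simp add: a_def)
  qed
  have "L2_set (\<lambda>y. cmod (a y)) F \<le> max B 0" if F: "finite F" for F
  proof -
    define r where "r = L2_set (\<lambda>y. cmod (a y)) F"
    define w where "w = (\<lambda>i. \<Sum>y\<in>F. cnj (a y) * l2_unit y i)"
    have w: "w = l2_cut F (\<lambda>y. cnj (a y))" unfolding w_def using l2_cut_sum[OF F] by metis
    have wl: "w \<in> l2" and "(l2_norm w)\<^sup>2 = (\<Sum>i\<in>F. (cmod (w i))\<^sup>2)"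
      using l2_finite_support[OF F, of w] by (auto simp: w l2_cut_def)
    then have "(l2_norm w)\<^sup>2 = r\<^sup>2" by (simp add: w l2_cut_def r_def L2_set_def sum_nonneg)
    then have nw: "l2_norm w = r" by (simp add: r_def L2_set_nonneg power2_eq_iff_nonneg)
    have "\<phi> w = (\<Sum>y\<in>F. cnj (a y) * a y)" unfolding w_def by (rule fin[OF F])
    also have "\<dots> = of_real (\<Sum>y\<in>F. (cmod (a y))\<^sup>2)"
      unfolding of_real_sum complex_norm_square by (simp add: mult.commute)
    also have "\<dots> = of_real (r\<^sup>2)" by (simp add: r_def L2_set_def sum_nonneg)
    finally have "r\<^sup>2 \<le> B * r" using bounded[OF wl] nw by (simp add: norm_power)
    moreover have "0 \<le> r" by (simp add: r_def L2_set_nonneg)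
    ultimately show ?thesis unfolding r_def[symmetric]
      by (cases "r = 0") (auto simp: power2_eq_square)
  qed
  then have a: "a \<in> l2" by (rule l2_boundedI(1))
  obtain F where F: "finite F" "l2_norm (\<lambda>i. a i - l2_cut F a i) < e"
    using l2_tail_small[OF a e] by blast
  have "cmod (\<phi> f - (\<Sum>y\<in>F. f y * a y)) \<le> e * l2_norm f" if f: "f \<in> l2" for f
  proof (rule field_le_epsilon)
    fix \<eta> :: real assume \<eta>: "0 < \<eta>"
    define B' where "B' = \<bar>B\<bar> + 1"
    have B': "0 < B'" by (simp add: B'_def)
    obtain F1 where F1: "finite F1" "l2_norm (\<lambda>i. f i - l2_cut F1 f i) < \<eta> / B'"
      using l2_tail_small[OF f, of "\<eta> / B'"] \<eta> B' by auto
    define F' where "F' = F \<union> F1"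
    have F': "finite F'" using F(1) F1(1) by (simp add: F'_def)
    have t: "l2_norm (\<lambda>i. f i - l2_cut F' f i) < \<eta> / B'"
      using l2_tail_antimono[OF f, of F1 F'] F1(2) by (simp add: F'_def)
    have "\<phi> f = \<phi> (\<lambda>i. (f i - l2_cut F' f i) + l2_cut F' f i)" by simp
    also have "\<dots> = \<phi> (\<lambda>i. f i - l2_cut F' f i) + (\<Sum>y\<in>F'. f y * a y)"
      using add[OF l2_diff(1)[OF f l2_cut(1)[OF f]] l2_cut(1)[OF f], of F' F'] fin[OF F', of f]
      by (simp add: l2_cut_sum[OF F'])
    also have "(\<Sum>y\<in>F'. f y * a y) = (\<Sum>y\<in>F. f y * a y) + (\<Sum>y\<in>F'-F. f y * a y)"
      using F' by (subst sum.subset_diff[of F F']) (auto simp: F'_def)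
    finally have "\<phi> f - (\<Sum>y\<in>F. f y * a y) = \<phi> (\<lambda>i. f i - l2_cut F' f i) + (\<Sum>y\<in>F'-F. f y * a y)"
      by simp
    then have "cmod (\<phi> f - (\<Sum>y\<in>F. f y * a y))
        \<le> cmod (\<phi> (\<lambda>i. f i - l2_cut F' f i)) + cmod (\<Sum>y\<in>F'-F. f y * a y)"
      by (simp add: norm_triangle_ineq)
    moreover have "cmod (\<phi> (\<lambda>i. f i - l2_cut F' f i)) \<le> \<eta>"
    proof -
      have "cmod (\<phi> (\<lambda>i. f i - l2_cut F' f i)) \<le> B * l2_norm (\<lambda>i. f i - l2_cut F' f i)"
        by (rule bounded[OF l2_diff(1)[OF f l2_cut(1)[OF f]]])
      also have "\<dots> \<le> B' * (\<eta> / B')"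
        using t B' by (intro mult_mono) (auto simp: B'_def)
      finally show ?thesis using B' by simp
    qed
    moreover have "cmod (\<Sum>y\<in>F'-F. f y * a y) \<le> e * l2_norm f"
    proof -
      let ?t = "\<lambda>i. a i - l2_cut F a i"
      have tl: "?t \<in> l2" by (rule l2_diff(1)[OF a l2_cut(1)[OF a]])
      have "cmod (\<Sum>y\<in>F'-F. f y * a y) \<le> (\<Sum>y\<in>F'-F. cmod (f y) * cmod (a y))"
        by (rule order_trans[OF norm_sum]) (simp add: norm_mult)
      also have "\<dots> = (\<Sum>y\<in>F'-F. cmod (f y) * cmod (?t y))"
        by (intro sum.cong) (auto simp: l2_cut_def)
      also have "\<dots> \<le> (\<Sum>\<^sub>\<infinity>y. cmod (f y) * cmod (?t y))"
        using F' by (intro finite_sum_le_infsum l2_product_abs_summable(1)[OF f tl]) auto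
      also have "\<dots> \<le> l2_norm f * l2_norm ?t"
        by (rule l2_product_abs_summable(2)[OF f tl])
      also have "\<dots> \<le> l2_norm f * e" using F(2) by (intro mult_left_mono) auto
      finally show ?thesis by (simp add: mult.commute)
    qed
    ultimately show "cmod (\<phi> f - (\<Sum>y\<in>F. f y * a y)) \<le> e * l2_norm f + \<eta>" by linarith
  qed
  with F(1) show ?thesis by (intro that[of F]) (simp_all add: a_def)
qed

lemma bounded_operators_ell2_iff:
  "T \<in> bounded_operators ell2 \<longleftrightarrow> T \<in> l2 \<rightarrow>\<^sub>E l2 \<and>
     (\<forall>f\<in>l2. \<forall>g\<in>l2. T (\<lambda>i. f i + g i) = (\<lambda>i. T f i + T g i)) \<and>
     (\<forall>c. \<forall>f\<in>l2. T (\<lambda>i. c * f i) = (\<lambda>i. c * T f i)) \<and>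
     (\<exists>B. \<forall>f\<in>l2. l2_norm (T f) \<le> B * l2_norm f)"
proof -
  have "hnorm ell2 (T f) = l2_norm (T f)" if "T \<in> l2 \<rightarrow>\<^sub>E l2" "f \<in> l2" for f
    using that by (intro hnorm_ell2) auto
  then show ?thesis by (auto simp: bounded_operators_def hnorm_ell2) blast+
qed

text \<open>
  The image of the unit ball is totally bounded, and the finitely many centers of a covering by small
  balls have a common finite set outside of which they are small.
\<close>

lemma compact_operator_uniform_tail:
  assumes K: "K \<in> compact_operators ell2" and e: "0 < e"
  obtains F where "finite F"
    "\<And>f. f \<in> l2 \<Longrightarrow> l2_norm (\<lambda>i. K f i - l2_cut F (K f) i) \<le> e * l2_norm f"
proof -
  interpret M: Metric_space "l2 :: ('a \<Rightarrow> complex) set" "hdist ell2" by (rule Metric_space_ell2)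
  have Kb: "K \<in> bounded_operators ell2" using K by (simp add: compact_operators_def)
  then have Kl: "K f \<in> l2" if "f \<in> l2" for f using that by (auto simp: bounded_operators_ell2_iff)
  have Ks: "K (\<lambda>i. c * f i) = (\<lambda>i. c * K f i)" if "f \<in> l2" for c f
    using Kb that by (simp add: bounded_operators_ell2_iff)
  define I where "I = K ` {f \<in> l2. l2_norm f \<le> 1}"
  have I: "I \<subseteq> l2" using Kl by (auto simp: I_def)
  have eqI: "K ` {x \<in> carrier ell2. hnorm ell2 x \<le> 1} = I"
    unfolding I_def by (intro arg_cong[of _ _ "image K"]) (auto simp: hnorm_ell2)
  have "compactin M.mtopology (M.mtopology closure_of (K ` {x \<in> carrier ell2. hnorm ell2 x \<le> 1}))"
    using K by (simp add: compact_operators_def)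
  then have "compactin M.mtopology (M.mtopology closure_of I)" unfolding eqI .
  then have "M.mtotally_bounded (M.mtopology closure_of I)" by (rule M.compactin_imp_mtotally_bounded)
  then obtain C where C: "finite C" "C \<subseteq> M.mtopology closure_of I" "M.mtopology closure_of I \<subseteq> (\<Union>x\<in>C. M.mball x (e/2))"
    unfolding M.mtotally_bounded_def using e by (meson half_gt_zero)
  have Cl: "C \<subseteq> l2" using C(2) closure_of_subset_topspace[of M.mtopology I] by auto
  have "I \<subseteq> M.mtopology closure_of I" using I by (intro closure_of_subset) simp
  with C(3) have near: "\<exists>g\<in>C. hdist ell2 g h < e/2" if "h \<in> I" for h
    using that by fastforce
  have "\<exists>F. finite F \<and> l2_norm (\<lambda>i. g i - l2_cut F g i) < e/2" if "g \<in> C" for g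
    using l2_tail_small[of g "e/2"] that Cl e by (metis half_gt_zero subset_iff)
  then obtain Fg where Fg: "\<And>g. g \<in> C \<Longrightarrow> finite (Fg g) \<and> l2_norm (\<lambda>i. g i - l2_cut (Fg g) g i) < e/2"
    by metis
  define F where "F = (\<Union>g\<in>C. Fg g)"
  have F: "finite F" using C(1) Fg by (auto simp: F_def)
  have unit: "l2_norm (\<lambda>i. h i - l2_cut F h i) \<le> e" if hI: "h \<in> I" for h
  proof -
    obtain g where g: "g \<in> C" "hdist ell2 g h < e/2" using near[OF hI] by blast
    have gl: "g \<in> l2" and hl: "h \<in> l2" using g(1) Cl hI I by auto
    have d: "(\<lambda>i. h i - g i) \<in> l2" by (rule l2_diff(1)[OF hl gl])
    have "l2_norm (\<lambda>i. h i - l2_cut F h i)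
        = l2_norm (\<lambda>i. l2_cut (-F) (\<lambda>i. h i - g i) i + (g i - l2_cut F g i))"
      by (intro arg_cong[of _ _ l2_norm]) (auto simp: l2_cut_def fun_eq_iff)
    also have "\<dots> \<le> l2_norm (l2_cut (-F) (\<lambda>i. h i - g i)) + l2_norm (\<lambda>i. g i - l2_cut F g i)"
      by (rule l2_add(2)[OF l2_cut(1)[OF d] l2_diff(1)[OF gl l2_cut(1)[OF gl]]])
    also have "\<dots> \<le> l2_norm (\<lambda>i. h i - g i) + l2_norm (\<lambda>i. g i - l2_cut (Fg g) g i)"
      using g(1) by (intro add_mono l2_cut(2)[OF d] l2_tail_antimono gl) (auto simp: F_def)
    also have "\<dots> \<le> e/2 + e/2"
      using g Fg[OF g(1)] gl hl by (intro add_mono) (auto simp: hdist_ell2 l2_norm_minus_commute[of h g])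
    finally show ?thesis by simp
  qed
  have "l2_norm (\<lambda>i. K f i - l2_cut F (K f) i) \<le> e * l2_norm f" if f: "f \<in> l2" for f
  proof (cases "l2_norm f = 0")
    case True
    then have "f = (\<lambda>i. 0)" using l2_norm_eq_0[OF f] by simp
    then have "K f = (\<lambda>i. 0)" using Ks[OF l2_zero, of 0] by simp
    then show ?thesis using True by (simp add: l2_cut_def)
  next
    case False
    define c where "c = 1 / l2_norm f"
    have c: "0 < c" using False l2_norm_nonneg[of f] by (simp add: c_def less_le)
    have "l2_norm (\<lambda>i. of_real c * f i) = 1"
      using False c by (simp add: l2_smult(2)[OF f]) (simp add: c_def)
    then have "K (\<lambda>i. of_real c * f i) \<in> I" using l2_smult(1)[OF f] by (auto simp: I_def)
    from unit[OF this] have "l2_norm (\<lambda>i. of_real c * (K f i - l2_cut F (K f) i)) \<le> e"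
      by (simp add: Ks[OF f] l2_cut_def if_distrib right_diff_distrib cong: if_cong)
    then have "c * l2_norm (\<lambda>i. K f i - l2_cut F (K f) i) \<le> e"
      using c by (simp add: l2_smult(2)[OF l2_diff(1)[OF Kl[OF f] l2_cut(1)[OF Kl[OF f]]]])
    then show ?thesis using False c l2_norm_nonneg[of f] by (simp add: c_def field_simps)
  qed
  with F show ?thesis by (rule that)
qed

section \<open>Permutation representations\<close>

locale transitive_action = group G for G :: "'g monoid" (structure) +
  fixes act :: "'g \<Rightarrow> 'i \<Rightarrow> 'i"
  assumes act_one: "act \<one> i = i"
    and act_mult: "g \<in> carrier G \<Longrightarrow> h \<in> carrier G \<Longrightarrow> act (g \<otimes> h) i = act g (act h i)"
    and transitive: "\<exists>g\<in>carrier G. act g i = j"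
begin

lemma act_inv [simp]:
  assumes "g \<in> carrier G"
  shows "act (inv g) (act g i) = i" "act g (act (inv g) i) = i"
  using assms act_mult[of "inv g" g i] act_mult[of g "inv g" i] act_one by auto

lemma bij_act: "g \<in> carrier G \<Longrightarrow> bij (act g)"
  by (rule o_bij[of "act (inv g)"]) auto

lemma act_inv_eq_iff: "g \<in> carrier G \<Longrightarrow> act (inv g) i = j \<longleftrightarrow> i = act g j"
  by (metis act_inv)

definition translate :: "'g \<Rightarrow> ('i \<Rightarrow> complex) \<Rightarrow> 'i \<Rightarrow> complex" where
  "translate g f = (\<lambda>i. f (act (inv g) i))"

lemma translate_l2: "g \<in> carrier G \<Longrightarrow> f \<in> l2 \<Longrightarrow> translate g f \<in> l2"
  unfolding translate_def by (rule l2_permute(1)[OF bij_act]) auto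

lemma l2_norm_translate: "g \<in> carrier G \<Longrightarrow> l2_norm (translate g f) = l2_norm f"
  unfolding translate_def by (rule l2_permute(2)[OF bij_act]) auto

lemma translate_mult:
  "g \<in> carrier G \<Longrightarrow> h \<in> carrier G \<Longrightarrow> translate (g \<otimes> h) f = translate g (translate h f)"
  by (simp add: translate_def inv_mult_group act_mult)

lemma translate_unit: "g \<in> carrier G \<Longrightarrow> translate g (l2_unit x) = l2_unit (act g x)"
  by (simp add: translate_def l2_unit_def act_inv_eq_iff)

lemma translate_add: "translate g (\<lambda>i. f i + h i) = (\<lambda>i. translate g f i + translate g h i)"
  and translate_smult: "translate g (\<lambda>i. z * f i) = (\<lambda>i. z * translate g f i)"
  by (simp_all add: translate_def)

definition rep :: "'g \<Rightarrow> ('i \<Rightarrow> complex) \<Rightarrow> 'i \<Rightarrow> complex" where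
  "rep g = restrict (translate g) l2"

lemma rep_bounded_operator: "g \<in> carrier G \<Longrightarrow> rep g \<in> bounded_operators ell2"
  unfolding bounded_operators_ell2_iff
  by (intro conjI exI[of _ 1])
    (auto simp: rep_def translate_l2 l2_norm_translate l2_add l2_smult translate_add translate_smult)

lemma rep_hom: "rep \<in> hom G (unitary_group ell2)"
proof (rule homI)
  fix g assume g: "g \<in> carrier G"
  have "rep g ` l2 = l2"
  proof
    show "rep g ` l2 \<subseteq> l2" using g by (auto simp: rep_def translate_l2)
    show "l2 \<subseteq> rep g ` l2"
    proof
      fix f :: "'i \<Rightarrow> complex" assume f: "f \<in> l2"
      have "rep g (translate (inv g) f) = translate g (translate (inv g) f)"
        using g f by (simp add: rep_def translate_l2)
      also have "\<dots> = f" using g by (simp add: translate_def)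
      finally show "f \<in> rep g ` l2" using g f by (metis image_eqI inv_closed translate_l2)
    qed
  qed
  moreover have "hinner ell2 (rep g f) (rep g h) = hinner ell2 f h" if "f \<in> l2" "h \<in> l2" for f h
    using that g infsum_reindex_bij_betw[OF bij_act[of "inv g"], of "\<lambda>i. f i * cnj (h i)"]
    by (simp add: rep_def translate_def)
  ultimately show "rep g \<in> carrier (unitary_group ell2)"
    using rep_bounded_operator[OF g] by (simp add: unitary_group_def)
next
  fix g h assume "g \<in> carrier G" "h \<in> carrier G"
  then show "rep (g \<otimes> h) = rep g \<otimes>\<^bsub>unitary_group ell2\<^esub> rep h"
    by (auto simp: unitary_group_def rep_def translate_mult translate_l2 compose_def fun_eq_iff)
qed

end

lemma (in transitive_action) unitary_rep:
  assumes "countable (UNIV :: 'i set)"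
  shows "unitary_rep G (ell2 :: ('i \<Rightarrow> complex) hilbert) rep"
  unfolding unitary_rep_def using hilbert_space_ell2 separable_ell2[OF assms] rep_hom by auto

section \<open>Spectral gap off a fixed point\<close>

text \<open>
  The gap says that no function vanishing at the fixed point \<open>x0\<close> is almost invariant under the
  elements \<open>s k\<close>. They are given as a family in order that repetitions do no harm.
\<close>
locale gap_action = transitive_action +
  fixes s :: "'k \<Rightarrow> 'a" and K :: "'k set" and x0 :: 'b and c :: real
  assumes finite_K: "finite K" and K_nonempty: "K \<noteq> {}"
    and s_closed: "k \<in> K \<Longrightarrow> s k \<in> carrier G"
    and s_fix: "k \<in> K \<Longrightarrow> act (s k) x0 = x0"
    and c_pos: "0 < c"
    and gap: "f \<in> l2 \<Longrightarrow> f x0 = 0 \<Longrightarrow>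
      l2_norm f \<le> c * (\<Sum>k\<in>K. l2_norm (\<lambda>i. translate (s k) f i - f i))"
begin

text \<open>
  Averaging the midpoints of \<open>f\<close> and its translates, instead of the translates themselves, makes the
  gap applicable directly: a midpoint is shorter than \<open>f\<close> unless the translate is close to \<open>f\<close>.
\<close>
definition walk :: "('b \<Rightarrow> complex) \<Rightarrow> 'b \<Rightarrow> complex" where
  "walk f = (\<lambda>i. \<Sum>k\<in>K. (1 / of_nat (card K)) * ((f i + translate (s k) f i) / 2))"

lemma card_K: "0 < real (card K)"
  using finite_K K_nonempty by (simp add: card_gt_0_iff)

lemma walk_l2: "f \<in> l2 \<Longrightarrow> walk f \<in> l2"
proof -
  assume f: "f \<in> l2"
  have "(\<lambda>i. (f i + translate (s k) f i) / 2) \<in> l2" if "k \<in> K" for k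
    using l2_smult(1)[OF l2_add(1)[OF f translate_l2[OF s_closed[OF that] f]], of "1/2"] by simp
  then show ?thesis
    unfolding walk_def by (intro l2_sum(1) finite_K l2_smult(1)) auto
qed

lemma walk_add: "walk (\<lambda>i. f i + g i) = (\<lambda>i. walk f i + walk g i)"
  unfolding walk_def translate_def
  by (simp add: fun_eq_iff sum.distrib[symmetric]) (auto intro!: sum.cong simp: add_divide_distrib algebra_simps)

lemma walk_smult: "walk (\<lambda>i. z * f i) = (\<lambda>i. z * walk f i)"
  unfolding walk_def translate_def
  by (auto simp: fun_eq_iff sum_distrib_left intro!: sum.cong simp: algebra_simps)

lemma translate_s_x0: "k \<in> K \<Longrightarrow> translate (s k) f x0 = f x0"
  using act_inv_eq_iff[OF s_closed, of k x0 x0] s_fix by (simp add: translate_def)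

lemma walk_x0: "walk f x0 = f x0"
  using card_K by (simp add: walk_def translate_s_x0)

lemma walk_unit_x0: "walk (l2_unit x0) = l2_unit x0"
  using card_K by (simp add: walk_def translate_unit s_closed s_fix)

text \<open>
  The \<open>8\<close> stems from \<open>l2_midpoint_norm\<close>. One factor \<open>card K\<close> comes from taking the average and the
  other one from the Cauchy-Schwarz inequality for the sum in the gap. The maximum with \<open>1\<close> ensures
  that the factor is not negative.
\<close>
definition contraction_factor :: real where "contraction_factor = 1 - 1 / (8 * (max c 1)\<^sup>2 * (real (card K))\<^sup>2)"

lemma contraction_factor_bounds: "0 \<le> contraction_factor" "contraction_factor < 1"
proof -
  have m: "1 \<le> max c 1" and n: "1 \<le> real (card K)" using card_K by auto
  have "1 \<le> (max c 1)\<^sup>2 * (real (card K))\<^sup>2"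
    using mult_mono[of 1 "(max c 1)\<^sup>2" 1 "(real (card K))\<^sup>2"] one_le_power[OF m, of 2] one_le_power[OF n, of 2] by auto
  then show "0 \<le> contraction_factor" "contraction_factor < 1" by (simp_all add: contraction_factor_def mult.assoc)
qed

lemma walk_contraction:
  assumes f: "f \<in> l2" and "f x0 = 0"
  shows "l2_norm (walk f) \<le> contraction_factor * l2_norm f"
proof (cases "l2_norm f = 0")
  case True
  then have "f = (\<lambda>i. 0)" using l2_norm_eq_0[OF f] by simp
  then have "walk f = (\<lambda>i. 0)" using walk_smult[of 0 f] by simp
  then show ?thesis using True by simp
next
  case False
  define N n d where "N = l2_norm f" and "n = real (card K)"
    and "d = (\<lambda>k. l2_norm (\<lambda>i. translate (s k) f i - f i))"
  have N: "0 < N" using False l2_norm_nonneg[of f] by (simp add: N_def less_le)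
  have n: "0 < n" using card_K by (simp add: n_def)
  define m where "m = (\<lambda>k i. (f i + translate (s k) f i) / 2)"
  have m: "m k \<in> l2" if "k \<in> K" for k
    unfolding m_def
    using l2_smult(1)[OF l2_add(1)[OF f translate_l2[OF s_closed[OF that] f]], of "1/2"] by simp
  have mN: "l2_norm (m k) \<le> N - (d k)\<^sup>2 / (8 * N)" if "k \<in> K" for k
    unfolding m_def N_def d_def
    using l2_midpoint_norm[OF f translate_l2[OF s_closed[OF that] f] l2_norm_translate[OF s_closed[OF that]]] N
    by (simp add: N_def)
  have "walk f = (\<lambda>i. \<Sum>k\<in>K. (1 / of_nat (card K)) * m k i)" by (simp only: walk_def m_def)
  then have "l2_norm (walk f) \<le> (\<Sum>k\<in>K. l2_norm (\<lambda>i. (1 / of_nat (card K)) * m k i))"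
    by (simp only:) (intro l2_sum(2) finite_K l2_smult(1) m)
  also have "\<dots> = (\<Sum>k\<in>K. l2_norm (m k) / n)"
  proof (intro sum.cong refl)
    fix k assume "k \<in> K"
    show "l2_norm (\<lambda>i. (1 / of_nat (card K)) * m k i) = l2_norm (m k) / n"
      unfolding l2_smult(2)[OF m[OF \<open>k \<in> K\<close>]] by (simp add: norm_divide n_def)
  qed
  also have "\<dots> = (\<Sum>k\<in>K. l2_norm (m k)) / n" by (simp add: sum_divide_distrib)
  also have "\<dots> \<le> (\<Sum>k\<in>K. N - (d k)\<^sup>2 / (8 * N)) / n"
    using n by (intro divide_right_mono sum_mono mN) auto
  also have "\<dots> = N - (\<Sum>k\<in>K. (d k)\<^sup>2) / (8 * N * n)"
    using n by (simp add: sum_subtractf n_def sum_divide_distrib[symmetric] diff_divide_distrib)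
  also have "\<dots> \<le> N - (N\<^sup>2 / ((max c 1)\<^sup>2 * n)) / (8 * N * n)"
  proof -
    have "N \<le> max c 1 * (\<Sum>k\<in>K. d k)"
      using gap[OF assms] mult_right_mono[of c "max c 1" "\<Sum>k\<in>K. d k"]
      by (simp add: N_def d_def sum_nonneg)
    then have "N\<^sup>2 \<le> (max c 1 * (\<Sum>k\<in>K. d k))\<^sup>2" using N by (intro power_mono) auto
    also have "\<dots> \<le> (max c 1)\<^sup>2 * ((\<Sum>k\<in>K. (d k)\<^sup>2) * n)"
      unfolding power_mult_distrib n_def
      using sum_squared_le_sum_of_squares[of d K] by (intro mult_left_mono) auto
    finally have "N\<^sup>2 / ((max c 1)\<^sup>2 * n) \<le> (\<Sum>k\<in>K. (d k)\<^sup>2)"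
      using n by (simp add: pos_divide_le_eq mult_ac)
    then show ?thesis using N n by (intro diff_left_mono divide_right_mono) auto
  qed
  also have "\<dots> = contraction_factor * N"
    using N n by (simp add: contraction_factor_def n_def[symmetric] field_simps power2_eq_square)
  finally show ?thesis by (simp add: N_def)
qed

lemma walk_power_l2: "f \<in> l2 \<Longrightarrow> (walk ^^ n) f \<in> l2"
  by (induction n) (auto simp: walk_l2)

lemma walk_power_x0: "(walk ^^ n) f x0 = f x0"
  by (induction n) (auto simp: walk_x0)

text \<open>
  Subtracting \<open>f x0\<close> times the fixed point mass leaves a function that vanishes at \<open>x0\<close>, to which
  the contraction applies repeatedly.
\<close>
lemma walk_power_limit:
  assumes f: "f \<in> l2"
  shows "l2_norm (\<lambda>i. (walk ^^ n) f i - f x0 * l2_unit x0 i) \<le> contraction_factor ^ n * l2_norm f"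
proof (induction n)
  case 0
  have "l2_norm (\<lambda>i. f i - f x0 * l2_unit x0 i) \<le> l2_norm f"
    by (rule l2_mono(2)[OF f]) (simp add: l2_unit_def)
  then show ?case by simp
next
  case (Suc n)
  define g where "g = (walk ^^ n) f"
  define h where "h = (\<lambda>i. g i - f x0 * l2_unit x0 i)"
  have g: "g \<in> l2" using walk_power_l2[OF f] by (simp add: g_def)
  have h: "h \<in> l2" unfolding h_def by (rule l2_diff(1)[OF g l2_smult(1)[OF l2_unit]])
  have h0: "h x0 = 0" by (simp add: h_def g_def walk_power_x0 l2_unit_def)
  have "g = (\<lambda>i. h i + f x0 * l2_unit x0 i)" by (simp add: h_def)
  then have "walk g = (\<lambda>i. walk h i + f x0 * l2_unit x0 i)"
    by (simp only: walk_add walk_smult walk_unit_x0)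
  then have "(\<lambda>i. (walk ^^ Suc n) f i - f x0 * l2_unit x0 i) = walk h"
    by (simp add: g_def)
  then have "l2_norm (\<lambda>i. (walk ^^ Suc n) f i - f x0 * l2_unit x0 i) \<le> contraction_factor * l2_norm h"
    using walk_contraction[OF h h0] by simp
  also have "\<dots> \<le> contraction_factor * (contraction_factor ^ n * l2_norm f)"
    using Suc contraction_factor_bounds by (intro mult_left_mono) (auto simp: h_def g_def)
  finally show ?case by simp
qed

end

section \<open>Irreducibility and compact operators\<close>
context gap_action begin

lemma contraction_factor_power_tendsto: "(\<lambda>n. contraction_factor ^ n * B) \<longlonglongrightarrow> 0"
  by (rule tendsto_mult_left_zero[OF LIMSEQ_realpow_zero[OF contraction_factor_bounds]])

text \<open>
  A nonzero vector of an invariant subspace can be moved so that it does not vanish at \<open>x0\<close>. Its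
  images under powers of \<^const>\<open>walk\<close> converge to a nonzero multiple of the point mass at \<open>x0\<close>, and
  translates of the latter span a dense subspace.
\<close>
lemma irreducible: "irreducible_rep G ell2 rep"
  unfolding irreducible_rep_def
proof (intro conjI allI impI)
  show "carrier (ell2 :: ('b \<Rightarrow> complex) hilbert) \<noteq> {\<zero>\<^bsub>ell2\<^esub>}"
  proof
    assume "carrier (ell2 :: ('b \<Rightarrow> complex) hilbert) = {\<zero>\<^bsub>ell2\<^esub>}"
    then have "l2_unit x0 = (\<lambda>i::'b. 0)" using l2_unit[of x0] unfolding ell2_simps by blast
    then have "l2_norm (l2_unit x0) = l2_norm (\<lambda>i::'b. 0)" by (rule arg_cong)
    then show False by simp
  qed
  fix W :: "('b \<Rightarrow> complex) set"
  assume W: "subspace_of W ell2 \<and> closedin (htopology ell2) W \<and> (\<forall>g\<in>carrier G. rep g ` W \<subseteq> W)"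
  then have sub: "subspace_of W ell2" and closed: "closedin (htopology ell2) W" by auto
  note Wl = subspace_of_ell2D(1)[OF sub] and Wa = subspace_of_ell2D(3)[OF sub]
    and Wc = subspace_of_ell2D(4)[OF sub]
  have Wt: "translate g f \<in> W" if "g \<in> carrier G" "f \<in> W" for g f
  proof -
    have "rep g f \<in> W" using W that by (simp add: image_subset_iff)
    then show ?thesis using Wl[OF that(2)] by (simp add: rep_def)
  qed
  have lim: "g \<in> W" if "\<And>k::nat. f k \<in> W" "g \<in> l2" "(\<lambda>k. l2_norm (\<lambda>i. f k i - g i)) \<longlonglongrightarrow> 0" for f g
  proof -
    have "limitin (htopology ell2) f g sequentially"
      by (subst limitin_ell2) (use that Wl in auto)
    moreover have "range f \<subseteq> W" using that(1) by auto
    ultimately show ?thesis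
      using closed by (simp add: Metric_space.metric_closedin_iff_sequentially_closed[OF Metric_space_ell2])
  qed
  show "W = {\<zero>\<^bsub>ell2\<^esub>} \<or> W = carrier ell2"
  proof (rule disjCI)
    assume "W \<noteq> carrier ell2"
    show "W = {\<zero>\<^bsub>ell2\<^esub>}"
    proof (rule ccontr)
      assume "W \<noteq> {\<zero>\<^bsub>ell2\<^esub>}"
      then obtain w where "w \<in> W" "w \<noteq> (\<lambda>i. 0)" using subspace_of_ell2D(2)[OF sub] by auto
      then obtain x where w: "w \<in> W" "w x \<noteq> 0" by auto
      obtain g where g: "g \<in> carrier G" "act g x = x0" using transitive by blast
      define v where "v = translate g w"
      have v: "v \<in> W" unfolding v_def by (rule Wt[OF g(1) w(1)])
      have v0: "v x0 \<noteq> 0" using w(2) act_inv(1)[OF g(1), of x] g(2) by (simp add: v_def translate_def)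
      have walkW: "walk f \<in> W" if "f \<in> W" for f
      proof -
        have "(\<lambda>i. (1 / of_nat (card K)) * ((1/2) * (f i + translate (s k) f i))) \<in> W" if "k \<in> K" for k
          by (intro Wc Wa Wt s_closed that \<open>f \<in> W\<close>)
        from subspace_of_ell2_sum[OF sub finite_K this] show ?thesis by (simp add: walk_def)
      qed
      have "(walk ^^ n) v \<in> W" for n by (induction n) (auto intro: v walkW)
      moreover have "(\<lambda>n. l2_norm (\<lambda>i. (walk ^^ n) v i - v x0 * l2_unit x0 i)) \<longlonglongrightarrow> 0"
        by (rule tendsto_sandwich[OF _ _ tendsto_const contraction_factor_power_tendsto[of "l2_norm v"]])
          (auto intro!: always_eventually walk_power_limit Wl v)
      ultimately have "(\<lambda>i. v x0 * l2_unit x0 i) \<in> W" by (rule lim[OF _ l2_smult(1)[OF l2_unit]])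
      from Wc[OF this, of "1 / v x0"] have unit0: "l2_unit x0 \<in> W" using v0 by simp
      have unit: "l2_unit y \<in> W" for y
      proof -
        obtain h where "h \<in> carrier G" "act h x0 = y" using transitive by blast
        then show ?thesis using Wt[OF _ unit0, of h] by (simp add: translate_unit)
      qed
      have cut: "l2_cut F f \<in> W" if "finite F" for F f
        unfolding l2_cut_sum[OF that] by (intro subspace_of_ell2_sum[OF sub that] Wc unit)
      have "f \<in> W" if f: "f \<in> l2" for f
      proof -
        have "\<exists>F. finite F \<and> l2_norm (\<lambda>i. f i - l2_cut F f i) < 1 / real (Suc n)" for n
          using l2_tail_small[OF f, of "1 / real (Suc n)"] by (metis of_nat_0_less_iff zero_less_Suc zero_less_divide_1_iff)
        then obtain F where F: "\<And>n. finite (F n)" "\<And>n. l2_norm (\<lambda>i. f i - l2_cut (F n) f i) < 1 / real (Suc n)"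
          by metis
        have "(\<lambda>n. l2_norm (\<lambda>i. f i - l2_cut (F n) f i)) \<longlonglongrightarrow> 0"
          by (rule tendsto_sandwich[OF _ _ tendsto_const LIMSEQ_inverse_real_of_nat])
            (use F(2) in \<open>auto intro!: always_eventually less_imp_le simp: inverse_eq_divide\<close>)
        then have "(\<lambda>n. l2_norm (\<lambda>i. l2_cut (F n) f i - f i)) \<longlonglongrightarrow> 0"
          by (subst l2_norm_minus_commute)
        then show ?thesis by (rule lim[OF cut[OF F(1)] f])
      qed
      then show False using \<open>W \<noteq> carrier ell2\<close> Wl by auto
    qed
  qed
qed

context
  fixes A
  assumes A: "cstar_subalgebra ell2 A" and rep_A: "rep ` carrier G \<subseteq> A"
begin

text \<open>
  From here on, \<open>A\<close> is an arbitrary C*-algebra of operators containing the image of the group. Its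
  members are written as restrictions of unrestricted functions, for which composition and sums are
  easier to handle.
\<close>
lemma A_closed:
  shows "(\<lambda>x\<in>carrier ell2. \<zero>\<^bsub>ell2\<^esub>) \<in> A"
    and "\<forall>S\<in>A. \<forall>T\<in>A. (\<lambda>x\<in>carrier ell2. S x \<oplus>\<^bsub>ell2\<^esub> T x) \<in> A"
    and "\<forall>c. \<forall>T\<in>A. (\<lambda>x\<in>carrier ell2. c \<odot>\<^bsub>ell2\<^esub> T x) \<in> A"
    and "\<forall>S\<in>A. \<forall>T\<in>A. compose (carrier ell2) S T \<in> A"
    and "\<forall>T\<in>bounded_operators ell2.
      (\<forall>e>0. \<exists>S\<in>A. \<forall>x\<in>carrier ell2. hdist ell2 (T x) (S x) \<le> e * hnorm ell2 x) \<longrightarrow> T \<in> A"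
proof -
  note A' = A[unfolded cstar_subalgebra_def]
  show "(\<lambda>x\<in>carrier ell2. \<zero>\<^bsub>ell2\<^esub>) \<in> A" using A' by (elim conjE)
  show "\<forall>S\<in>A. \<forall>T\<in>A. (\<lambda>x\<in>carrier ell2. S x \<oplus>\<^bsub>ell2\<^esub> T x) \<in> A" using A' by (elim conjE)
  show "\<forall>c. \<forall>T\<in>A. (\<lambda>x\<in>carrier ell2. c \<odot>\<^bsub>ell2\<^esub> T x) \<in> A" using A' by (elim conjE)
  show "\<forall>S\<in>A. \<forall>T\<in>A. compose (carrier ell2) S T \<in> A" using A' by (elim conjE)
  show "\<forall>T\<in>bounded_operators ell2.
      (\<forall>e>0. \<exists>S\<in>A. \<forall>x\<in>carrier ell2. hdist ell2 (T x) (S x) \<le> e * hnorm ell2 x) \<longrightarrow> T \<in> A"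
    using A' by (elim conjE)
qed

lemma A_zero: "(\<lambda>f\<in>l2. \<lambda>i. 0) \<in> A"
  using A_closed(1) by simp

lemma A_add:
  assumes "restrict S l2 \<in> A" "restrict T l2 \<in> A"
  shows "(\<lambda>f\<in>l2. \<lambda>i. S f i + T f i) \<in> A"
  using bspec[OF bspec[OF A_closed(2) assms(1)] assms(2)] by (simp cong: restrict_cong)

lemma A_smult:
  assumes "restrict T l2 \<in> A"
  shows "(\<lambda>f\<in>l2. \<lambda>i. z * T f i) \<in> A"
  using bspec[OF spec[OF A_closed(3)] assms, of z] by (simp cong: restrict_cong)

lemma A_comp:
  assumes "restrict S l2 \<in> A" "restrict T l2 \<in> A" "\<And>f. f \<in> l2 \<Longrightarrow> T f \<in> l2"
  shows "(\<lambda>f\<in>l2. S (T f)) \<in> A"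
  using bspec[OF bspec[OF A_closed(4) assms(1)] assms(2)] assms(3)
  by (simp add: compose_def cong: restrict_cong)

lemma A_sum:
  assumes "finite F" "\<And>k. k \<in> F \<Longrightarrow> restrict (T k) l2 \<in> A"
  shows "(\<lambda>f\<in>l2. \<lambda>i. \<Sum>k\<in>F. T k f i) \<in> A"
  using assms
proof (induction F rule: finite_induct)
  case empty
  show ?case using A_zero by (simp del: restrict_apply)
next
  case (insert k F)
  then show ?case using A_add[of "T k" "\<lambda>f i. \<Sum>k\<in>F. T k f i"] by (simp del: restrict_apply)
qed

lemma A_limit:
  assumes T: "restrict T l2 \<in> bounded_operators ell2"
    and lim: "\<And>e. 0 < e \<Longrightarrow> \<exists>S. restrict S l2 \<in> A \<and> (\<forall>f\<in>l2. S f \<in> l2 \<and> l2_norm (\<lambda>i. T f i - S f i) \<le> e * l2_norm f)"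
  shows "restrict T l2 \<in> A"
proof -
  have Tl: "T f \<in> l2" if "f \<in> l2" for f using T that by (auto simp: bounded_operators_ell2_iff)
  have "\<exists>S\<in>A. \<forall>x\<in>carrier ell2. hdist ell2 (restrict T l2 x) (S x) \<le> e * hnorm ell2 x" if e: "e > 0" for e
  proof -
    obtain S where S: "restrict S l2 \<in> A" "\<And>f. f \<in> l2 \<Longrightarrow> S f \<in> l2"
        "\<And>f. f \<in> l2 \<Longrightarrow> l2_norm (\<lambda>i. T f i - S f i) \<le> e * l2_norm f"
      using lim[OF e] by blast
    have "\<forall>x\<in>carrier ell2. hdist ell2 (restrict T l2 x) (restrict S l2 x) \<le> e * hnorm ell2 x"
      using S(2,3) Tl by (auto simp: hdist_ell2 hnorm_ell2)
    with S(1) show ?thesis by blast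
  qed
  with bspec[OF A_closed(5) T] show ?thesis by simp
qed

lemma A_translate: "g \<in> carrier G \<Longrightarrow> restrict (translate g) l2 \<in> A"
  using rep_A by (auto simp: rep_def[abs_def])

lemma A_id: "(\<lambda>f\<in>l2. f) \<in> A"
proof -
  have "translate \<one> = (\<lambda>f. f)" by (simp add: fun_eq_iff translate_def act_one)
  then show ?thesis using A_translate[OF one_closed] by simp
qed

lemma A_walk: "restrict walk l2 \<in> A"
proof -
  have "(\<lambda>f\<in>l2. \<lambda>i. \<Sum>k\<in>K. (1 / of_nat (card K)) * ((1/2) * (f i + translate (s k) f i))) \<in> A"
    by (intro A_sum[OF finite_K] A_smult A_add A_id A_translate s_closed)
  then show ?thesis unfolding walk_def[abs_def] by simp
qed

lemma A_walk_power: "restrict (walk ^^ n) l2 \<in> A"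
proof (induction n)
  case 0
  then show ?case using A_id by (simp add: id_def del: restrict_apply)
next
  case (Suc n)
  from A_comp[OF A_walk this walk_power_l2] show ?case by (simp add: comp_def del: restrict_apply)
qed

text \<open>
  This is the limit in norm of the powers of \<^const>\<open>walk\<close>, by the spectral gap.
\<close>
lemma A_rank_one_base: "(\<lambda>f\<in>l2. \<lambda>i. f x0 * l2_unit x0 i) \<in> A"
proof (rule A_limit)
  show "(\<lambda>f\<in>l2. \<lambda>i. f x0 * l2_unit x0 i) \<in> bounded_operators ell2"
    unfolding bounded_operators_ell2_iff
    by (intro conjI exI[of _ 1])
      (auto simp: l2_smult l2_add cmod_le_l2_norm algebra_simps)
  fix e :: real assume "0 < e"
  then obtain n where n: "contraction_factor ^ n < e"
    using real_arch_pow_inv[OF _ contraction_factor_bounds(2), of e] by blast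
  have "l2_norm (\<lambda>i. f x0 * l2_unit x0 i - (walk ^^ n) f i) \<le> e * l2_norm f" if f: "f \<in> l2" for f
  proof -
    have "l2_norm (\<lambda>i. f x0 * l2_unit x0 i - (walk ^^ n) f i) \<le> contraction_factor ^ n * l2_norm f"
      using walk_power_limit[OF f, of n] by (subst l2_norm_minus_commute)
    also have "\<dots> \<le> e * l2_norm f" using n by (intro mult_right_mono) auto
    finally show ?thesis .
  qed
  then show "\<exists>S. restrict S l2 \<in> A \<and> (\<forall>f\<in>l2. S f \<in> l2 \<and>
      l2_norm (\<lambda>i. f x0 * l2_unit x0 i - S f i) \<le> e * l2_norm f)"
    using A_walk_power[of n] walk_power_l2 by blast
qed

lemma A_matrix_unit: "(\<lambda>f\<in>l2. \<lambda>i. f y * l2_unit x i) \<in> A"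
proof -
  obtain g where g: "g \<in> carrier G" "act g x0 = x" using transitive by blast
  obtain h where h: "h \<in> carrier G" "act h y = x0" using transitive by blast
  have "(\<lambda>f\<in>l2. translate g (\<lambda>i. translate h f x0 * l2_unit x0 i)) \<in> A"
    using A_comp[OF A_translate[OF g(1)] A_comp[OF A_rank_one_base A_translate[OF h(1)]]] h(1)
    by (simp add: translate_l2 l2_smult)
  moreover have "translate h f x0 = f y" for f
    using act_inv(1)[OF h(1), of y] h(2) by (simp add: translate_def)
  ultimately show ?thesis using g by (simp add: translate_smult translate_unit)
qed

text \<open>
  The functional that takes the coordinate of \<open>T f\<close> at \<open>x\<close> is approximated by finite combinations of
  coordinates of \<open>f\<close>, which turn the operator into a finite combination of matrix units.
\<close>
lemma A_rank_one:
  assumes T: "T \<in> bounded_operators ell2"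
  shows "(\<lambda>f\<in>l2. \<lambda>i. T f x * l2_unit x i) \<in> A"
proof (rule A_limit)
  have "\<exists>B. \<forall>f\<in>l2. l2_norm (T f) \<le> B * l2_norm f"
    using T by (simp add: bounded_operators_ell2_iff)
  then obtain B where B: "\<And>f. f \<in> l2 \<Longrightarrow> l2_norm (T f) \<le> B * l2_norm f" by blast
  have Tl: "T f \<in> l2" if "f \<in> l2" for f using T that by (auto simp: bounded_operators_ell2_iff)
  have Ta: "T (\<lambda>i. f i + g i) = (\<lambda>i. T f i + T g i)" if "f \<in> l2" "g \<in> l2" for f g
    using T that by (auto simp: bounded_operators_ell2_iff)
  have Ts: "T (\<lambda>i. z * f i) = (\<lambda>i. z * T f i)" if "f \<in> l2" for z f
    using T that by (auto simp: bounded_operators_ell2_iff)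
  have Tb: "cmod (T f x) \<le> B * l2_norm f" if "f \<in> l2" for f
    using cmod_le_l2_norm[OF Tl[OF that], of x] B[OF that] by linarith
  show "(\<lambda>f\<in>l2. \<lambda>i. T f x * l2_unit x i) \<in> bounded_operators ell2"
    unfolding bounded_operators_ell2_iff
    by (intro conjI exI[of _ B])
      (auto simp: l2_smult l2_add Ta Ts Tb distrib_right mult.assoc)
  fix e :: real assume e: "0 < e"
  obtain F where F: "finite F"
      "\<And>f. f \<in> l2 \<Longrightarrow> cmod (T f x - (\<Sum>y\<in>F. f y * T (l2_unit y) x)) \<le> e * l2_norm f"
    by (rule l2_functional_approx[of "\<lambda>f. T f x" B e]) (use Ta Ts Tb e in auto)
  define S where "S = (\<lambda>f i. \<Sum>y\<in>F. T (l2_unit y) x * (f y * l2_unit x i))"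
  have "restrict S l2 \<in> A"
    unfolding S_def by (intro A_sum[OF F(1)] A_smult A_matrix_unit)
  moreover have S: "S f = (\<lambda>i. (\<Sum>y\<in>F. f y * T (l2_unit y) x) * l2_unit x i)" for f
    by (simp add: S_def sum_distrib_left mult_ac)
  have "S f \<in> l2" for f unfolding S by (rule l2_smult(1)[OF l2_unit])
  moreover have "l2_norm (\<lambda>i. T f x * l2_unit x i - S f i) \<le> e * l2_norm f" if "f \<in> l2" for f
    using F(2)[OF that] l2_smult(2)[OF l2_unit, of "T f x - (\<Sum>y\<in>F. f y * T (l2_unit y) x)" x]
    by (simp add: S left_diff_distrib)
  ultimately show "\<exists>S. restrict S l2 \<in> A \<and> (\<forall>f\<in>l2. S f \<in> l2 \<and>
      l2_norm (\<lambda>i. T f x * l2_unit x i - S f i) \<le> e * l2_norm f)" by blast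
qed

text \<open>
  Cutting off the image of a compact operator to a large finite set changes it by little in norm, and
  leaves a finite sum of operators as in \<open>A_rank_one\<close>.
\<close>
lemma A_compact:
  assumes T: "T \<in> compact_operators ell2"
  shows "T \<in> A"
proof -
  have Tb: "T \<in> bounded_operators ell2" using T by (simp add: compact_operators_def)
  then have Te: "restrict T l2 = T" and Tl: "\<And>f. f \<in> l2 \<Longrightarrow> T f \<in> l2"
    by (auto simp: bounded_operators_ell2_iff intro: extensional_restrict PiE_ext)
  have "restrict T l2 \<in> A"
  proof (rule A_limit)
    show "restrict T l2 \<in> bounded_operators ell2" using Tb Te by simp
    fix e :: real assume e: "0 < e"
    obtain F where F: "finite F" "\<And>f. f \<in> l2 \<Longrightarrow> l2_norm (\<lambda>i. T f i - l2_cut F (T f) i) \<le> e * l2_norm f"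
      using compact_operator_uniform_tail[OF T e] by blast
    have "(\<lambda>f\<in>l2. l2_cut F (T f)) \<in> A"
      unfolding l2_cut_sum[OF F(1)] by (intro A_sum[OF F(1)] A_rank_one Tb)
    then show "\<exists>S. restrict S l2 \<in> A \<and> (\<forall>f\<in>l2. S f \<in> l2 \<and> l2_norm (\<lambda>i. T f i - S f i) \<le> e * l2_norm f)"
      using F(2) l2_cut(1)[OF Tl] by (intro exI[of _ "\<lambda>f. l2_cut F (T f)"]) auto
  qed
  then show ?thesis using Te by simp
qed

end

lemma traceable: "traceable G ell2 rep"
  unfolding traceable_def cstar_generated_def using A_compact by blast

end

section \<open>Invariant means on commutative monoids\<close>

text \<open>
  Finitely additive probability measures on all subsets, concentrated on \<open>U\<close>.
\<close>
definition mean :: "'a set \<Rightarrow> ('a set \<Rightarrow> real) \<Rightarrow> bool" where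
  "mean U m \<longleftrightarrow> (\<forall>A. 0 \<le> m A) \<and> m UNIV = 1 \<and> m U = 1 \<and>
     (\<forall>A B. A \<inter> B = {} \<longrightarrow> m (A \<union> B) = m A + m B)"

lemma meanD:
  assumes "mean U m"
  shows "0 \<le> m A" and "m UNIV = 1" and "m U = 1"
    and "A \<inter> B = {} \<Longrightarrow> m (A \<union> B) = m A + m B"
  using assms by (auto simp: mean_def)

lemma mean_mono:
  assumes "mean U m" "A \<subseteq> B"
  shows "m A \<le> m B"
  using meanD(4)[OF assms(1), of A "B - A"] meanD(1)[OF assms(1), of "B - A"] assms(2)
  by (simp add: Un_absorb1)

lemma mean_le_1: "mean U m \<Longrightarrow> m A \<le> 1"
  using mean_mono[of U m A UNIV] meanD(2)[of U m] by simp

lemma mean_superset: "mean U m \<Longrightarrow> U \<subseteq> A \<Longrightarrow> m A = 1"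
  using mean_mono[of U m U A] mean_le_1[of U m A] meanD(3)[of U m] by simp

lemma mean_subadditive:
  assumes "mean U m"
  shows "m (A \<union> B) \<le> m A + m B"
  using meanD(4)[OF assms, of A "B - A"] mean_mono[OF assms, of "B - A" B] by simp

text \<open>
  Means form a closed subset of a product of unit intervals, which is compact by Tychonoff's theorem.
  Since this product need not be metrizable, a filter \<open>G\<close> on the means takes the place of a convergent
  subsequence.
\<close>
lemma mean_cluster_point:
  fixes m :: "nat \<Rightarrow> 'a set \<Rightarrow> real"
  assumes m: "\<And>k. mean U (m k)"
  obtains M G where "mean U M" "G \<noteq> bot" "\<And>A. ((\<lambda>f. f A) \<longlongrightarrow> M A) G"
    "\<And>P. eventually (\<lambda>k. P (m k)) sequentially \<Longrightarrow> eventually P G"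
proof -
  define C :: "('a set \<Rightarrow> real) set" where "C = (\<Pi>\<^sub>E A\<in>UNIV. {0..1})"
  have "compactin (product_topology (\<lambda>A::'a set. euclidean) UNIV) C"
    unfolding C_def compactin_PiE by (simp add: compactin_euclidean_iff)
  then have "compact C" by (simp add: euclidean_product_topology)
  moreover have "filtermap m sequentially \<noteq> bot" by (simp add: filtermap_bot_iff)
  moreover have "\<forall>\<^sub>F f in filtermap m sequentially. f \<in> C"
    using meanD(1)[OF m] mean_le_1[OF m] by (auto simp: eventually_filtermap C_def intro!: always_eventually)
  ultimately obtain M where M: "inf (nhds M) (filtermap m sequentially) \<noteq> bot"
    unfolding compact_filter by blast
  define G where "G = inf (nhds M) (filtermap m sequentially)"
  have G: "G \<noteq> bot" using M by (simp add: G_def)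
  have lim: "((\<lambda>f. f A) \<longlongrightarrow> M A) G" for A
  proof -
    have "continuous_on UNIV (\<lambda>f :: 'a set \<Rightarrow> real. f A)" by (rule continuous_on_product_coordinates)
    then have "((\<lambda>f. f A) \<longlongrightarrow> M A) (at M)" by (simp add: continuous_on_def)
    then have "((\<lambda>f. f A) \<longlongrightarrow> M A) (nhds M)"
      using tendsto_at_iff_tendsto_nhds[of "\<lambda>f. f A" M] by simp
    then show ?thesis by (rule tendsto_mono[rotated]) (simp add: G_def)
  qed
  have ev: "eventually P G" if "eventually (\<lambda>k. P (m k)) sequentially" for P
    using that filter_leD[of G "filtermap m sequentially" P] by (simp add: G_def eventually_filtermap)
  have "\<forall>\<^sub>F f in G. mean U f" by (rule ev) (simp add: m)
  have "mean U M"
    unfolding mean_def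
  proof (intro conjI allI impI)
    show "0 \<le> M A" for A
      by (rule tendsto_lowerbound[OF lim _ G]) (rule ev, simp add: meanD(1)[OF m])
    have one: "M A = 1" if "\<And>k. m k A = 1" for A
      by (rule tendsto_unique[OF G lim]) (rule tendsto_eventually, rule ev, simp add: that)
    show "M UNIV = 1" "M U = 1" using one meanD(2,3)[OF m] by auto
    fix A B :: "'a set" assume d: "A \<inter> B = {}"
    have "((\<lambda>f. f (A \<union> B)) \<longlongrightarrow> M A + M B) G"
      by (rule Lim_transform_eventually[OF tendsto_add[OF lim lim]])
        (rule ev, simp add: meanD(4)[OF m d])
    then show "M (A \<union> B) = M A + M B" using tendsto_unique[OF G lim] by blast
  qed
  with G lim ev show ?thesis using that by blast
qed

text \<open>
  The argument of Markov and Kakutani: average the translates of \<open>m\<close> by the powers of \<open>w\<close>. The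
  difference between such an average and its translate by \<open>w\<close> telescopes and tends to \<open>0\<close>, while the
  invariance that \<open>m\<close> already has is preserved because \<open>w\<close> commutes with \<open>W\<close>.
\<close>
lemma mean_add_invariance:
  fixes w :: "'a::comm_monoid_mult"
  assumes m: "mean U m" and w: "\<And>u. u \<in> U \<Longrightarrow> w * u \<in> U"
    and inv: "\<And>v A. v \<in> W \<Longrightarrow> m {u. v * u \<in> A} = m A"
  obtains M where "mean U M" "\<And>v A. v \<in> insert w W \<Longrightarrow> M {u. v * u \<in> A} = M A"
proof -
  define t where "t = (\<lambda>k A. m {u. w ^ k * u \<in> A})"
  define a where "a = (\<lambda>K A. (\<Sum>k<Suc K. t k A) / real (Suc K))"
  have wk: "w ^ k * u \<in> U" if "u \<in> U" for k u
    using that by (induction k) (auto simp: w mult.assoc)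
  have t: "mean U (t k)" for k
    unfolding mean_def
  proof (intro conjI allI impI)
    show "t k U = 1" unfolding t_def using wk by (intro mean_superset[OF m]) auto
    show "t k (A \<union> B) = t k A + t k B" if "A \<inter> B = {}" for A B
    proof -
      have "{u. w ^ k * u \<in> A \<union> B} = {u. w ^ k * u \<in> A} \<union> {u. w ^ k * u \<in> B}" by auto
      then show ?thesis unfolding t_def using that by (simp add: meanD(4)[OF m] disjoint_iff)
    qed
  qed (simp_all add: t_def meanD[OF m])
  have a: "mean U (a K)" for K
    unfolding mean_def a_def
    by (auto simp: meanD(1-3)[OF t] meanD(4)[OF t] sum.distrib add_divide_distrib
        intro!: divide_nonneg_pos sum_nonneg add_nonneg_nonneg)
  obtain M G where M: "mean U M" and G: "G \<noteq> bot" and lim: "\<And>A. ((\<lambda>f. f A) \<longlongrightarrow> M A) G"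
    and ev: "\<And>P. eventually (\<lambda>k. P (a k)) sequentially \<Longrightarrow> eventually P G"
    by (rule mean_cluster_point[OF a], rule that)
  have "M {u. v * u \<in> A} = M A" if v: "v \<in> insert w W" for v A
  proof -
    have diff: "\<bar>a K {u. v * u \<in> A} - a K A\<bar> \<le> 1 / real (Suc K)" for K
    proof (cases "v \<in> W")
      case True
      have "t k {u. v * u \<in> A} = t k A" for k
        using inv[OF True, of "{u. w ^ k * u \<in> A}"] by (simp add: t_def mult.left_commute)
      then show ?thesis by (simp add: a_def)
    next
      case False
      then have "v = w" using v by simp
      then have t1: "t k {u. v * u \<in> A} = t (Suc k) A" for k by (simp add: t_def mult_ac)
      have "(\<Sum>k<Suc K. t (Suc k) A) - (\<Sum>k<Suc K. t k A) = t (Suc K) A - t 0 A"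
        using sum_lessThan_telescope[of "\<lambda>k. t k A" "Suc K"] by (simp only: sum_subtractf)
      then have "a K {u. v * u \<in> A} - a K A = (t (Suc K) A - t 0 A) / real (Suc K)"
        unfolding a_def t1 by (simp only: diff_divide_distrib[symmetric])
      moreover have "\<bar>t (Suc K) A - t 0 A\<bar> \<le> 1"
      proof -
        have "0 \<le> t k A" "t k A \<le> 1" for k using meanD(1)[OF t] mean_le_1[OF t] by auto
        from this[of 0] this[of "Suc K"] show ?thesis by linarith
      qed
      ultimately show ?thesis by (simp add: divide_right_mono)
    qed
    have "((\<lambda>f. f {u. v * u \<in> A} - f A) \<longlongrightarrow> 0) G"
    proof (rule tendstoI)
      fix e :: real assume "0 < e"
      then obtain N where N: "1 / real (Suc N) < e" using nat_approx_posE by blast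
      show "\<forall>\<^sub>F f in G. dist (f {u. v * u \<in> A} - f A) 0 < e"
      proof (rule ev, rule eventually_sequentiallyI[of N])
        fix K assume "N \<le> K"
        then have "1 / real (Suc K) \<le> 1 / real (Suc N)" by (simp add: frac_le)
        then show "dist (a K {u. v * u \<in> A} - a K A) 0 < e" using diff[of K] N by (simp add: dist_real_def)
      qed
    qed
    from tendsto_unique[OF G this tendsto_diff[OF lim lim]] show ?thesis by simp
  qed
  with M show ?thesis by (rule that)
qed

theorem invariant_mean_exists:
  fixes U W :: "'a::comm_monoid_mult set"
  assumes W: "countable W" and U: "1 \<in> U" "\<And>w u. w \<in> W \<Longrightarrow> u \<in> U \<Longrightarrow> w * u \<in> U"
  obtains M where "mean U M" "\<And>w A. w \<in> W \<Longrightarrow> M {u. w * u \<in> A} = M A"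
proof (cases "W = {}")
  case True
  have "mean U (\<lambda>A. of_bool (1 \<in> A))" using U(1) by (auto simp: mean_def)
  then show ?thesis using True that by blast
next
  case False
  define w where "w = from_nat_into W"
  have rw: "range w = W" unfolding w_def using False W by (rule range_from_nat_into)
  have "\<exists>m. mean U m \<and> (\<forall>v\<in>w ` {..<n}. \<forall>A. m {u. v * u \<in> A} = m A)" for n
  proof (induction n)
    case 0
    have "mean U (\<lambda>A. of_bool (1 \<in> A))" using U(1) by (auto simp: mean_def)
    then show ?case by auto
  next
    case (Suc n)
    then obtain m where m: "mean U m" "\<And>v A. v \<in> w ` {..<n} \<Longrightarrow> m {u. v * u \<in> A} = m A" by blast
    have wn: "w n * u \<in> U" if "u \<in> U" for u using U(2) rw that by blast
    obtain M where "mean U M" "\<And>v A. v \<in> insert (w n) (w ` {..<n}) \<Longrightarrow> M {u. v * u \<in> A} = M A"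
      by (rule mean_add_invariance[OF m(1) wn m(2)], assumption+, rule that)
    then show ?case by (intro exI[of _ M]) (simp add: lessThan_Suc)
  qed
  then have "\<exists>m. \<forall>n. mean U (m n) \<and> (\<forall>v\<in>w ` {..<n}. \<forall>A. m n {u. v * u \<in> A} = m n A)"
    by (intro choice allI)
  then obtain m where m: "\<And>n. mean U (m n)" and inv: "\<And>n v A. v \<in> w ` {..<n} \<Longrightarrow> m n {u. v * u \<in> A} = m n A"
    by blast
  obtain M G where M: "mean U M" and G: "G \<noteq> bot" and lim: "\<And>A. ((\<lambda>f. f A) \<longlongrightarrow> M A) G"
    and ev: "\<And>P. eventually (\<lambda>k. P (m k)) sequentially \<Longrightarrow> eventually P G"
    by (rule mean_cluster_point[OF m], rule that)
  have "M {u. v * u \<in> A} = M A" if vW: "v \<in> W" for v A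
  proof -
    obtain k where k: "v = w k" using vW rw by blast
    have "\<forall>\<^sub>F f in G. f A = f {u. v * u \<in> A}"
      by (rule ev, rule eventually_sequentiallyI[of "Suc k"]) (simp add: inv k)
    from Lim_transform_eventually[OF lim this] show ?thesis
      by (rule tendsto_unique[OF G lim])
  qed
  with M show ?thesis by (rule that)
qed

section \<open>Comparing sizes in a domain\<close>

text \<open>
  Read \<open>C x y\<close> as ``\<open>y\<close> is nonzero, and \<open>x\<close> is not larger than \<open>y\<close>''. The last clause says that the
  set of pairs related by \<open>C\<close> has disjoint images under three row operations, so that
  it is small in the sense of paradoxical decompositions, although it and its mirror image cover all pairs
  other than \<open>(0, 0)\<close>.
\<close>
definition size_relation :: "('a::comm_ring_1 \<Rightarrow> 'a \<Rightarrow> bool) \<Rightarrow> (nat \<Rightarrow> 'a) \<Rightarrow> bool" where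
  "size_relation C s \<longleftrightarrow>
     (\<forall>x y. C x y \<longrightarrow> y \<noteq> 0) \<and>
     (\<forall>x y. x \<noteq> 0 \<or> y \<noteq> 0 \<longrightarrow> C x y \<or> C y x) \<and>
     (\<forall>i j x y. i < j \<longrightarrow> j < 3 \<longrightarrow> \<not> (C (x + s i * y) y \<and> C (x + s j * y) y))"

text \<open>
  Torsion free abelian groups can be ordered. By Zorn's lemma there is a maximal cone \<open>P\<close>. If an
  element \<open>y\<close> cannot be adjoined to \<open>P\<close>, then some negative multiple of \<open>y\<close> lies in \<open>P\<close>. If this
  were the case for both \<open>x\<close> and \<open>- x\<close>, then \<open>P\<close> would contain a positive multiple of \<open>x\<close> together
  with its negative, and \<open>x\<close> would be \<open>0\<close>.
\<close>
lemma positive_cone_exists: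
  assumes char0: "\<And>n::nat. 0 < n \<Longrightarrow> of_nat n \<noteq> (0::'a::idom)"
  obtains P :: "'a::idom set" where "0 \<in> P" "\<And>x y. x \<in> P \<Longrightarrow> y \<in> P \<Longrightarrow> x + y \<in> P"
    "\<And>x. x \<in> P \<Longrightarrow> - x \<in> P \<Longrightarrow> x = 0" "\<And>x. x \<in> P \<or> - x \<in> P"
proof -
  define cone :: "'a set \<Rightarrow> bool" where
    "cone P \<longleftrightarrow> 0 \<in> P \<and> (\<forall>x\<in>P. \<forall>y\<in>P. x + y \<in> P) \<and> (\<forall>x\<in>P. - x \<in> P \<longrightarrow> x = 0)" for P
  have "\<exists>P\<in>{P. cone P}. \<forall>Q\<in>{P. cone P}. P \<subseteq> Q \<longrightarrow> Q = P"
  proof (rule subset_Zorn_nonempty)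
    have "cone {0}" by (simp add: cone_def)
    then show "{P. cone P} \<noteq> {}" by blast
    fix \<C> :: "'a set set" assume ne: "\<C> \<noteq> {}" and chain: "subset.chain {P. cone P} \<C>"
    have cone: "cone P" if "P \<in> \<C>" for P using chain that by (auto simp: subset.chain_def)
    have both: "\<exists>P\<in>\<C>. x \<in> P \<and> y \<in> P" if "x \<in> \<Union>\<C>" "y \<in> \<Union>\<C>" for x y
    proof -
      obtain P Q where PQ: "P \<in> \<C>" "Q \<in> \<C>" "x \<in> P" "y \<in> Q" using \<open>x \<in> \<Union>\<C>\<close> \<open>y \<in> \<Union>\<C>\<close> by blast
      then have "P \<subseteq> Q \<or> Q \<subseteq> P" using chain by (auto simp: subset_chain_def)
      then show ?thesis using PQ by blast
    qed
    have "cone (\<Union>\<C>)"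
      unfolding cone_def
    proof (intro conjI ballI impI)
      obtain P where P: "P \<in> \<C>" using ne by auto
      from cone[OF P] have "0 \<in> P" by (simp add: cone_def)
      with P show "0 \<in> \<Union>\<C>" by auto
      fix x assume x: "x \<in> \<Union>\<C>"
      show "x + y \<in> \<Union>\<C>" if "y \<in> \<Union>\<C>" for y
        using both[OF x that] cone unfolding cone_def by blast
      show "x = 0" if "- x \<in> \<Union>\<C>"
        using both[OF x that] cone unfolding cone_def by blast
    qed
    then show "\<Union>\<C> \<in> {P. cone P}" by simp
  qed
  then obtain P where P: "cone P" and maximal: "\<And>Q. cone Q \<Longrightarrow> P \<subseteq> Q \<Longrightarrow> Q = P" by blast
  have zero: "0 \<in> P" and add: "\<And>x y. x \<in> P \<Longrightarrow> y \<in> P \<Longrightarrow> x + y \<in> P"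
    and anti: "\<And>x. x \<in> P \<Longrightarrow> - x \<in> P \<Longrightarrow> x = 0"
    using P by (auto simp: cone_def)
  have mult: "of_nat n * x \<in> P" if "x \<in> P" for n x
    by (induction n) (auto simp: zero distrib_right add that)
  have outside: "\<exists>n>0. - (of_nat n * y) \<in> P" if y: "y \<notin> P" for y
  proof (rule ccontr)
    assume "\<not> ?thesis"
    then have no: "- (of_nat n * y) \<notin> P" if "0 < n" for n using that by blast
    define Q where "Q = {p + of_nat a * y | p a. p \<in> P}"
    have QI: "p + of_nat a * y \<in> Q" if "p \<in> P" for p a using that by (auto simp: Q_def)
    have "cone Q"
      unfolding cone_def
    proof (intro conjI ballI impI)
      show "0 \<in> Q" using QI[OF zero, of 0] by simp
      fix z assume "z \<in> Q"
      then obtain p a where z: "z = p + of_nat a * y" "p \<in> P" by (auto simp: Q_def)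
      show "z + z' \<in> Q" if z': "z' \<in> Q" for z'
      proof -
        obtain p' a' where "z' = p' + of_nat a' * y" "p' \<in> P" using z' by (auto simp: Q_def)
        then show ?thesis using z QI[OF add[of p p'], of "a + a'"] by (simp add: algebra_simps)
      qed
      assume "- z \<in> Q"
      then obtain p' a' where z': "- z = p' + of_nat a' * y" "p' \<in> P" by (auto simp: Q_def)
      have "(p + of_nat a * y) + (p' + of_nat a' * y) = z + - z" by (simp only: z(1)[symmetric] z'(1)[symmetric])
      then have "p + p' + of_nat (a + a') * y = 0" by (simp add: algebra_simps)
      then have "p + p' = - (of_nat (a + a') * y)" by (simp add: eq_neg_iff_add_eq_0 del: of_nat_add)
      then have "- (of_nat (a + a') * y) \<in> P" using add[OF z(2) z'(2)] by simp
      then have "\<not> 0 < a + a'" using no[of "a + a'"] by blast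
      then show "z = 0" using z z' anti[of p] by auto
    qed
    moreover have "P \<subseteq> Q" using QI[of _ 0] by auto
    ultimately have "Q = P" by (rule maximal)
    then show False using QI[OF zero, of 1] y by simp
  qed
  have "x \<in> P \<or> - x \<in> P" for x
  proof (rule ccontr)
    assume no: "\<not> (x \<in> P \<or> - x \<in> P)"
    obtain n where n: "0 < n" "- (of_nat n * x) \<in> P" using outside no by blast
    obtain m where m: "0 < m" "- (of_nat m * - x) \<in> P" using outside no by blast
    have "of_nat n * (of_nat m * x) \<in> P" using mult[OF m(2), of n] by simp
    moreover have "- (of_nat n * (of_nat m * x)) \<in> P" using mult[OF n(2), of m] by (simp add: mult.left_commute)
    ultimately have "of_nat n * (of_nat m * x) = 0" by (rule anti)
    then show False using char0[OF n(1)] char0[OF m(1)] no zero by simp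
  qed
  with zero add anti show ?thesis by (rule that)
qed

text \<open>
  The relation is \<open>\<bar>x\<bar> \<le> \<bar>y\<bar>\<close> for the absolute value of an additive order. Two numbers of
  absolute value at most \<open>\<bar>y\<bar>\<close> differ by at most twice \<open>\<bar>y\<bar>\<close>, hence not by three or six
  times \<open>y\<close>.
\<close>
lemma size_relation_char_0:
  assumes char0: "\<And>n::nat. 0 < n \<Longrightarrow> of_nat n \<noteq> (0::'a::idom)"
  obtains C and s :: "nat \<Rightarrow> 'a::idom" where "size_relation C s"
proof -
  obtain P :: "'a set" where zero: "0 \<in> P" and add: "\<And>x y. x \<in> P \<Longrightarrow> y \<in> P \<Longrightarrow> x + y \<in> P"
    and anti: "\<And>x. x \<in> P \<Longrightarrow> - x \<in> P \<Longrightarrow> x = 0" and total: "\<And>x. x \<in> P \<or> - x \<in> P"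
    by (rule positive_cone_exists[OF char0], assumption, rule that)
  have mult: "of_nat n * x \<in> P" if "x \<in> P" for n x
    by (induction n) (auto simp: zero distrib_right add that)
  define C where "C = (\<lambda>x y. y \<noteq> 0 \<and> (\<exists>z. (z = y \<or> z = - y) \<and> z \<in> P \<and> z - x \<in> P \<and> z + x \<in> P))"
  have pre: "C x y" if z: "z = y \<or> z = - y" "z \<in> P" and w: "w = x \<or> w = - x" "w \<in> P"
    and wz: "z - w \<in> P" and nz: "x \<noteq> 0 \<or> y \<noteq> 0" for x y z w
  proof -
    have "y \<noteq> 0"
    proof
      assume "y = 0"
      then have "z = 0" using z by auto
      then have "w = 0" using wz w anti[of w] by simp
      then show False using w nz \<open>y = 0\<close> by auto
    qed
    moreover have "z + w \<in> P" using add[OF z(2) w(2)] .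
    ultimately show ?thesis unfolding C_def using z w wz by (intro conjI exI[of _ z]) auto
  qed
  have "C x y \<or> C y x" if nz: "x \<noteq> 0 \<or> y \<noteq> 0" for x y
  proof -
    obtain z where z: "z = y \<or> z = - y" "z \<in> P" using total[of y] by blast
    obtain w where w: "w = x \<or> w = - x" "w \<in> P" using total[of x] by blast
    show ?thesis
      using total[of "z - w"]
    proof
      assume "z - w \<in> P"
      then show ?thesis using pre[OF z w] nz by blast
    next
      assume "- (z - w) \<in> P"
      then have "w - z \<in> P" by simp
      then show ?thesis using pre[OF w z] nz by blast
    qed
  qed
  moreover have "\<not> (C (x + of_nat (3 * i) * y) y \<and> C (x + of_nat (3 * j) * y) y)" if ij: "i < j" for i j x y
  proof
    define x' where "x' = x + of_nat (3 * i) * y"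
    define e where "e = 3 * (j - i) - 2"
    have e: "3 * j = 3 * i + (e + 2)" "0 < e" using ij unfolding e_def by linarith+
    assume CC: "C (x + of_nat (3 * i) * y) y \<and> C (x + of_nat (3 * j) * y) y"
    have eq: "x + of_nat (3 * j) * y = x' + of_nat (e + 2) * y"
      unfolding e(1) x'_def by (simp only: of_nat_add distrib_right add.assoc)
    have C: "C x' y" "C (x' + of_nat (e + 2) * y) y"
      using CC unfolding eq x'_def[symmetric] by (rule conjunct1, rule conjunct2)
    then have y: "y \<noteq> 0" by (simp add: C_def)
    obtain z where z: "z = y \<or> z = - y" "z \<in> P" "z - x' \<in> P" "z + x' \<in> P"
      using C(1) by (auto simp: C_def)
    obtain w where w: "w = y \<or> w = - y" "w \<in> P" "w - (x' + of_nat (e + 2) * y) \<in> P" "w + (x' + of_nat (e + 2) * y) \<in> P"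
      using C(2) unfolding C_def by blast
    have "w = z" using z(1,2) w(1,2) y anti[of y] by auto
    have "- (of_nat e * z) \<in> P"
      using z(1)
    proof
      assume "z = y"
      then show ?thesis using add[OF z(4) w(3)] \<open>w = z\<close> by (simp add: algebra_simps)
    next
      assume "z = - y"
      then show ?thesis using add[OF z(3) w(4)] \<open>w = z\<close> by (simp add: algebra_simps)
    qed
    then have "of_nat e * z = 0" using mult[OF z(2), of e] anti by blast
    then show False using char0[OF e(2)] z(1) y by auto
  qed
  ultimately have "size_relation C (\<lambda>i. of_nat (3 * i))"
    unfolding size_relation_def by (auto simp: C_def)
  then show ?thesis by (rule that)
qed

definition is_subring :: "'b::comm_ring_1 set \<Rightarrow> bool" where
  "is_subring D \<longleftrightarrow> 1 \<in> D \<and> (\<forall>x\<in>D. \<forall>y\<in>D. x - y \<in> D \<and> x * y \<in> D)"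

lemma is_subringD:
  assumes "is_subring D"
  shows "1 \<in> D" "0 \<in> D" "x \<in> D \<Longrightarrow> y \<in> D \<Longrightarrow> x - y \<in> D" "x \<in> D \<Longrightarrow> - x \<in> D"
    "x \<in> D \<Longrightarrow> y \<in> D \<Longrightarrow> x + y \<in> D" "x \<in> D \<Longrightarrow> y \<in> D \<Longrightarrow> x * y \<in> D" "x \<in> D \<Longrightarrow> x ^ n \<in> D"
proof -
  have 1: "1 \<in> D" and diff: "\<And>x y. x \<in> D \<Longrightarrow> y \<in> D \<Longrightarrow> x - y \<in> D"
    and mult: "\<And>x y. x \<in> D \<Longrightarrow> y \<in> D \<Longrightarrow> x * y \<in> D"
    using assms by (auto simp: is_subring_def)
  have 0: "0 \<in> D" using diff[OF 1 1] by simp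
  have minus: "- x \<in> D" if "x \<in> D" for x using diff[OF 0 that] by simp
  show "1 \<in> D" "0 \<in> D" "x \<in> D \<Longrightarrow> y \<in> D \<Longrightarrow> x - y \<in> D" "x \<in> D \<Longrightarrow> - x \<in> D"
    "x \<in> D \<Longrightarrow> y \<in> D \<Longrightarrow> x * y \<in> D"
    using 1 0 diff minus mult by auto
  show "x \<in> D \<Longrightarrow> y \<in> D \<Longrightarrow> x + y \<in> D" using diff[OF _ minus, of x y] by simp
  show "x \<in> D \<Longrightarrow> x ^ n \<in> D" by (induction n) (auto simp: 1 mult)
qed

lemma is_subring_sum: "is_subring D \<Longrightarrow> (\<And>i. i \<in> I \<Longrightarrow> f i \<in> D) \<Longrightarrow> sum f I \<in> D"
  by (induction I rule: infinite_finite_induct) (auto simp: is_subringD)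

lemma is_subring_adjoin:
  fixes x :: "'a::comm_ring_1"
  assumes D: "is_subring D"
  defines "E \<equiv> {poly p x | p. \<forall>i. coeff p i \<in> D}"
  shows "is_subring E" and "D \<subseteq> E" and "x \<in> E"
proof -
  have EI: "poly p x \<in> E" if "\<And>i. coeff p i \<in> D" for p
    unfolding E_def using that by auto
  have const: "d \<in> E" if "d \<in> D" for d
    using EI[of "[:d:]"] that by (simp add: coeff_pCons is_subringD(2)[OF D] split: nat.split)
  then show "D \<subseteq> E" by blast
  show "x \<in> E"
    using EI[of "[:0, 1:]"] by (simp add: coeff_pCons is_subringD(1,2)[OF D] split: nat.split)
  show "is_subring E"
    unfolding is_subring_def
  proof (intro conjI ballI)
    show "1 \<in> E" using const is_subringD(1)[OF D] .
    fix a b assume "a \<in> E" "b \<in> E"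
    then obtain p r where p: "a = poly p x" "\<And>i. coeff p i \<in> D" and r: "b = poly r x" "\<And>i. coeff r i \<in> D"
      unfolding E_def by auto
    have "poly (p - r) x \<in> E"
      by (rule EI) (simp add: p r is_subringD(3)[OF D])
    then show "a - b \<in> E" by (simp add: p r)
    have "poly (p * r) x \<in> E"
      by (rule EI) (simp add: coeff_mult p r is_subring_sum[OF D] is_subringD(6)[OF D])
    then show "a * b \<in> E" by (simp add: p r)
  qed
qed

section \<open>Valuation rings\<close>
lemma maximal_subring_without:
  fixes t :: "'b::field"
  assumes "is_subring D" "inverse t \<in> D" "t \<notin> D"
  obtains E where "D \<subseteq> E" "is_subring E" "t \<notin> E"
    "\<And>E'. is_subring E' \<Longrightarrow> E \<subseteq> E' \<Longrightarrow> t \<notin> E' \<Longrightarrow> E' = E"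
proof -
  define \<A> where "\<A> = {E. is_subring E \<and> D \<subseteq> E \<and> t \<notin> E}"
  have "\<exists>E\<in>\<A>. \<forall>E'\<in>\<A>. E \<subseteq> E' \<longrightarrow> E' = E"
  proof (rule subset_Zorn_nonempty)
    show "\<A> \<noteq> {}" using assms by (auto simp: \<A>_def)
    fix \<C> :: "'b set set" assume ne: "\<C> \<noteq> {}" and chain: "subset.chain \<A> \<C>"
    have sub: "is_subring E" and DE: "D \<subseteq> E" and tE: "t \<notin> E" if "E \<in> \<C>" for E
      using chain that by (auto simp: subset.chain_def \<A>_def)
    obtain E0 where E0: "E0 \<in> \<C>" using ne by auto
    have "is_subring (\<Union>\<C>)"
      unfolding is_subring_def
    proof (intro conjI ballI)
      show "1 \<in> \<Union>\<C>" using E0 is_subringD(1)[OF sub[OF E0]] by auto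
      fix x y assume "x \<in> \<Union>\<C>" "y \<in> \<Union>\<C>"
      then obtain E1 E2 where E: "E1 \<in> \<C>" "x \<in> E1" "E2 \<in> \<C>" "y \<in> E2" by auto
      then have "E1 \<subseteq> E2 \<or> E2 \<subseteq> E1" using chain by (auto simp: subset_chain_def)
      then obtain E where "E \<in> \<C>" "x \<in> E" "y \<in> E" using E by auto
      moreover from this have "x - y \<in> E" "x * y \<in> E" using is_subringD(3,6)[OF sub] by auto
      ultimately show "x - y \<in> \<Union>\<C>" "x * y \<in> \<Union>\<C>" by auto
    qed
    moreover have "D \<subseteq> \<Union>\<C>" using DE[OF E0] E0 by auto
    moreover have "t \<notin> \<Union>\<C>" using tE by auto
    ultimately show "\<Union>\<C> \<in> \<A>" by (simp add: \<A>_def)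
  qed
  then obtain E where E: "E \<in> \<A>" "\<forall>E'\<in>\<A>. E \<subseteq> E' \<longrightarrow> E' = E" by auto
  show ?thesis
  proof (rule that[of E])
    show "D \<subseteq> E" "is_subring E" "t \<notin> E" using E(1) by (auto simp: \<A>_def)
    fix E' assume "is_subring E'" "E \<subseteq> E'" "t \<notin> E'"
    moreover from this have "E' \<in> \<A>" using E(1) by (auto simp: \<A>_def)
    ultimately show "E' = E" using E(2) by auto
  qed
qed

text \<open>
  A subring \<open>E\<close> that is maximal among those that contain the inverse of \<open>t\<close>, but not \<open>t\<close>, is a
  valuation ring. Elements of the form \<open>1 - m / t\<close> are units of \<open>E\<close>, as otherwise their inverses could
  be adjoined. If neither \<open>x\<close> nor its inverse is in \<open>E\<close>, then \<open>t\<close> is a polynomial in either of them.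
  The polynomial of smaller degree expresses the power of \<open>x\<close> that is the leading term of the other
  one by lower powers, because the unit \<open>1 - m / t\<close> can be cancelled; so degrees can be lowered
  indefinitely.
\<close>
lemma valuation_ring_exists:
  fixes t :: "'b::field"
  assumes "is_subring D" "inverse t \<in> D" "t \<notin> D"
  obtains E where "D \<subseteq> E" "is_subring E" "t \<notin> E" "\<And>x. x \<in> E \<or> inverse x \<in> E"
proof -
  obtain E where DE: "D \<subseteq> E" and E: "is_subring E" and tE: "t \<notin> E"
    and maximal: "\<And>E'. is_subring E' \<Longrightarrow> E \<subseteq> E' \<Longrightarrow> t \<notin> E' \<Longrightarrow> E' = E"
    by (rule maximal_subring_without[OF assms], rule that)
  note E_rules = is_subringD[OF E]
  have it: "inverse t \<in> E" using DE assms(2) by auto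
  have t0: "t \<noteq> 0" using tE E_rules(2) by auto
  have unit: "inverse (1 - m * inverse t) \<in> E" if m: "m \<in> E" for m
  proof -
    define u where "u = 1 - m * inverse t"
    have u0: "u \<noteq> 0"
    proof
      assume "u = 0"
      then have "m = t" using t0 by (simp add: u_def field_simps)
      then show False using m tE by simp
    qed
    have uE: "u \<in> E" using m it E_rules by (auto simp: u_def)
    have upow: "\<exists>m'\<in>E. u ^ k = 1 - m' * inverse t" for k
    proof (induction k)
      case 0
      show ?case using E_rules(2) by (intro bexI[of _ 0]) auto
    next
      case (Suc k)
      then obtain m' where m': "m' \<in> E" "u ^ k = 1 - m' * inverse t" by auto
      have "u ^ Suc k = 1 - (m' + m * u ^ k) * inverse t"
        using m'(2) by (simp add: u_def algebra_simps)
      moreover have "m' + m * u ^ k \<in> E" by (intro E_rules m' m uE)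
      ultimately show ?case by auto
    qed
    \<comment> \<open>the localization of \<open>E\<close> at \<open>u\<close>\<close>
    define E' where "E' = {a * inverse u ^ k | a k. a \<in> E}"
    have E'I: "a * inverse u ^ k \<in> E'" if "a \<in> E" for a k using that by (auto simp: E'_def)
    have "is_subring E'"
      unfolding is_subring_def
    proof (intro conjI ballI)
      show "1 \<in> E'" using E'I[OF E_rules(1), of 0] by simp
      fix x y assume "x \<in> E'" "y \<in> E'"
      then obtain a k b l where x: "x = a * inverse u ^ k" "a \<in> E" and y: "y = b * inverse u ^ l" "b \<in> E"
        by (auto simp: E'_def)
      have "x - y = (a * u ^ l - b * u ^ k) * inverse u ^ (k + l)"
        using u0 by (simp add: x y field_simps power_add)
      then show "x - y \<in> E'" using E'I[of "a * u ^ l - b * u ^ k" "k + l"] x y uE E_rules by auto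
      have "x * y = (a * b) * inverse u ^ (k + l)" by (simp add: x y power_add)
      then show "x * y \<in> E'" using E'I[OF E_rules(6)[OF x(2) y(2)], of "k + l"] by simp
    qed
    moreover have "E \<subseteq> E'"
    proof
      fix a assume "a \<in> E"
      from E'I[OF this, of 0] show "a \<in> E'" by simp
    qed
    moreover have "t \<notin> E'"
    proof
      assume "t \<in> E'"
      then obtain a k where a: "t = a * inverse u ^ k" "a \<in> E" by (auto simp: E'_def)
      obtain m' where m': "m' \<in> E" "u ^ k = 1 - m' * inverse t" using upow by auto
      have "a = t * u ^ k" using a u0 by (simp add: field_simps)
      also have "\<dots> = t - m'" using t0 by (simp add: m'(2) field_simps)
      finally have "t = a + m'" by simp
      then show False using a(2) m'(1) tE E_rules(5) by auto
    qed
    ultimately have "E' = E" by (rule maximal)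
    then show ?thesis using E'I[OF E_rules(1), of 1] by (simp add: u_def)
  qed
  \<comment> \<open>\<open>t\<close> is a polynomial of degree at most \<open>n\<close> in \<open>x\<close>\<close>
  define R where "R = (\<lambda>x n. \<exists>c. (\<forall>i. c i \<in> E) \<and> t = (\<Sum>i\<le>n. c i * x ^ i))"
  have outside: "\<exists>n. R x n" if x: "x \<notin> E" for x
  proof -
    define E' where "E' = {poly p x | p. \<forall>i. coeff p i \<in> E}"
    have "t \<in> E'"
    proof (rule ccontr)
      assume "t \<notin> E'"
      moreover have "is_subring E'" "E \<subseteq> E'" "x \<in> E'"
        unfolding E'_def by (rule is_subring_adjoin[OF E])+
      ultimately show False using maximal[of E'] x by auto
    qed
    then obtain p where "t = poly p x" "\<forall>i. coeff p i \<in> E" by (auto simp: E'_def)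
    then show ?thesis unfolding R_def poly_altdef by (intro exI[of _ "degree p"] exI[of _ "coeff p"]) auto
  qed
  \<comment> \<open>multiply the relation for \<open>inverse x\<close> by \<open>x ^ n\<close> and solve it for \<open>x ^ n\<close>\<close>
  have reduce: "\<exists>n'<n. R x n'" if n: "R x n" and l: "R (inverse x) l" and ln: "l \<le> n" and x: "x \<notin> E" for x n l
  proof -
    have x0: "x \<noteq> 0" using x E_rules(2) by auto
    obtain c where c: "\<And>i. c i \<in> E" "t = (\<Sum>i\<le>n. c i * x ^ i)" using n by (auto simp: R_def)
    obtain d where d: "\<And>i. d i \<in> E" "t = (\<Sum>i\<le>l. d i * inverse x ^ i)" using l by (auto simp: R_def)
    define d' where "d' = (\<lambda>i. if i \<le> l then d i else 0)"
    have d': "d' i \<in> E" for i using d(1) E_rules(2) by (simp add: d'_def)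
    have td': "t = (\<Sum>i\<le>n. d' i * inverse x ^ i)"
      unfolding d(2) using ln by (intro sum.mono_neutral_cong_left) (auto simp: d'_def)
    have n0: "n \<noteq> 0"
    proof
      assume "n = 0"
      then have "t = c 0" using c(2) by simp
      then show False using c(1) tE by metis
    qed
    define w where "w = inverse (1 - d' 0 * inverse t)"
    have w: "w \<in> E" unfolding w_def by (rule unit[OF d'])
    have "t \<noteq> d' 0" using d' tE by metis
    then have tw: "(t - d' 0) * (w * inverse t) = 1" using t0 by (simp add: w_def field_simps)
    define e where "e = (\<lambda>i. d' i * (w * inverse t))"
    have e: "e i \<in> E" for i using d' w it E_rules(6) by (simp add: e_def)
    have split: "{..n} = insert 0 {1..n}" by auto
    have "t - d' 0 = (\<Sum>i=1..n. d' i * inverse x ^ i)"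
      using td' unfolding split by (simp add: sum.insert)
    then have "(\<Sum>i=1..n. d' i * inverse x ^ i) * (w * inverse t) = 1" using tw by simp
    then have "(\<Sum>i=1..n. e i * inverse x ^ i) = 1"
      unfolding sum_distrib_right e_def by (simp add: mult_ac)
    then have "x ^ n = (\<Sum>i=1..n. e i * inverse x ^ i) * x ^ n" by simp
    also have "\<dots> = (\<Sum>i=1..n. e i * x ^ (n - i))"
      unfolding sum_distrib_right using x0
      by (intro sum.cong) (auto simp: power_diff field_simps)
    also have "\<dots> = (\<Sum>i<n. e (n - i) * x ^ i)"
      by (rule sum.reindex_bij_witness[of _ "\<lambda>i. n - i" "\<lambda>i. n - i"]) auto
    finally have xn: "x ^ n = (\<Sum>i<n. e (n - i) * x ^ i)" .
    have "t = (\<Sum>i<n. c i * x ^ i) + c n * x ^ n"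
      using c(2) by (simp add: lessThan_Suc_atMost[symmetric])
    also have "\<dots> = (\<Sum>i<n. (c i + c n * e (n - i)) * x ^ i)"
      unfolding xn by (simp add: sum_distrib_left sum.distrib[symmetric] algebra_simps)
    also have "{..<n} = {..n - 1}" using n0 by auto
    finally have "R x (n - 1)"
      unfolding R_def using c(1) e E_rules(5,6)
      by (intro exI[of _ "\<lambda>i. c i + c n * e (n - i)"]) auto
    then show ?thesis using n0 by (intro exI[of _ "n - 1"]) auto
  qed
  have "x \<in> E \<or> inverse x \<in> E" for x
  proof (rule ccontr)
    assume "\<not> (x \<in> E \<or> inverse x \<in> E)"
    then have x: "x \<notin> E" "inverse x \<notin> E" by auto
    define n where "n = (LEAST n. R x n)"
    define l where "l = (LEAST n. R (inverse x) n)"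
    obtain n0 l0 where "R x n0" "R (inverse x) l0" using outside x by metis
    then have n: "R x n" and l: "R (inverse x) l" unfolding n_def l_def by (auto intro: LeastI)
    show False
    proof (cases "l \<le> n")
      case True
      obtain n' where "n' < n" "R x n'" using reduce[OF n l True x(1)] by auto
      then show False unfolding n_def using not_less_Least by blast
    next
      case False
      then have "n \<le> l" by simp
      then obtain n' where "n' < l" "R (inverse x) n'"
        using reduce[OF l _ _ x(2), of n] n by auto
      then show False unfolding l_def using not_less_Least by blast
    qed
  qed
  with DE E tE show ?thesis by (rule that)
qed

text \<open>
  If \<open>t\<close> were a polynomial in its inverse, then \<open>t\<close> would be integral over the finite ring \<open>D\<close>, and all
  powers of \<open>t\<close> would be among the finitely many polynomials in \<open>t\<close> of bounded degree over \<open>D\<close>.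
\<close>
lemma infinite_order_not_integral:
  fixes t :: "'b::field"
  assumes D: "is_subring D" and fin: "finite D" and inj: "inj (\<lambda>k::nat. t ^ k)"
  shows "t \<notin> {poly p (inverse t) | p. \<forall>i. coeff p i \<in> D}"
proof
  assume "t \<in> {poly p (inverse t) | p. \<forall>i. coeff p i \<in> D}"
  then obtain p where p: "t = poly p (inverse t)" "\<And>i. coeff p i \<in> D" by auto
  have t0: "t \<noteq> 0"
  proof
    assume "t = 0"
    then have "t ^ 1 = t ^ 2" by simp
    then have "(1::nat) = 2" by (rule injD[OF inj])
    then show False by simp
  qed
  define n where "n = degree p"
  have "t ^ Suc n = t * t ^ n" by simp
  also have "\<dots> = (\<Sum>i\<le>n. coeff p i * inverse t ^ i) * t ^ n"
    using p(1) unfolding poly_altdef n_def by (rule arg_cong)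
  also have "\<dots> = (\<Sum>i\<le>n. coeff p i * t ^ (n - i))"
    unfolding sum_distrib_right using t0
    by (intro sum.cong) (auto simp: power_diff field_simps)
  also have "\<dots> = (\<Sum>i\<le>n. coeff p (n - i) * t ^ i)"
    by (rule sum.reindex_bij_witness[of _ "\<lambda>i. n - i" "\<lambda>i. n - i"]) auto
  finally have tn: "t ^ Suc n = (\<Sum>i\<le>n. coeff p (n - i) * t ^ i)" .
  \<comment> \<open>closed under multiplication by \<open>t\<close>, and finite\<close>
  define V where "V = (\<lambda>b. \<Sum>i\<le>n. b i * t ^ i) ` ({..n} \<rightarrow>\<^sub>E D)"
  have VI: "(\<Sum>i\<le>n. b i * t ^ i) \<in> V" if "\<And>i. b i \<in> D" for b
  proof -
    have "(\<Sum>i\<le>n. b i * t ^ i) = (\<Sum>i\<le>n. restrict b {..n} i * t ^ i)" by (intro sum.cong) auto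
    moreover have "restrict b {..n} \<in> {..n} \<rightarrow>\<^sub>E D" using that by auto
    ultimately show ?thesis unfolding V_def by blast
  qed
  have "t ^ k \<in> V" for k
  proof (induction k)
    case 0
    have "(\<Sum>i\<le>n. (if i = 0 then 1 else 0) * t ^ i) = 1" by (simp add: if_distrib[of "\<lambda>z. z * _"] cong: if_cong)
    then show ?case using VI[of "\<lambda>i. if i = 0 then 1 else 0"] is_subringD(1,2)[OF D] by simp
  next
    case (Suc k)
    then obtain b0 where b0: "t ^ k = (\<Sum>i\<le>n. b0 i * t ^ i)" "b0 \<in> {..n} \<rightarrow>\<^sub>E D" by (auto simp: V_def)
    define b where "b = (\<lambda>i. if i \<le> n then b0 i else 0)"
    have b: "b i \<in> D" for i using b0(2) is_subringD(2)[OF D] by (auto simp: b_def)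
    have "t ^ Suc k = t * (\<Sum>i\<le>n. b i * t ^ i)" using b0(1) by (simp add: b_def)
    also have "\<dots> = (\<Sum>i\<le>n. b i * t ^ Suc i)" by (simp add: sum_distrib_left mult_ac)
    also have "\<dots> = (\<Sum>i\<le>n. (case i of 0 \<Rightarrow> 0 | Suc j \<Rightarrow> b j) * t ^ i) + b n * t ^ Suc n"
      using sum.atMost_Suc_shift[of "\<lambda>i. (case i of 0 \<Rightarrow> 0 | Suc j \<Rightarrow> b j) * t ^ i" n]
      by simp
    also have "\<dots> = (\<Sum>i\<le>n. ((case i of 0 \<Rightarrow> 0 | Suc j \<Rightarrow> b j) + b n * coeff p (n - i)) * t ^ i)"
      unfolding tn by (simp add: sum_distrib_left sum.distrib[symmetric] distrib_right mult.assoc)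
    also have "\<dots> \<in> V"
      using b p(2) by (intro VI) (auto intro!: is_subringD[OF D] split: nat.split)
    finally show ?case .
  qed
  then have "range (\<lambda>k::nat. t ^ k) \<subseteq> V" by auto
  moreover have "finite V" unfolding V_def using fin by (intro finite_imageI finite_PiE) auto
  ultimately have "finite (range (\<lambda>k::nat. t ^ k))" by (rule finite_subset)
  then show False using inj finite_imageD[of "\<lambda>k::nat. t ^ k" UNIV] by auto
qed

section \<open>Existence of size relations\<close>
text \<open>
  Otherwise every nonzero element of the domain is a root of unity and thus invertible, so that every
  \<open>x\<close> in the fraction field is a root of a polynomial \<open>X ^ Suc d - X\<close> with \<open>d > 0\<close>.
\<close>
lemma nonalgebraic_infinite_order:
  assumes "\<not> algebraic_over_prime_field TYPE('a::idom fract)"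
  obtains t :: "'a::idom" where "inj (\<lambda>k::nat. t ^ k)"
proof (rule ccontr)
  note witness = that
  assume no: "\<not> thesis"
  have order: "\<exists>d>0. c ^ d = 1" if c: "c \<noteq> 0" for c :: 'a
  proof -
    have "\<not> inj (\<lambda>k::nat. c ^ k)" using no witness by blast
    then obtain i j where ij: "i \<noteq> j" "c ^ i = c ^ j" by (auto simp: inj_def)
    have *: "\<exists>d>0. c ^ d = 1" if "i < j" "c ^ i = c ^ j" for i j :: nat
    proof -
      have "c ^ i * c ^ (j - i) = c ^ j" using that(1) by (simp add: power_add[symmetric])
      then have "c ^ i * c ^ (j - i) = c ^ i * 1" using that(2) by simp
      then have "c ^ (j - i) = 1" using c by (subst (asm) mult_cancel_left) auto
      then show ?thesis using that(1) by (intro exI[of _ "j - i"]) auto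
    qed
    show ?thesis using ij *[of i j] *[of j i] by (metis linorder_neqE_nat)
  qed
  have xd: "\<exists>d>0. x ^ Suc d = x" for x :: "'a fract"
  proof -
    obtain a b where ab: "x = Fract a b" "b \<noteq> 0" by (cases x) auto
    obtain d where d: "0 < d" "b ^ d = 1" using order[OF ab(2)] by auto
    define c where "c = a * b ^ (d - 1)"
    have "b * b ^ (d - 1) = 1" using d by (cases d) auto
    then have x: "x = Fract c 1" unfolding ab(1) c_def using ab(2)
      by (simp add: eq_fract mult_ac)
    show ?thesis
    proof (cases "c = 0")
      case True
      then have "x = 0" using x by (simp add: Zero_fract_def)
      then show ?thesis by (intro exI[of _ 1]) simp
    next
      case False
      then obtain e where e: "0 < e" "c ^ e = 1" using order by auto
      have "x ^ k = Fract (c ^ k) 1" for k by (induction k) (simp_all add: x One_fract_def)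
      then have "x ^ e = 1" using e by (simp add: One_fract_def)
      then show ?thesis using e(1) by (intro exI[of _ e]) simp
    qed
  qed
  interpret K: field "ring_of_type_algebra :: 'a fract ring" by (rule field_from_type_algebra)
  have ops: "\<zero>\<^bsub>ring_of_type_algebra :: 'a fract ring\<^esub> = 0" "\<one>\<^bsub>ring_of_type_algebra :: 'a fract ring\<^esub> = 1"
    "carrier (ring_of_type_algebra :: 'a fract ring) = UNIV"
    "a \<oplus>\<^bsub>ring_of_type_algebra :: 'a fract ring\<^esub> b = a + b" "a \<otimes>\<^bsub>ring_of_type_algebra :: 'a fract ring\<^esub> b = a * b" for a b
    by (simp_all add: ring_of_type_algebra_def)
  have pow: "a [^]\<^bsub>ring_of_type_algebra :: 'a fract ring\<^esub> (k::nat) = a ^ k" for a k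
    by (induction k) (simp_all add: ops mult.commute)
  have minus1: "\<ominus>\<^bsub>ring_of_type_algebra :: 'a fract ring\<^esub> \<one>\<^bsub>ring_of_type_algebra :: 'a fract ring\<^esub> = - 1"
    by (rule K.minus_equality) (simp_all add: ops)
  have "0 \<in> L \<and> 1 \<in> L \<and> - 1 \<in> L" if "subfield L (ring_of_type_algebra :: 'a fract ring)" for L
    using subringE(2,3)[OF subfieldE(1)[OF that]] subringE(5)[OF subfieldE(1)[OF that] subringE(3)[OF subfieldE(1)[OF that]]]
    unfolding minus1 unfolding ops by blast
  then have PF: "(0::'a fract) \<in> prime_field" "(1::'a fract) \<in> prime_field" "(-1::'a fract) \<in> prime_field"
    unfolding prime_field_def by auto
  have "(ring.algebraic ring_of_type_algebra over prime_field) x" for x :: "'a fract"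
  proof -
    obtain d where d: "0 < d" "x ^ Suc d = x" using xd by blast
    \<comment> \<open>the polynomial \<open>X ^ Suc d - X\<close>, leading coefficient first\<close>
    define p :: "'a fract list" where "p = 1 # (replicate (d - 1) 0 @ [-1, 0])"
    have "p \<in> carrier (prime_field [X]\<^bsub>ring_of_type_algebra\<^esub>)"
      using PF by (simp add: univ_poly_def polynomial_def p_def ops set_replicate_conv_if)
    moreover have "K.eval p x = \<zero>\<^bsub>ring_of_type_algebra\<^esub>"
    proof -
      have "K.eval (replicate k 0 @ [-1, 0]) x = - x" for k
        by (induction k) (simp_all add: ops pow)
      then show ?thesis using d by (cases d) (simp_all add: p_def ops pow mult.commute)
    qed
    moreover have "p \<noteq> []" by (simp add: p_def)
    ultimately show ?thesis using K.algebraicI by blast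
  qed
  then show False using assms by (simp add: algebraic_over_prime_field_def)
qed

text \<open>
  The relation says that \<open>x / y\<close> lies in a valuation ring of the fraction field that contains the
  inverse of \<open>t\<close>, but not \<open>t\<close>. The elements \<open>0\<close>, \<open>t\<close> and \<open>t\<^sup>2\<close> are in different classes modulo this ring.
\<close>
lemma size_relation_positive_char:
  fixes t :: "'a::idom"
  assumes char: "CHAR('a) > 0" and t: "inj (\<lambda>k::nat. t ^ k)"
  obtains C and s :: "nat \<Rightarrow> 'a" where "size_relation C s"
proof -
  define D :: "'a fract set" where "D = range of_int"
  have D: "is_subring D"
    unfolding is_subring_def D_def
    by (auto simp del: of_int_diff of_int_mult simp: of_int_diff[symmetric] of_int_mult[symmetric] intro: range_eqI[of _ _ 1])
  have "(of_nat CHAR('a) :: 'a fract) = 0"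
    by (simp add: of_nat_fract Zero_fract_def)
  then have p0: "(of_int (int CHAR('a)) :: 'a fract) = 0" by simp
  have "D \<subseteq> of_int ` {0..<int CHAR('a)}"
  proof
    fix x assume "x \<in> D"
    then obtain k where k: "x = of_int k" by (auto simp: D_def)
    have "k = k mod int CHAR('a) + int CHAR('a) * (k div int CHAR('a))" by simp
    then have "x = of_int (k mod int CHAR('a))"
      unfolding k using p0 by (metis add.right_neutral mult_zero_left of_int_add of_int_mult)
    then show "x \<in> of_int ` {0..<int CHAR('a)}" using char by auto
  qed
  then have fin: "finite D" by (rule finite_subset) simp
  define \<iota> :: "'a \<Rightarrow> 'a fract" where "\<iota> = (\<lambda>a. Fract a 1)"
  have \<iota>_power: "\<iota> t ^ k = \<iota> (t ^ k)" for k
    by (induction k) (simp_all add: \<iota>_def One_fract_def)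
  have "inj (\<lambda>k::nat. \<iota> t ^ k)"
    using t by (simp add: inj_def \<iota>_power) (simp add: \<iota>_def eq_fract)
  note notin = infinite_order_not_integral[OF D fin this]
  note adj = is_subring_adjoin[OF D, of "inverse (\<iota> t)"]
  obtain E where E: "is_subring E" "\<iota> t \<notin> E" "\<And>x. x \<in> E \<or> inverse x \<in> E"
      and DE: "{poly p (inverse (\<iota> t)) | p. \<forall>i. coeff p i \<in> D} \<subseteq> E"
    by (rule valuation_ring_exists[OF adj(1) adj(3) notin], rule that)
  have it: "inverse (\<iota> t) \<in> E" using DE adj(3) by blast
  have t0: "\<iota> t \<noteq> 0" using E(2) is_subringD(2)[OF E(1)] by auto
  define C where "C = (\<lambda>x y. y \<noteq> 0 \<and> \<iota> x / \<iota> y \<in> E)"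
  have \<iota>0: "\<iota> y \<noteq> 0" if "y \<noteq> 0" for y
    using that by (simp add: \<iota>_def Zero_fract_def eq_fract)
  have \<iota>_add: "\<iota> (x + s * y) / \<iota> y = \<iota> x / \<iota> y + \<iota> s" if "y \<noteq> 0" for x s y
  proof -
    have "\<iota> (x + s * y) = \<iota> x + \<iota> s * \<iota> y" by (simp add: \<iota>_def)
    then show ?thesis using \<iota>0[OF that] by (simp add: add_divide_distrib)
  qed
  define s where "s = (\<lambda>i::nat. if i = 0 then 0 else t ^ i)"
  have "C x y \<or> C y x" if "x \<noteq> 0 \<or> y \<noteq> 0" for x y
  proof (cases "x = 0 \<or> y = 0")
    case True
    have "\<iota> 0 = 0" by (simp add: \<iota>_def Zero_fract_def)
    then show ?thesis using True that is_subringD(2)[OF E(1)] by (auto simp: C_def)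
  next
    case False
    then show ?thesis using E(3)[of "\<iota> x / \<iota> y"] by (auto simp: C_def)
  qed
  moreover have "\<not> (C (x + s i * y) y \<and> C (x + s j * y) y)" if ij: "i < j" "j < 3" for i j x y
  proof
    assume *: "C (x + s i * y) y \<and> C (x + s j * y) y"
    then have y: "y \<noteq> 0" by (simp add: C_def)
    have in_E: "\<iota> x / \<iota> y + \<iota> (s i) \<in> E" "\<iota> x / \<iota> y + \<iota> (s j) \<in> E"
      using * \<iota>_add[OF y] by (auto simp: C_def)
    from is_subringD(3)[OF E(1) in_E(2,1)] have diff: "\<iota> (s j) - \<iota> (s i) \<in> E" by simp
    have s: "\<iota> (s 0) = 0" "\<iota> (s 1) = \<iota> t" "\<iota> (s 2) = \<iota> t * \<iota> t"
      by (simp_all add: s_def \<iota>_def Zero_fract_def power2_eq_square)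
    consider "i = 0" "j = 1" | "i = 0" "j = 2" | "i = 1" "j = 2" using ij by linarith
    then have "\<iota> t \<in> E"
    proof cases
      case 1
      then show ?thesis using diff s by simp
    next
      case 2
      then have "\<iota> t * \<iota> t \<in> E" using diff s by simp
      from is_subringD(6)[OF E(1) this it] show ?thesis using t0 by (simp add: mult.assoc)
    next
      case 3
      then have "\<iota> t * \<iota> t - \<iota> t \<in> E" using diff s by simp
      from is_subringD(6)[OF E(1) this it] have "\<iota> t - 1 \<in> E" using t0 by (simp add: left_diff_distrib mult.assoc)
      from is_subringD(5)[OF E(1) this is_subringD(1)[OF E(1)]] show ?thesis by simp
    qed
    then show False using E(2) by simp
  qed
  ultimately have "size_relation C s" unfolding size_relation_def by (auto simp: C_def)
  then show ?thesis by (rule that)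
qed

lemma size_relation_exists:
  assumes "CHAR('a::idom) > 0 \<Longrightarrow> \<not> algebraic_over_prime_field TYPE('a fract)"
  obtains C and s :: "nat \<Rightarrow> 'a::idom" where "size_relation C s" "infinite (UNIV :: 'a set)"
proof (cases "CHAR('a) = 0")
  case True
  then have char0: "of_nat n \<noteq> (0::'a)" if "0 < n" for n using that by (simp add: of_nat_eq_0_iff_char_dvd)
  have "inj (of_nat :: nat \<Rightarrow> 'a)"
  proof (rule injI)
    have *: "i = j" if "of_nat i = (of_nat j :: 'a)" "i \<le> j" for i j
    proof (rule ccontr)
      assume "i \<noteq> j"
      with that have "of_nat (j - i) \<noteq> (0::'a)" by (intro char0) auto
      then show False using that by (simp add: of_nat_diff)
    qed
    show "i = j" if "of_nat i = (of_nat j :: 'a)" for i j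
      using *[of i j] *[of j i] that by (cases "i \<le> j") auto
  qed
  then have "infinite (UNIV :: 'a set)" using infinite_UNIV_nat finite_imageD finite_subset subset_UNIV by metis
  then show ?thesis using size_relation_char_0[OF char0] that by blast
next
  case False
  then obtain t :: 'a where t: "inj (\<lambda>k::nat. t ^ k)" using nonalgebraic_infinite_order[OF assms] by auto
  then have "infinite (UNIV :: 'a set)" using infinite_UNIV_nat finite_imageD finite_subset subset_UNIV by metis
  then show ?thesis using size_relation_positive_char[OF _ t] False that by blast
qed

section \<open>Spectral gap from a paradoxical decomposition\<close>

text \<open>
  For the indicator function of a set, this is the mass that \<open>f\<close> has on the set.
\<close>
definition weight :: "('i \<Rightarrow> real) \<Rightarrow> ('i \<Rightarrow> complex) \<Rightarrow> real" where
  "weight \<phi> f = (\<Sum>\<^sub>\<infinity>i. \<phi> i * (cmod (f i))\<^sup>2)"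

lemma weight_summable:
  assumes "f \<in> l2" "\<And>i. 0 \<le> \<phi> i" "\<And>i. \<phi> i \<le> (B :: real)"
  shows "(\<lambda>i. \<phi> i * (cmod (f i))\<^sup>2) summable_on UNIV"
proof (rule summable_on_comparison_test)
  show "(\<lambda>i. B * (cmod (f i))\<^sup>2) summable_on UNIV"
    using assms(1) by (intro summable_on_cmult_right) (simp add: l2_def)
qed (use assms(2,3) in \<open>auto intro!: mult_right_mono\<close>)

lemma infsum_finite_sum:
  fixes h :: "'p \<Rightarrow> 'i \<Rightarrow> real"
  assumes "finite P" "\<And>p. p \<in> P \<Longrightarrow> h p summable_on UNIV"
  shows "(\<lambda>i. \<Sum>p\<in>P. h p i) summable_on UNIV"
    and "(\<Sum>\<^sub>\<infinity>i. \<Sum>p\<in>P. h p i) = (\<Sum>p\<in>P. \<Sum>\<^sub>\<infinity>i. h p i)"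
proof -
  have "((\<lambda>i. \<Sum>p\<in>P. h p i) has_sum (\<Sum>p\<in>P. \<Sum>\<^sub>\<infinity>i. h p i)) UNIV"
    using assms
  proof (induction P rule: finite_induct)
    case (insert p P)
    have "((\<lambda>i. h p i + (\<Sum>p\<in>P. h p i)) has_sum (\<Sum>\<^sub>\<infinity>i. h p i) + (\<Sum>p\<in>P. \<Sum>\<^sub>\<infinity>i. h p i)) UNIV"
      using insert by (intro has_sum_add has_sum_infsum) auto
    then show ?case using insert.hyps by simp
  qed simp
  then show "(\<lambda>i. \<Sum>p\<in>P. h p i) summable_on UNIV"
    "(\<Sum>\<^sub>\<infinity>i. \<Sum>p\<in>P. h p i) = (\<Sum>p\<in>P. \<Sum>\<^sub>\<infinity>i. h p i)"
    by (auto simp: infsumI has_sum_imp_summable)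
qed

lemma weight_perturb:
  assumes f: "f \<in> l2" and g: "g \<in> l2" and \<phi>: "\<And>i. 0 \<le> \<phi> i" "\<And>i. \<phi> i \<le> 1"
  shows "weight \<phi> f \<le> weight \<phi> g + l2_norm (\<lambda>i. f i - g i) * (l2_norm f + l2_norm g)"
proof -
  let ?d = "\<lambda>i. f i - g i"
  have d: "?d \<in> l2" by (rule l2_diff(1)[OF f g])
  have s: "(\<lambda>i. cmod (?d i) * cmod (f i)) summable_on UNIV" "(\<lambda>i. cmod (?d i) * cmod (g i)) summable_on UNIV"
    using l2_product_abs_summable(1)[OF d] f g by auto
  have sw: "(\<lambda>i. \<phi> i * (cmod (f i))\<^sup>2) summable_on UNIV" "(\<lambda>i. \<phi> i * (cmod (g i))\<^sup>2) summable_on UNIV"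
    using weight_summable[OF f \<phi>] weight_summable[OF g \<phi>] by auto
  have "weight \<phi> f \<le> (\<Sum>\<^sub>\<infinity>i. \<phi> i * (cmod (g i))\<^sup>2 + (cmod (?d i) * cmod (f i) + cmod (?d i) * cmod (g i)))"
    unfolding weight_def
  proof (rule infsum_mono)
    show "(\<lambda>i. \<phi> i * (cmod (f i))\<^sup>2) summable_on UNIV"
      "(\<lambda>i. \<phi> i * (cmod (g i))\<^sup>2 + (cmod (?d i) * cmod (f i) + cmod (?d i) * cmod (g i))) summable_on UNIV"
      by (intro sw summable_on_add s)+
    fix i
    have "(cmod (f i))\<^sup>2 - (cmod (g i))\<^sup>2 = (cmod (f i) - cmod (g i)) * (cmod (f i) + cmod (g i))"
      by (simp add: power2_eq_square algebra_simps)
    also have "\<dots> \<le> cmod (?d i) * (cmod (f i) + cmod (g i))"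
      by (intro mult_right_mono norm_triangle_ineq2) auto
    finally have le: "(cmod (f i))\<^sup>2 - (cmod (g i))\<^sup>2 \<le> cmod (?d i) * (cmod (f i) + cmod (g i))" .
    have "\<phi> i * ((cmod (f i))\<^sup>2 - (cmod (g i))\<^sup>2) \<le> \<phi> i * (cmod (?d i) * (cmod (f i) + cmod (g i)))"
      by (rule mult_left_mono[OF le \<phi>(1)])
    also have "\<dots> \<le> 1 * (cmod (?d i) * (cmod (f i) + cmod (g i)))"
      by (intro mult_right_mono \<phi>(2)) auto
    finally show "\<phi> i * (cmod (f i))\<^sup>2
        \<le> \<phi> i * (cmod (g i))\<^sup>2 + (cmod (?d i) * cmod (f i) + cmod (?d i) * cmod (g i))"
      by (simp add: algebra_simps)
  qed
  also have "\<dots> = weight \<phi> g + ((\<Sum>\<^sub>\<infinity>i. cmod (?d i) * cmod (f i)) + (\<Sum>\<^sub>\<infinity>i. cmod (?d i) * cmod (g i)))"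
    unfolding weight_def by (simp only: infsum_add[OF sw(2) summable_on_add[OF s]] infsum_add[OF s])
  also have "\<dots> \<le> weight \<phi> g + (l2_norm ?d * l2_norm f + l2_norm ?d * l2_norm g)"
    by (intro add_left_mono add_mono l2_product_abs_summable(2) d f g)
  finally show ?thesis by (simp add: distrib_left)
qed

context transitive_action begin

lemma weight_translate:
  assumes "g \<in> carrier G"
  shows "weight \<phi> (translate g f) = weight (\<lambda>i. \<phi> (act g i)) f"
  unfolding weight_def translate_def
  using infsum_reindex_bij_betw[OF bij_act[OF assms], of "\<lambda>i. \<phi> i * (cmod (f (act (inv g) i)))\<^sup>2"] assms
  by simp

text \<open>
  Replacing \<open>f\<close> by its translate under \<open>e k\<close> changes the weight by little if \<open>f\<close> is almost invariant,
  and has the same effect as translating \<open>\<phi>\<close> instead. The three translates of \<open>\<phi>\<close> fit into \<open>Y\<close>.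
\<close>
lemma weight_packing_bound:
  assumes f: "f \<in> l2" and e: "\<And>k. k < 3 \<Longrightarrow> e k \<in> carrier G"
    and \<phi>: "\<And>i. 0 \<le> \<phi> i" "\<And>i. \<phi> i \<le> 1"
    and packing: "\<And>i. (\<Sum>k<3::nat. \<phi> (act (e k) i)) \<le> of_bool (i \<in> Y)"
  shows "3 * weight \<phi> f \<le> weight (\<lambda>i. of_bool (i \<in> Y)) f
    + 2 * l2_norm f * (\<Sum>k<3. l2_norm (\<lambda>i. translate (e k) f i - f i))"
proof -
  define d where "d = (\<lambda>k. l2_norm (\<lambda>i. translate (e k) f i - f i))"
  have "weight \<phi> f \<le> weight (\<lambda>i. \<phi> (act (e k) i)) f + 2 * l2_norm f * d k" if k: "k < 3" for k
    using weight_perturb[OF f translate_l2[OF e[OF k] f] \<phi>]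
    by (simp add: weight_translate[OF e[OF k]] l2_norm_translate[OF e[OF k]] d_def
        l2_norm_minus_commute[of f] mult_ac)
  then have "(\<Sum>k<3::nat. weight \<phi> f) \<le> (\<Sum>k<3. weight (\<lambda>i. \<phi> (act (e k) i)) f + 2 * l2_norm f * d k)"
    by (intro sum_mono) auto
  also have "\<dots> = (\<Sum>k<3. weight (\<lambda>i. \<phi> (act (e k) i)) f) + 2 * l2_norm f * (\<Sum>k<3. d k)"
    by (simp only: sum.distrib sum_distrib_left)
  also have "(\<Sum>k<3. weight (\<lambda>i. \<phi> (act (e k) i)) f) = (\<Sum>\<^sub>\<infinity>i. \<Sum>k<3. \<phi> (act (e k) i) * (cmod (f i))\<^sup>2)"
    unfolding weight_def by (intro infsum_finite_sum(2)[symmetric] weight_summable[OF f \<phi>]) simp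
  also have "\<dots> \<le> weight (\<lambda>i. of_bool (i \<in> Y)) f"
    unfolding weight_def
  proof (rule infsum_mono)
    show "(\<lambda>i. \<Sum>k<3. \<phi> (act (e k) i) * (cmod (f i))\<^sup>2) summable_on UNIV"
      by (intro infsum_finite_sum(1) weight_summable[OF f \<phi>]) simp
    show "(\<lambda>i. of_bool (i \<in> Y) * (cmod (f i))\<^sup>2) summable_on UNIV"
      by (rule weight_summable[OF f, where B = 1]) auto
    show "(\<Sum>k<3. \<phi> (act (e k) i) * (cmod (f i))\<^sup>2) \<le> of_bool (i \<in> Y) * (cmod (f i))\<^sup>2" for i
      unfolding sum_distrib_right[symmetric] by (intro mult_right_mono packing) auto
  qed
  finally show ?thesis by (simp add: d_def)
qed

text \<open>
  The functions \<open>\<phi> p\<close> and \<open>\<phi> (swap p)\<close> together cover \<open>Y p\<close>, while three translates of either of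
  them fit into \<open>Y p\<close>. Up to the displacement of \<open>f\<close>, three times the mass of \<open>f\<close> on \<open>Y p\<close> is thus
  at most twice this mass, so the displacement bounds the mass. As the sets \<open>Y p\<close> exhaust the
  complement of \<open>z\<close>, it bounds the norm of \<open>f\<close>.
\<close>
lemma gap_from_paradox:
  fixes \<phi> :: "'p \<Rightarrow> 'i \<Rightarrow> real"
  assumes P: "finite P" and swap: "\<And>p. p \<in> P \<Longrightarrow> swap p \<in> P"
    and e: "\<And>p k. p \<in> P \<Longrightarrow> k < 3 \<Longrightarrow> e p k \<in> carrier G"
    and \<phi>: "\<And>p i. 0 \<le> \<phi> p i" "\<And>p i. \<phi> p i \<le> 1"
    and packing: "\<And>p i. p \<in> P \<Longrightarrow> (\<Sum>k<3::nat. \<phi> p (act (e p k) i)) \<le> of_bool (i \<in> Y p)"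
    and covering: "\<And>p i. p \<in> P \<Longrightarrow> i \<in> Y p \<Longrightarrow> 1 \<le> \<phi> p i + \<phi> (swap p) i"
    and Y_swap: "\<And>p. p \<in> P \<Longrightarrow> Y (swap p) = Y p"
    and exhaust: "\<And>i. i \<noteq> z \<Longrightarrow> \<exists>p\<in>P. i \<in> Y p"
    and f: "f \<in> l2" "f z = 0"
  shows "l2_norm f \<le> 4 * real (card P) *
    (\<Sum>(p, k)\<in>P \<times> {..<3}. l2_norm (\<lambda>i. translate (e p k) f i - f i))"
proof -
  define D where "D = (\<lambda>p. \<Sum>k<3. l2_norm (\<lambda>i. translate (e p k) f i - f i))"
  define N T where "N = l2_norm f" and "T = (\<Sum>p\<in>P. D p)"
  define w where "w = (\<lambda>p. weight (\<lambda>i. of_bool (i \<in> Y p)) f)"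
  have D0: "0 \<le> D p" for p by (simp add: D_def sum_nonneg)
  have DT: "D p \<le> T" if "p \<in> P" for p
    unfolding T_def using P that D0 by (intro member_le_sum) auto
  have N0: "0 \<le> N" by (simp add: N_def)
  have wp: "w p \<le> 4 * N * T" if p: "p \<in> P" for p
  proof -
    have "w p \<le> weight (\<phi> p) f + weight (\<phi> (swap p)) f"
    proof -
      have "w p \<le> (\<Sum>\<^sub>\<infinity>i. \<phi> p i * (cmod (f i))\<^sup>2 + \<phi> (swap p) i * (cmod (f i))\<^sup>2)"
        unfolding w_def weight_def
      proof (rule infsum_mono)
        show "(\<lambda>i. of_bool (i \<in> Y p) * (cmod (f i))\<^sup>2) summable_on UNIV"
          by (rule weight_summable[OF f(1), where B = 1]) auto
        show "(\<lambda>i. \<phi> p i * (cmod (f i))\<^sup>2 + \<phi> (swap p) i * (cmod (f i))\<^sup>2) summable_on UNIV"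
          by (intro summable_on_add weight_summable[OF f(1) \<phi>])
        fix i
        have "of_bool (i \<in> Y p) \<le> \<phi> p i + \<phi> (swap p) i"
          using covering[OF p, of i] \<phi>(1)[of p i] \<phi>(1)[of "swap p" i] by (cases "i \<in> Y p") auto
        then show "of_bool (i \<in> Y p) * (cmod (f i))\<^sup>2 \<le> \<phi> p i * (cmod (f i))\<^sup>2 + \<phi> (swap p) i * (cmod (f i))\<^sup>2"
          unfolding distrib_right[symmetric] by (intro mult_right_mono) auto
      qed
      also have "\<dots> = weight (\<phi> p) f + weight (\<phi> (swap p)) f"
        unfolding weight_def by (intro infsum_add weight_summable[OF f(1) \<phi>])
      finally show ?thesis .
    qed
    moreover have "3 * weight (\<phi> p) f \<le> w p + 2 * N * D p"
      using weight_packing_bound[OF f(1) e[OF p] \<phi> packing[OF p]] by (simp add: w_def N_def D_def)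
    moreover have "3 * weight (\<phi> (swap p)) f \<le> w p + 2 * N * D (swap p)"
      using weight_packing_bound[OF f(1) e[OF swap[OF p]] \<phi> packing[OF swap[OF p]]]
      by (simp add: w_def N_def D_def Y_swap[OF p])
    moreover have "N * D p \<le> N * T" "N * D (swap p) \<le> N * T"
      using DT p swap N0 by (auto intro!: mult_left_mono)
    ultimately show ?thesis by linarith
  qed
  have "N\<^sup>2 \<le> (\<Sum>\<^sub>\<infinity>i. \<Sum>p\<in>P. of_bool (i \<in> Y p) * (cmod (f i))\<^sup>2)"
    unfolding N_def l2_norm_power2
  proof (rule infsum_mono)
    show "(\<lambda>i. (cmod (f i))\<^sup>2) summable_on UNIV" using f(1) by (simp add: l2_def)
    show "(\<lambda>i. \<Sum>p\<in>P. of_bool (i \<in> Y p) * (cmod (f i))\<^sup>2) summable_on UNIV"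
      using P by (intro infsum_finite_sum(1) weight_summable[OF f(1), where B = 1]) auto
    show "(cmod (f i))\<^sup>2 \<le> (\<Sum>p\<in>P. of_bool (i \<in> Y p) * (cmod (f i))\<^sup>2)" for i
    proof (cases "i = z")
      case True
      then show ?thesis using f(2) by simp
    next
      case False
      then obtain p where p: "p \<in> P" "i \<in> Y p" using exhaust by blast
      then have "(cmod (f i))\<^sup>2 = of_bool (i \<in> Y p) * (cmod (f i))\<^sup>2" by simp
      also have "\<dots> \<le> (\<Sum>p\<in>P. of_bool (i \<in> Y p) * (cmod (f i))\<^sup>2)"
        using p(1) P by (intro member_le_sum) auto
      finally show ?thesis .
    qed
  qed
  also have "\<dots> = (\<Sum>p\<in>P. w p)"
    unfolding w_def weight_def using P by (intro infsum_finite_sum(2) weight_summable[OF f(1), where B = 1]) auto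
  also have "\<dots> \<le> (\<Sum>p\<in>P. 4 * N * T)" by (intro sum_mono wp)
  finally have "N * N \<le> N * (4 * real (card P) * T)" by (simp add: power2_eq_square mult_ac)
  then have "N \<le> 4 * real (card P) * T"
    using N0 sum_nonneg[of P D] D0 by (cases "N = 0") (auto simp: T_def)
  then show ?thesis
    using P by (simp add: N_def T_def D_def sum.cartesian_product)
qed

end

section \<open>Linear groups acting on lines\<close>

text \<open>The sign \<open>$\<close> is reserved for entries of \<^typ>\<open>'a vec\<close> from the theory of matrices.\<close>

no_notation vec_nth (infixl \<open>$\<close> 90)
no_notation fps_nth (infixl \<open>$\<close> 75)

text \<open>
  The properties that the general and the special linear group share.
\<close>
locale linear_group = group G for G :: "'a::{idom,countable} mat monoid" (structure) +
  fixes n :: nat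
  assumes n_ge_3: "3 \<le> n"
    and carrier_mat: "carrier G \<subseteq> carrier_mat n n"
    and mult_eq: "A \<otimes> B = A * B"
    and one_eq: "\<one> = 1\<^sub>m n"
    and det_one: "A \<in> carrier_mat n n \<Longrightarrow> det A = 1 \<Longrightarrow> A \<in> carrier G"
begin

lemma in_carrier_mat: "A \<in> carrier G \<Longrightarrow> A \<in> carrier_mat n n"
  using carrier_mat by auto

lemma addrow_mat_carrier: "i \<noteq> j \<Longrightarrow> addrow_mat n a i j \<in> carrier G"
  by (intro det_one det_addrow_mat) auto

text \<open>
  Multiples by units suffice, since only columns of invertible matrices matter: if two of them are
  proportional over the fraction field, then they are so by a unit.
\<close>
definition line :: "'a vec \<Rightarrow> 'a vec set" where
  "line v = {u \<cdot>\<^sub>v v | u. u dvd 1}"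

definition lines :: "'a vec set set" where
  "lines = (\<lambda>A. line (col A 0)) ` carrier G"

lemma line_self: "v \<in> line v"
  unfolding line_def by (auto intro!: exI[of _ 1])

lemma line_unit:
  assumes "w dvd 1"
  shows "line (w \<cdot>\<^sub>v v) = line v"
proof -
  obtain w' where w': "w * w' = 1" using assms by (auto elim: dvdE)
  then have w'1: "w' dvd 1" by (metis dvd_triv_right)
  show ?thesis
  proof (intro equalityI subsetI)
    fix z assume "z \<in> line (w \<cdot>\<^sub>v v)"
    then obtain u where "z = (u * w) \<cdot>\<^sub>v v" "u dvd 1" by (auto simp: line_def smult_smult_assoc)
    moreover from this have "u * w dvd 1" using assms mult_dvd_mono[of u 1 w 1] by simp
    ultimately show "z \<in> line v" by (auto simp: line_def)
  next
    fix z assume "z \<in> line v"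
    then obtain u where u: "z = u \<cdot>\<^sub>v v" "u dvd 1" by (auto simp: line_def)
    have "(u * w') * w = u * (w * w')" by (simp only: mult_ac)
    then have "(u * w') * w = u" using w' by simp
    then have "z = (u * w') \<cdot>\<^sub>v (w \<cdot>\<^sub>v v)" using u(1) by (simp only: smult_smult_assoc)
    moreover have "u * w' dvd 1" using u(2) w'1 mult_dvd_mono[of u 1 w' 1] by simp
    ultimately show "z \<in> line (w \<cdot>\<^sub>v v)" by (auto simp: line_def)
  qed
qed

lemma line_image:
  assumes "A \<in> carrier_mat n n" "v \<in> carrier_vec n"
  shows "(\<lambda>x. A *\<^sub>v x) ` line v = line (A *\<^sub>v v)"
proof -
  have "line z = (\<lambda>u. u \<cdot>\<^sub>v z) ` {u. u dvd 1}" for z by (auto simp: line_def)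
  moreover have "(\<lambda>u. A *\<^sub>v (u \<cdot>\<^sub>v v)) ` {u. u dvd 1} = (\<lambda>u. u \<cdot>\<^sub>v (A *\<^sub>v v)) ` {u. u dvd 1}"
    using assms
    by (intro image_cong refl eq_vecI) (auto simp: scalar_prod_def sum_distrib_left mult.left_commute)
  ultimately show ?thesis by (simp add: image_image)
qed

lemma col_carrier: "A \<in> carrier G \<Longrightarrow> col A 0 \<in> carrier_vec n"
  using in_carrier_mat[of A] by (intro carrier_vecI) auto

lemma line_image_col:
  assumes "A \<in> carrier G" "B \<in> carrier G"
  shows "(\<lambda>x. A *\<^sub>v x) ` line (col B 0) = line (col (A * B) 0)"
  using assms n_ge_3 by (simp add: line_image in_carrier_mat col_carrier col_mult2[of A n n B n])

lemma line_image_lines: "A \<in> carrier G \<Longrightarrow> L \<in> lines \<Longrightarrow> (\<lambda>x. A *\<^sub>v x) ` L \<in> lines"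
  by (auto simp: lines_def line_image_col mult_eq[symmetric])

lemma countable_lines: "countable lines"
proof (rule countable_subset)
  show "lines \<subseteq> range (\<lambda>l. line (vec_of_list l))"
    unfolding lines_def by (metis (no_types, lifting) image_subset_iff rangeI vec_list)
qed simp

definition base :: "'a vec set" where
  "base = line (col (1\<^sub>m n) 0)"

lemma base_lines: "base \<in> lines"
  unfolding base_def lines_def using one_closed by (auto simp: one_eq)

text \<open>
  The vectors with first entries \<open>1\<close> and \<open>r\<close> span different lines for different \<open>r\<close>.
\<close>
lemma infinite_lines:
  assumes "infinite (UNIV :: 'a set)"
  shows "infinite lines"
proof
  assume fin: "finite lines"
  define F where "F = (\<lambda>r. line (col (addrow_mat n r 1 0) 0))"
  have "inj F"
  proof (rule injI)
    fix r r' assume "F r = F r'"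
    then have "col (addrow_mat n r 1 0) 0 \<in> line (col (addrow_mat n r' 1 0) 0)"
      using line_self unfolding F_def by metis
    then obtain u where u: "col (addrow_mat n r 1 0) 0 = u \<cdot>\<^sub>v col (addrow_mat n r' 1 0) 0"
      by (auto simp: line_def)
    have "col (addrow_mat n r 1 0) 0 $ k = (u \<cdot>\<^sub>v col (addrow_mat n r' 1 0) 0) $ k" for k
      using u by simp
    from this[of 0] this[of 1] show "r = r'" using n_ge_3 by simp
  qed
  moreover have "range F \<subseteq> lines" by (auto simp: F_def lines_def addrow_mat_carrier)
  ultimately show False using fin assms by (metis finite_imageD finite_subset)
qed

text \<open>
  Lines are numbered by natural numbers, as the Hilbert space consists of functions on \<^typ>\<open>nat\<close>.
\<close>
definition act :: "'a mat \<Rightarrow> nat \<Rightarrow> nat" where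
  "act A i = to_nat_on lines ((\<lambda>x. A *\<^sub>v x) ` from_nat_into lines i)"

context
  assumes inf: "infinite (UNIV :: 'a set)"
begin

abbreviation "point \<equiv> from_nat_into lines"

lemma point_lines: "point i \<in> lines"
  using infinite_lines[OF inf] by (intro from_nat_into) auto

lemma point_act: "A \<in> carrier G \<Longrightarrow> point (act A i) = (\<lambda>x. A *\<^sub>v x) ` point i"
  unfolding act_def using countable_lines line_image_lines[OF _ point_lines] by simp

lemma point_inj: "point i = point j \<Longrightarrow> i = j"
  using from_nat_into_inj_infinite[OF countable_lines infinite_lines[OF inf]] by simp

lemma point_cases: obtains A where "A \<in> carrier G" "point i = line (col A 0)"
  using point_lines[of i] by (auto simp: lines_def)

lemma transitive_action_lines: "transitive_action G act"
proof
  show "act \<one> i = i" for i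
  proof (rule point_inj)
    obtain A where "A \<in> carrier G" "point i = line (col A 0)" by (rule point_cases)
    then show "point (act \<one> i) = point i"
      by (simp add: point_act line_image_col) (simp add: mult_eq[symmetric])
  qed
  show "act (A \<otimes> B) i = act A (act B i)" if AB: "A \<in> carrier G" "B \<in> carrier G" for A B i
  proof (rule point_inj)
    obtain C where "C \<in> carrier G" "point i = line (col C 0)" by (rule point_cases)
    then show "point (act (A \<otimes> B) i) = point (act A (act B i))"
      using AB by (simp add: point_act line_image_col mult_eq[symmetric] m_assoc)
  qed
  show "\<exists>g\<in>carrier G. act g i = j" for i j
  proof -
    obtain A where A: "A \<in> carrier G" "point i = line (col A 0)" by (rule point_cases)
    obtain B where B: "B \<in> carrier G" "point j = line (col B 0)" by (rule point_cases)
    have "point (act (B \<otimes> inv A) i) = point j"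
      using A B by (simp add: point_act line_image_col mult_eq[symmetric] m_assoc)
    then show ?thesis using A B point_inj by (intro bexI[of _ "B \<otimes> inv A"]) auto
  qed
qed

text \<open>
  The function \<open>\<Phi> (i, j)\<close> sends the line through \<open>v\<close> to the mean of the set of units \<open>u\<close> for which
  \<open>u * v $ i\<close> is not larger than \<open>u * v $ j\<close>. By invariance of the mean, it does not depend on the
  choice of \<open>v\<close>.
\<close>
lemma traceable_representation:
  fixes s :: "nat \<Rightarrow> 'a"
  assumes size: "size_relation C s"
  shows "\<exists>(H :: (nat \<Rightarrow> complex) hilbert) \<pi>.
    unitary_rep G H \<pi> \<and> irreducible_rep G H \<pi> \<and> infinite_dimensional H \<and> traceable G H \<pi>"
proof -
  interpret transitive_action G act by (rule transitive_action_lines)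
  have C_nz: "\<And>x y. C x y \<Longrightarrow> y \<noteq> 0" and C_total: "\<And>x y. x \<noteq> 0 \<or> y \<noteq> 0 \<Longrightarrow> C x y \<or> C y x"
    and C_disj: "\<And>i j x y. i < j \<Longrightarrow> j < 3 \<Longrightarrow> \<not> (C (x + s i * y) y \<and> C (x + s j * y) y)"
    using size unfolding size_relation_def by blast+
  obtain M where M: "mean {u::'a. u dvd 1} M"
    and M_inv: "\<And>w A. w \<in> {u. u dvd 1} \<Longrightarrow> M {u. w * u \<in> A} = M A"
  proof (rule invariant_mean_exists[of "{u::'a. u dvd 1}" "{u::'a. u dvd 1}"])
    show "w * u \<in> {u. u dvd 1}" if "w \<in> {u. u dvd 1}" "u \<in> {u. u dvd 1}" for w u :: 'a
      using that mult_dvd_mono[of w 1 u 1] by simp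
  qed (use that in auto)
  define \<Phi> where "\<Phi> = (\<lambda>(i, j) L. let v = (SOME v. v \<in> L) in M {u. C (u * v $ i) (u * v $ j)})"
  define Y where "Y = (\<lambda>(i, j). {L. \<exists>v\<in>L. v $ i \<noteq> 0 \<or> v $ j \<noteq> (0::'a)})"
  define P where "P = {(i, j). 1 \<le> i \<and> i < n \<and> 1 \<le> j \<and> j < n \<and> i \<noteq> j}"
  define e where "e = (\<lambda>(i, j) k. addrow_mat n (s k) i j)"
  have \<Phi>_line: "\<Phi> (i, j) (line v) = M {u. C (u * v $ i) (u * v $ j)}"
    if v: "v \<in> carrier_vec n" and ij: "i < n" "j < n" for i j v
  proof -
    have "(SOME z. z \<in> line v) \<in> line v" using line_self by (rule someI)
    then obtain w where w: "(SOME z. z \<in> line v) = w \<cdot>\<^sub>v v" "w dvd 1" by (auto simp: line_def)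
    have "\<Phi> (i, j) (line v) = M {u. w * u \<in> {u. C (u * v $ i) (u * v $ j)}}"
      using v ij by (simp add: \<Phi>_def Let_def w(1) mult_ac)
    then show ?thesis using M_inv[of w "{u. C (u * v $ i) (u * v $ j)}"] w(2) by simp
  qed
  have Y_line: "line v \<in> Y (i, j) \<longleftrightarrow> v $ i \<noteq> 0 \<or> v $ j \<noteq> 0"
    if v: "v \<in> carrier_vec n" and ij: "i < n" "j < n" for i j v
  proof -
    have "(\<exists>z\<in>line v. z $ i \<noteq> 0 \<or> z $ j \<noteq> 0) \<longleftrightarrow> v $ i \<noteq> 0 \<or> v $ j \<noteq> 0"
      using line_self[of v] v ij by (auto simp: line_def)
    then show ?thesis by (simp add: Y_def)
  qed
  have P_finite: "finite P"
    by (rule finite_subset[of _ "{..<n} \<times> {..<n}"]) (auto simp: P_def)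
  have P_nonempty: "(1, 2) \<in> P" using n_ge_3 by (simp add: P_def)
  have e_carrier: "e p k \<in> carrier G" if "p \<in> P" for p k
    using that by (auto simp: e_def P_def addrow_mat_carrier)
  \<comment> \<open>the three sets of units in question are disjoint by the last property of size relations\<close>
  have packing: "(\<Sum>k<3::nat. \<Phi> p (point (act (e p k) i))) \<le> of_bool (point i \<in> Y p)" if p: "p \<in> P" for p i
  proof -
    obtain a b where ab: "p = (a, b)" "a < n" "b < n" "a \<noteq> b" using p by (auto simp: P_def)
    obtain A where A: "A \<in> carrier G" "point i = line (col A 0)" by (rule point_cases)
    define x y where "x = col A 0 $ a" and "y = col A 0 $ b"
    define T where "T = (\<lambda>k. {u. C (u * x + s k * (u * y)) (u * y)})"
    have \<Phi>T: "\<Phi> p (point (act (e p k) i)) = M (T k)" for k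
    proof -
      have E: "addrow_mat n (s k) a b \<in> carrier G" using ab by (intro addrow_mat_carrier)
      have Am: "A \<in> carrier_mat n n" using in_carrier_mat[OF A(1)] .
      have "point (act (e p k) i) = line (col (addrow_mat n (s k) a b * A) 0)"
        using E A by (simp add: point_act ab(1) e_def line_image_col)
      moreover have "col (addrow_mat n (s k) a b * A) 0 $ a = x + s k * y"
          "col (addrow_mat n (s k) a b * A) 0 $ b = y"
        using ab Am n_ge_3 unfolding addrow_mat[OF Am ab(3), symmetric] by (auto simp: x_def y_def)
      moreover have "col (addrow_mat n (s k) a b * A) 0 \<in> carrier_vec n"
        using col_carrier[OF m_closed[OF E A(1)]] by (simp add: mult_eq)
      ultimately show ?thesis using ab by (simp add: \<Phi>_line T_def algebra_simps)
    qed
    have disj: "T k \<inter> T l = {}" if "k < l" "l < 3" for k l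
      using C_disj[OF that] by (auto simp: T_def)
    have "{..<3::nat} = {0, 1, 2}" by auto
    then have "(\<Sum>k<3::nat. \<Phi> p (point (act (e p k) i))) = M (T 0) + M (T 1) + M (T 2)"
      by (simp add: \<Phi>T)
    also have "\<dots> = M (T 0 \<union> T 1 \<union> T 2)"
      using disj[of 0 1] disj[of 0 2] disj[of 1 2] by (simp add: meanD(4)[OF M] Int_Un_distrib2)
    also have "\<dots> \<le> of_bool (point i \<in> Y p)"
    proof (cases "y = 0")
      case True
      then have "T k = {}" for k using C_nz by (auto simp: T_def)
      then have "M (T 0 \<union> T 1 \<union> T 2) = 0" using meanD(4)[OF M, of "{}" "{}"] by simp
      then show ?thesis by simp
    next
      case False
      then have "point i \<in> Y p" using A ab by (simp add: Y_line col_carrier y_def)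
      then show ?thesis using mean_le_1[OF M] by simp
    qed
    finally show ?thesis .
  qed
  have covering: "1 \<le> \<Phi> p (point i) + \<Phi> (prod.swap p) (point i)" if p: "p \<in> P" and i: "point i \<in> Y p" for p i
  proof -
    obtain a b where ab: "p = (a, b)" "a < n" "b < n" using p by (auto simp: P_def)
    obtain A where A: "A \<in> carrier G" "point i = line (col A 0)" by (rule point_cases)
    define x y where "x = col A 0 $ a" and "y = col A 0 $ b"
    have nz: "x \<noteq> 0 \<or> y \<noteq> 0" using i A ab by (simp add: Y_line col_carrier x_def y_def)
    have "C (u * x) (u * y) \<or> C (u * y) (u * x)" if "u dvd 1" for u
      using that nz by (intro C_total) auto
    then have "1 = M ({u. C (u * x) (u * y)} \<union> {u. C (u * y) (u * x)})"
      by (intro mean_superset[OF M, symmetric]) auto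
    also have "\<dots> \<le> M {u. C (u * x) (u * y)} + M {u. C (u * y) (u * x)}"
      by (rule mean_subadditive[OF M])
    also have "\<dots> = \<Phi> p (point i) + \<Phi> (prod.swap p) (point i)"
      using A ab by (simp add: \<Phi>_line col_carrier x_def y_def)
    finally show ?thesis .
  qed
  \<comment> \<open>an invertible matrix whose first column vanishes below its first entry has a unit there\<close>
  have exhaust: "\<exists>p\<in>P. point i \<in> Y p" if i: "point i \<noteq> base" for i
  proof -
    obtain A where A: "A \<in> carrier G" "point i = line (col A 0)" by (rule point_cases)
    have Am: "A \<in> carrier_mat n n" using in_carrier_mat[OF A(1)] .
    have "\<exists>a. 1 \<le> a \<and> a < n \<and> col A 0 $ a \<noteq> 0"
    proof (rule ccontr)
      assume "\<not> ?thesis"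
      then have z: "A $$ (a, 0) = 0" if "1 \<le> a" "a < n" for a using that Am by auto
      have B: "inv A \<in> carrier_mat n n" using A(1) by (intro in_carrier_mat) simp
      have "inv A * A = 1\<^sub>m n" using A(1) by (simp add: mult_eq[symmetric] one_eq[symmetric])
      then have "1 = (inv A * A) $$ (0, 0)" using n_ge_3 by simp
      also have "\<dots> = (\<Sum>k<n. (inv A) $$ (0, k) * A $$ (k, 0))"
        using B Am n_ge_3 by (simp add: scalar_prod_def atLeast0LessThan)
      also have "\<dots> = (\<Sum>k<n. if k = 0 then (inv A) $$ (0, 0) * A $$ (0, 0) else 0)"
        using z by (intro sum.cong) auto
      also have "\<dots> = (inv A) $$ (0, 0) * A $$ (0, 0)" using n_ge_3 by simp
      finally have "A $$ (0, 0) dvd 1" by (metis dvd_triv_right)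
      moreover have "col A 0 = A $$ (0, 0) \<cdot>\<^sub>v col (1\<^sub>m n) 0"
        using Am z n_ge_3 by (intro eq_vecI) (auto simp: Suc_le_eq)
      ultimately show False using i A(2) line_unit by (simp add: base_def)
    qed
    then obtain a where a: "1 \<le> a" "a < n" "col A 0 $ a \<noteq> 0" by blast
    define b :: nat where "b = (if a = 1 then 2 else 1)"
    have "(a, b) \<in> P" using a n_ge_3 by (auto simp: P_def b_def)
    moreover have "point i \<in> Y (a, b)"
      using a A(1) n_ge_3 by (simp add: A(2) Y_line col_carrier b_def)
    ultimately show ?thesis by blast
  qed
  define x0 where "x0 = to_nat_on lines base"
  have x0: "point x0 = base" unfolding x0_def using countable_lines base_lines by simp
  have e_fix: "act (e p k) x0 = x0" if p: "p \<in> P" for p k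
  proof (rule point_inj)
    obtain a b where ab: "p = (a, b)" "1 \<le> b" "a < n" "b < n" "a \<noteq> b" using p by (auto simp: P_def)
    have "point (act (e p k) x0) = line (col (e p k * 1\<^sub>m n) 0)"
      using e_carrier[OF p] line_image_col[OF _ one_closed] by (simp add: point_act x0 base_def one_eq)
    also have "col (e p k * 1\<^sub>m n) 0 = col (1\<^sub>m n) 0"
      using ab n_ge_3 by (auto simp: e_def intro!: eq_vecI)
    finally show "point (act (e p k) x0) = point x0" by (simp add: x0 base_def)
  qed
  have gap: "l2_norm f \<le> 4 * real (card P) *
      (\<Sum>(p, k)\<in>P \<times> {..<3}. l2_norm (\<lambda>i. translate (e p k) f i - f i))"
    if "f \<in> l2" "f x0 = 0" for f
  proof (rule gap_from_paradox[where \<phi> = "\<lambda>p i. \<Phi> p (point i)" and Y = "\<lambda>p. {i. point i \<in> Y p}"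
        and swap = prod.swap and z = x0])
    show "\<exists>p\<in>P. i \<in> {i. point i \<in> Y p}" if "i \<noteq> x0" for i
      using exhaust[of i] point_inj[of i x0] that x0 by auto
    show "0 \<le> \<Phi> p (point i)" "\<Phi> p (point i) \<le> 1" for p i
      using meanD(1)[OF M] mean_le_1[OF M] by (auto simp: \<Phi>_def Let_def split: prod.split)
    show "{i. point i \<in> Y (prod.swap p)} = {i. point i \<in> Y p}" for p
      by (cases p) (auto simp: Y_def)
  qed (use that P_finite e_carrier packing covering in \<open>auto simp: P_def\<close>)
  have "((1, 2), 0) \<in> P \<times> {..<3::nat}" using P_nonempty by simp
  then have K_nonempty: "P \<times> {..<3::nat} \<noteq> {}" by blast
  interpret gap_action G act "\<lambda>(p, k). e p k" "P \<times> {..<3}" x0 "4 * real (card P)"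
  proof
    show "0 < 4 * real (card P)" using P_finite P_nonempty by (auto simp: card_gt_0_iff)
    show "P \<times> {..<3::nat} \<noteq> {}" by (rule K_nonempty)
  qed (use P_finite e_carrier e_fix gap in \<open>auto simp: case_prod_beta\<close>)
  show ?thesis
    using unitary_rep irreducible traceable infinite_dimensional_ell2[OF infinite_UNIV_nat] by blast
qed

end

end

lemma group_GL: "group (GL n :: 'a::comm_ring_1 mat monoid)"
  unfolding GL_def by (intro monoid.units_group ring.is_monoid ring_mat)

lemma GL_simps:
  "A \<otimes>\<^bsub>GL n\<^esub> B = A * B" "\<one>\<^bsub>GL n\<^esub> = 1\<^sub>m n"
  "carrier (GL n) = Units (ring_mat TYPE('a::comm_ring_1) n ())"
  by (simp_all add: GL_def units_of_def ring_mat_simps)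

lemma det_one_in_GL:
  assumes "A \<in> carrier_mat n n" "det A = (1 :: 'a::comm_ring_1)"
  shows "A \<in> carrier (GL n)"
proof -
  have "1 \<cdot>\<^sub>m 1\<^sub>m n = (1\<^sub>m n :: 'a mat)" by (intro eq_matI) auto
  then show ?thesis
    using adj_mat[OF assms(1)] assms unfolding GL_simps Units_def by (auto simp: ring_mat_simps)
qed

lemma subgroup_SL: "subgroup {A \<in> carrier_mat n n. det A = (1 :: 'a::comm_ring_1)} (GL n)"
proof -
  interpret group "GL n :: 'a mat monoid" by (rule group_GL)
  show ?thesis
  proof (rule subgroupI)
    show "{A \<in> carrier_mat n n. det A = (1 :: 'a)} \<subseteq> carrier (GL n)" using det_one_in_GL by auto
    show "{A \<in> carrier_mat n n. det A = (1 :: 'a)} \<noteq> {}" using one_carrier_mat[of n] det_one by blast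
    fix A B :: "'a mat" assume A: "A \<in> {A \<in> carrier_mat n n. det A = 1}"
    then have AG: "A \<in> carrier (GL n)" using det_one_in_GL by auto
    have im: "inv\<^bsub>GL n\<^esub> A \<in> carrier_mat n n"
      using inv_closed[OF AG] by (auto simp: GL_simps Units_def ring_mat_simps)
    have "det (inv\<^bsub>GL n\<^esub> A * A) = 1" using l_inv[OF AG] by (simp add: GL_simps)
    then have "det (inv\<^bsub>GL n\<^esub> A) = 1" using A det_mult[OF im, of A] by simp
    with im show "inv\<^bsub>GL n\<^esub> A \<in> {A \<in> carrier_mat n n. det A = 1}" by simp
    assume "B \<in> {A \<in> carrier_mat n n. det A = 1}"
    with A show "A \<otimes>\<^bsub>GL n\<^esub> B \<in> {A \<in> carrier_mat n n. det A = 1}" by (auto simp: GL_simps det_mult)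
  qed
qed

lemma linear_group_GL: "3 \<le> n \<Longrightarrow> linear_group (GL n :: 'a::{idom,countable} mat monoid) n"
  by (intro linear_group.intro linear_group_axioms.intro group_GL)
    (auto simp: GL_simps(1,2) det_one_in_GL, auto simp: GL_simps Units_def ring_mat_simps)

lemma linear_group_SL: "3 \<le> n \<Longrightarrow> linear_group (SL n :: 'a::{idom,countable} mat monoid) n"
  unfolding SL_def
  by (intro linear_group.intro linear_group_axioms.intro subgroup.subgroup_is_group[OF subgroup_SL] group_GL)
    (auto simp: GL_simps)

theorem theorem3:
  fixes n :: nat and G :: "'a::{idom,countable} mat monoid"
  assumes "CHAR('a) > 0 \<Longrightarrow> \<not> algebraic_over_prime_field TYPE('a fract)"
    and "n \<ge> 3"
    and "G = GL n \<or> G = SL n"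
  shows "\<exists>(H :: (nat \<Rightarrow> complex) hilbert) \<pi>.
    unitary_rep G H \<pi> \<and> irreducible_rep G H \<pi> \<and> infinite_dimensional H \<and> traceable G H \<pi>"
proof -
  interpret linear_group G n using assms(2,3) linear_group_GL linear_group_SL by auto
  obtain C and s :: "nat \<Rightarrow> 'a" where "size_relation C s" "infinite (UNIV :: 'a set)"
    using size_relation_exists[OF assms(1)] by blast
  then show ?thesis using traceable_representation by blast
qed

end
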